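(* Consider a rigid spherical orthogonal circle pattern, i.e. one with non-degenerate Hessian $\det\big(\partial^2S_{sph}/\partial\beta^0_v\partial\beta^0_{v'}\big)\neq0$, with fixed boundary conditions, together with its deformation to spherical orthogonal ring patterns with $q=1-\epsilon$, $\epsilon>0$ small, with the same combinatorics and boundary data. Then there exists an $\epsilon$-family of associated S$_1$-cmc pairs $\frac1\epsilon s$ and $\frac1\epsilon s^*$ in $\mathbb{R}^3$ with mean curvature $H=\epsilon$. In the limit $\epsilon\to0$ (surfaces being suitably translated), $s$ converges to a classical Koebe net with edges touching the unit sphere, and $\frac1\epsilon s^*$ converges to its dual S$_1$-minimal surface.
   Context: S-quad graph $\mathcal S$: here given by a simply connected set of squares of $\mathbb{Z}^2$, vertices properly bicolored black/white, white vertices labeled s or c ($V_w=V_s\,\dot\cup\,V_c$) so that each quad has one s- and one c-vertex. $\mathcal G$: quad graph with vertices $V_s$, edges $\leftrightarrow$ black vertices, faces $\leftrightarrow V_c$. Edges of $\mathcal G$ are horizontal/vertical alternating around faces; this extends to $\mathcal S$ (edge $(v,b)$ has the color of the $\mathcal G$-edge through $b$ if $v\in V_s$, the opposite one if $v\in V_c$). Spherical orthogonal ring pattern: rings $(p_v,r_v,R_v)$, $v\in V_w$ (concentric circles in $S^2$ with center $p_v$, signed inner spherical radius $r_v$ and outer radius $R_v\in(0,\frac\pi2]$), such that for the two white vertices of each quad the outer circle of each ring intersects the inner circle of the other orthogonally; at each black vertex $b$ the inner circles of the rings at horizontal neighbors of $b$ and the outer circles at vertical neighbors pass through a common point $q_b$;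 and the points $q_b$ around each ring are ordered counterclockwise if $r_v>0$, clockwise if $r_v<0$. There is a global $q\le1$ with $q\cos r_v=\cos R_v$; $q=1$ gives orthogonal circle patterns. Variables: $\cos r_v=\operatorname{sn}(\beta_v,q)$, $\sin r_v=\operatorname{cn}(\beta_v,q)$, $\sin R_v=\operatorname{dn}(\beta_v,q)$, and for $q=1$: $\tanh\beta^0_v=\cos R_v$, $1/\cosh\beta_v^0=\sin R_v$. Patterns are critical points of $$S_{sph}(\beta)=\sum_{(v,v')}\big(F(\beta_v-\beta_{v'})-F(\beta_v+\beta_{v'})\big)+\sum_v\Phi_v\beta_v,\quad F(x)=\int_0^x\arctan\frac{(1+q)\operatorname{sn}\frac u2}{\operatorname{cn}\frac u2\operatorname{dn}\frac u2}\,du$$ (continuous branch; for $q=1$ the integrand is $\arctan\sinh u$), the first sum over pairs of white vertices of a common quad, $\Phi_v$ constants determined by the boundary angles. Boundary conditions: Dirichlet (boundary radii prescribed) or Neumann (boundary cone angles prescribed); the Hessian is taken at $\beta^0$ with respect to the free variables. It is known that a rigid circle pattern has, for small $\epsilon$, a deformation to ring patterns with $q=1-\epsilon$, $\beta(q)\to\beta^0$ as $q\to1$, with the same combinatorics and boundary data. S$_1$-cmc pairs: oriented spheres (center $c$, signed radius $d$) lift to $\hat s=\frac1d(c+e_0+(\|c\|^2-d^2)e_\infty)\in\mathbb{R}^{4,1}$ ($\langle x,y\rangle=x_1y_1+\dots+x_4y_4-x_5y_5$, $e_0=\frac12(e_5-e_4)$, $e_\infty=\frac12(e_4+e_5)$).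 $s$ from $V(\mathcal G)$ to oriented spheres is S$_1$-isothermic if on each face $\hat s_{v_{ij}}-\hat s_v=a_{ij}(\hat s_{v_j}-\hat s_{v_i})$, $a_{ij}\in\mathbb{R}$ ($(v,v_i)$ horizontal, $(v,v_j)$ vertical), and neighboring spheres touch, with $\langle\hat s_v,\hat s_{v'}\rangle=-1$ on horizontal, $+1$ on vertical edges. Christoffel dual: $c^*_{v'}-c^*_v=\lambda\frac{c_{v'}-c_v}{d_vd_{v'}}$, $d_v^*=\lambda/d_v$, $\lambda>0$ global, up to translation. $(s,s^* )$ is an S$_1$-cmc pair if, with suitable $\lambda$ and translation, on all edges $\hat s^*_{v'}-\hat s_v=a_+(\hat s^*_v-\hat s_{v'})$, $a_+\in\mathbb{R}$, possibly after reversing simultaneously all orientations of $s^*$. Associated pair: the ring pattern determines the vertices $k_v=\frac{1}{\sqrt q\cos r_v}p_v$, $v\in V_s$, of a two-sphere Koebe net; the associated S$_1$-cmc pair $(s,s^* )$ (with mean curvature $1$) is the one, unique up to translation, with Gauss map $k$, that is $c-c^*=k$ (the Gauss map $c^*-c$ up to a global sign), with absolute vertex sphere radii $d_v=\frac{1}{2\sqrt q}\frac{\operatorname{dn}\beta_v+\operatorname{cn}\beta_v}{\operatorname{sn}\beta_v}$, $d^*_v=\frac{1}{2\sqrt q}\frac{\operatorname{dn}\beta_v-\operatorname{cn}\beta_v}{\operatorname{sn}\beta_v}$. Scaling the pair by $\mu$ while keeping the Gauss map gives $\mu s,\mu s^*$ of mean curvature $1/\mu$ (discrete mean curvature of a face: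 $-A(c,n)/A(c)$ with $n=c^*-c$ for the unscaled pair, $A(\cdot,\cdot)$ the mixed area). Koebe net: a net with planar faces all of whose edges touch the unit sphere, regarded as an S$_1$-isothermic surface with the vertex spheres orthogonal to the unit sphere. S$_1$-minimal surface: an S$_1$-isothermic surface that is Christoffel dual (up to scaling) to a Koebe net. *)

theory Defs
  imports "HOL-Analysis.Analysis"
begin

section \<open>S-quad graphs in the square lattice\<close>

text \<open>A square is named by its lower left corner. White vertices have even coordinate sum; the
  label s means that both coordinates are even, c that both are odd. Every other choice of colours
  and labels on the square lattice is a translate of this one. The squares form a disc: their union
  is simply connected, and the connected interior forbids squares that hang together only at a
  vertex.\<close>

type_synonym vertex = "int \<times> int"

definition corners :: "int \<times> int \<Rightarrow> vertex set" where
  "corners = (\<lambda>(i, j). {i, i + 1} \<times> {j, j + 1})"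

definition region :: "(int \<times> int) set \<Rightarrow> (real \<times> real) set" where
  "region Q = (\<Union>(i, j)\<in>Q. cbox (of_int i, of_int j) (of_int i + 1, of_int j + 1))"

definition s_quad_graph :: "(int \<times> int) set \<Rightarrow> bool" where
  "s_quad_graph Q \<longleftrightarrow> finite Q \<and> Q \<noteq> {} \<and> simply_connected (region Q) \<and> connected (interior (region Q))"

definition verts :: "(int \<times> int) set \<Rightarrow> vertex set" where
  "verts Q = (\<Union>a\<in>Q. corners a)"

definition s_verts :: "(int \<times> int) set \<Rightarrow> vertex set" where
  "s_verts Q = {v \<in> verts Q. even (fst v) \<and> even (snd v)}"

definition c_verts :: "(int \<times> int) set \<Rightarrow> vertex set" where
  "c_verts Q = {v \<in> verts Q. odd (fst v) \<and> odd (snd v)}"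

definition white :: "(int \<times> int) set \<Rightarrow> vertex set" where
  "white Q = s_verts Q \<union> c_verts Q"

definition black :: "(int \<times> int) set \<Rightarrow> vertex set" where
  "black Q = verts Q - white Q"

definition interior_vertex :: "(int \<times> int) set \<Rightarrow> vertex \<Rightarrow> bool" where
  "interior_vertex Q = (\<lambda>(i, j). {(i, j), (i - 1, j), (i, j - 1), (i - 1, j - 1)} \<subseteq> Q)"

definition boundary_white :: "(int \<times> int) set \<Rightarrow> vertex set" where
  "boundary_white Q = {v \<in> white Q. \<not> interior_vertex Q v}"

text \<open>A black vertex with even second coordinate lies on an edge of the graph \<open>\<G>\<close> parallel to the
  first axis; these are the horizontal edges of \<open>\<G>\<close>. With this choice the colouring of the edges of
  the quad graph (the colour of the edge of \<open>\<G>\<close> through the black vertex at an s-vertex, the opposite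
  one at a c-vertex) is again given by the direction of the edge in the lattice. The other
  alternating colouring is obtained by turning the lattice by a quarter turn.\<close>

definition h_edge :: "(int \<times> int) set \<Rightarrow> vertex \<Rightarrow> vertex \<Rightarrow> bool" where
  "h_edge Q u w \<longleftrightarrow> (\<exists>a\<in>Q. u \<in> corners a \<and> w \<in> corners a) \<and> \<bar>fst u - fst w\<bar> = 1 \<and> snd u = snd w"

definition v_edge :: "(int \<times> int) set \<Rightarrow> vertex \<Rightarrow> vertex \<Rightarrow> bool" where
  "v_edge Q u w \<longleftrightarrow> (\<exists>a\<in>Q. u \<in> corners a \<and> w \<in> corners a) \<and> fst u = fst w \<and> \<bar>snd u - snd w\<bar> = 1"

text \<open>\<open>ccw_quad Q a b c d\<close>: the corners of a square of \<open>Q\<close>, counterclockwise, starting at any corner.\<close>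

definition ccw_quad :: "(int \<times> int) set \<Rightarrow> vertex \<Rightarrow> vertex \<Rightarrow> vertex \<Rightarrow> vertex \<Rightarrow> bool" where
  "ccw_quad Q a b c d \<longleftrightarrow> (\<exists>(i, j)\<in>Q.
     let p = (i, j); p' = (i + 1, j); p'' = (i + 1, j + 1); p''' = (i, j + 1) in
     (a, b, c, d) \<in> {(p, p', p'', p'''), (p', p'', p''', p), (p'', p''', p, p'), (p''', p, p', p'')})"

text \<open>Edges and faces of \<open>\<G>\<close>.\<close>

definition g_hedge :: "(int \<times> int) set \<Rightarrow> vertex \<Rightarrow> vertex \<Rightarrow> bool" where
  "g_hedge Q v w \<longleftrightarrow> v \<in> s_verts Q \<and> w \<in> s_verts Q \<and> v \<noteq> w \<and> (\<exists>b. h_edge Q v b \<and> h_edge Q b w)"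

definition g_vedge :: "(int \<times> int) set \<Rightarrow> vertex \<Rightarrow> vertex \<Rightarrow> bool" where
  "g_vedge Q v w \<longleftrightarrow> v \<in> s_verts Q \<and> w \<in> s_verts Q \<and> v \<noteq> w \<and> (\<exists>b. v_edge Q v b \<and> v_edge Q b w)"

definition g_edge :: "(int \<times> int) set \<Rightarrow> vertex \<Rightarrow> vertex \<Rightarrow> bool" where
  "g_edge Q v w \<longleftrightarrow> g_hedge Q v w \<or> g_vedge Q v w"

definition g_face :: "(int \<times> int) set \<Rightarrow> vertex \<Rightarrow> bool" where
  "g_face Q c \<longleftrightarrow> c \<in> c_verts Q \<and> interior_vertex Q c"


section \<open>Jacobi elliptic functions of modulus \<open>q \<le> 1\<close>\<close>

definition ellF :: "real \<Rightarrow> real \<Rightarrow> real" where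
  "ellF q \<phi> = (LBINT \<theta>=ereal 0..ereal \<phi>. 1 / sqrt (1 - q\<^sup>2 * (sin \<theta>)\<^sup>2))"

text \<open>The amplitude inverts the integral. The side condition is vacuous for \<open>q < 1\<close>; for \<open>q = 1\<close> it
  restricts \<open>\<phi>\<close> to \<open>(-\<pi>/2, \<pi>/2)\<close>, beyond which the integral diverges.\<close>

definition jacobi_am :: "real \<Rightarrow> real \<Rightarrow> real" where
  "jacobi_am q u = (THE \<phi>. (\<forall>\<theta>\<in>closed_segment 0 \<phi>. q\<^sup>2 * (sin \<theta>)\<^sup>2 < 1) \<and> ellF q \<phi> = u)"

definition jacobi_sn :: "real \<Rightarrow> real \<Rightarrow> real" where
  "jacobi_sn u q = sin (jacobi_am q u)"

definition jacobi_cn :: "real \<Rightarrow> real \<Rightarrow> real" where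
  "jacobi_cn u q = cos (jacobi_am q u)"

definition jacobi_dn :: "real \<Rightarrow> real \<Rightarrow> real" where
  "jacobi_dn u q = sqrt (1 - q\<^sup>2 * (sin (jacobi_am q u))\<^sup>2)"


section \<open>Spherical orthogonal ring patterns\<close>

text \<open>\<open>centre\<close>, \<open>rad_in\<close> and \<open>rad_out\<close> are \<open>p\<^sub>v\<close>, \<open>r\<^sub>v\<close> and \<open>R\<^sub>v\<close> at white vertices, \<open>pt\<close> is \<open>q\<^sub>b\<close> at black
  vertices; values elsewhere are irrelevant.\<close>

record ring_pattern =
  centre :: "vertex \<Rightarrow> real^3"
  rad_in :: "vertex \<Rightarrow> real"
  rad_out :: "vertex \<Rightarrow> real"
  pt :: "vertex \<Rightarrow> real^3"

definition on_circle :: "real^3 \<Rightarrow> real \<Rightarrow> real^3 \<Rightarrow> bool" where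
  "on_circle p \<rho> x \<longleftrightarrow> norm x = 1 \<and> x \<bullet> p = cos \<rho>"

text \<open>\<open>cross3 p x\<close> is tangent at \<open>x\<close> to the circle through \<open>x\<close> with centre \<open>p\<close>.\<close>

definition circles_orthogonal :: "real^3 \<Rightarrow> real \<Rightarrow> real^3 \<Rightarrow> real \<Rightarrow> bool" where
  "circles_orthogonal p \<rho> p' \<rho>' \<longleftrightarrow>
     (\<exists>x. on_circle p \<rho> x \<and> on_circle p' \<rho>' x \<and> cross3 p x \<bullet> cross3 p' x = 0)"

definition tangent_part :: "real^3 \<Rightarrow> real^3 \<Rightarrow> real^3" where
  "tangent_part p x = x - (x \<bullet> p) *\<^sub>R p"

definition angle_at :: "real^3 \<Rightarrow> real^3 \<Rightarrow> real^3 \<Rightarrow> real" where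
  "angle_at p x y = arccos (tangent_part p x \<bullet> tangent_part p y
                             / (norm (tangent_part p x) * norm (tangent_part p y)))"

text \<open>\<open>ccw_about p x y\<close>: seen from outside the sphere, the direction from \<open>p\<close> to \<open>y\<close> is obtained from
  that to \<open>x\<close> by a counterclockwise turn by an angle in \<open>(0, \<pi>]\<close>. For two consecutive points of a
  ring the angle is composed of angles of two right-angled spherical triangles with legs at most
  \<open>\<pi>/2\<close>, hence never exceeds \<open>\<pi>\<close>; it equals \<open>\<pi>\<close> only if the neighbouring ring is a great circle.\<close>

definition ccw_about :: "real^3 \<Rightarrow> real^3 \<Rightarrow> real^3 \<Rightarrow> bool" where
  "ccw_about p x y \<longleftrightarrow> p \<bullet> cross3 x y > 0 \<or>
     (p \<bullet> cross3 x y = 0 \<and> tangent_part p x \<bullet> tangent_part p y < 0)"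

definition cone_angle :: "(int \<times> int) set \<Rightarrow> ring_pattern \<Rightarrow> vertex \<Rightarrow> real" where
  "cone_angle Q P v =
     (\<Sum>(b, v', b')\<in>{(b, v', b'). ccw_quad Q v b v' b'}. angle_at (centre P v) (pt P b) (pt P b'))"

text \<open>The last two clauses express that the points of each ring are ordered counterclockwise or
  clockwise according to the sign of \<open>r\<^sub>v\<close>: consecutive points are, and around an interior vertex the
  points go round the ring exactly once.\<close>

definition ring_pattern_on :: "(int \<times> int) set \<Rightarrow> real \<Rightarrow> ring_pattern \<Rightarrow> bool" where
  "ring_pattern_on Q q P \<longleftrightarrow>
     0 < q \<and> q \<le> 1 \<and>
     (\<forall>v\<in>white Q. norm (centre P v) = 1 \<and> 0 < rad_out P v \<and> rad_out P v \<le> pi / 2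
        \<and> \<bar>rad_in P v\<bar> \<le> rad_out P v \<and> q * cos (rad_in P v) = cos (rad_out P v)) \<and>
     (\<forall>v b v' b'. v \<in> white Q \<and> ccw_quad Q v b v' b' \<longrightarrow>
        circles_orthogonal (centre P v) (rad_out P v) (centre P v') (rad_in P v') \<and>
        circles_orthogonal (centre P v) (rad_in P v) (centre P v') (rad_out P v')) \<and>
     (\<forall>v\<in>white Q. \<forall>b\<in>black Q.
        (h_edge Q v b \<longrightarrow> on_circle (centre P v) (rad_in P v) (pt P b)) \<and>
        (v_edge Q v b \<longrightarrow> on_circle (centre P v) (rad_out P v) (pt P b))) \<and>
     (\<forall>v b v' b'. v \<in> white Q \<and> ccw_quad Q v b v' b' \<longrightarrow>
        (rad_in P v > 0 \<longrightarrow> ccw_about (centre P v) (pt P b) (pt P b')) \<and>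
        (rad_in P v < 0 \<longrightarrow> ccw_about (centre P v) (pt P b') (pt P b))) \<and>
     (\<forall>v\<in>white Q. interior_vertex Q v \<and> rad_in P v \<noteq> 0 \<longrightarrow> cone_angle Q P v = 2 * pi)"

definition ring_variables :: "(int \<times> int) set \<Rightarrow> real \<Rightarrow> ring_pattern \<Rightarrow> (vertex \<Rightarrow> real) \<Rightarrow> bool" where
  "ring_variables Q q P \<beta> \<longleftrightarrow> (\<forall>v\<in>white Q.
     cos (rad_in P v) = jacobi_sn (\<beta> v) q \<and> sin (rad_in P v) = jacobi_cn (\<beta> v) q \<and>
     sin (rad_out P v) = jacobi_dn (\<beta> v) q)"

definition circle_pattern_on :: "(int \<times> int) set \<Rightarrow> ring_pattern \<Rightarrow> bool" where
  "circle_pattern_on Q P \<longleftrightarrow> ring_pattern_on Q 1 P \<and> (\<forall>v\<in>white Q. rad_in P v = rad_out P v)"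

definition circle_variables :: "(int \<times> int) set \<Rightarrow> ring_pattern \<Rightarrow> (vertex \<Rightarrow> real) \<Rightarrow> bool" where
  "circle_variables Q P \<beta> \<longleftrightarrow> (\<forall>v\<in>white Q.
     tanh (\<beta> v) = cos (rad_out P v) \<and> 1 / cosh (\<beta> v) = sin (rad_out P v))"


section \<open>The functional for circle patterns and rigidity\<close>

definition F_circ :: "real \<Rightarrow> real" where
  "F_circ x = (LBINT u=ereal 0..ereal x. arctan (sinh u))"

text \<open>Each square has exactly one s- and one c-vertex, and \<open>F_circ\<close> is even, so the first sum runs
  over the unordered pairs of white vertices of a common square.\<close>

definition S_sph :: "(int \<times> int) set \<Rightarrow> (vertex \<Rightarrow> real) \<Rightarrow> (vertex \<Rightarrow> real) \<Rightarrow> real" where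
  "S_sph Q \<Phi> \<beta> =
     (\<Sum>(v, v')\<in>{(v, v'). v \<in> s_verts Q \<and> v' \<in> c_verts Q \<and> (\<exists>b b'. ccw_quad Q v b v' b')}.
        F_circ (\<beta> v - \<beta> v') - F_circ (\<beta> v + \<beta> v'))
     + (\<Sum>v\<in>white Q. \<Phi> v * \<beta> v)"

text \<open>The angle at \<open>v\<close> in a quad with white vertices \<open>v, v'\<close> is
  \<open>\<pi> + arctan sinh (\<beta>\<^sub>v - \<beta>\<^sub>v\<^sub>') - arctan sinh (\<beta>\<^sub>v + \<beta>\<^sub>v\<^sub>')\<close>, so that the pattern is critical for the
  following constants.\<close>

definition Phi :: "(int \<times> int) set \<Rightarrow> ring_pattern \<Rightarrow> vertex \<Rightarrow> real" where
  "Phi Q P v = real (card {a \<in> Q. v \<in> corners a}) * pi - cone_angle Q P v"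

definition partial :: "vertex \<Rightarrow> ((vertex \<Rightarrow> real) \<Rightarrow> real) \<Rightarrow> (vertex \<Rightarrow> real) \<Rightarrow> real" where
  "partial v f \<beta> = deriv (\<lambda>t. f (\<beta>(v := t))) (\<beta> v)"

definition hessian :: "((vertex \<Rightarrow> real) \<Rightarrow> real) \<Rightarrow> (vertex \<Rightarrow> real) \<Rightarrow> vertex \<Rightarrow> vertex \<Rightarrow> real" where
  "hessian f \<beta> v w = partial v (partial w f) \<beta>"

definition det_on :: "'a set \<Rightarrow> ('a \<Rightarrow> 'a \<Rightarrow> real) \<Rightarrow> real" where
  "det_on A M = (\<Sum>p | p permutes A. of_int (sign p) * (\<Prod>i\<in>A. M i (p i)))"

text \<open>\<open>D\<close> is the set of boundary vertices at which the radius is prescribed (Dirichlet); at the other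
  boundary vertices the cone angle is prescribed (Neumann). The variables off \<open>D\<close> are free.\<close>

definition rigid :: "(int \<times> int) set \<Rightarrow> vertex set \<Rightarrow> ring_pattern \<Rightarrow> (vertex \<Rightarrow> real) \<Rightarrow> bool" where
  "rigid Q D P \<beta> \<longleftrightarrow> det_on (white Q - D) (hessian (S_sph Q (Phi Q P)) \<beta>) \<noteq> 0"

text \<open>For \<open>q < 1\<close> a ring cannot keep both radii of a circle; keeping the inner radii, the outer radii
  or the variables \<open>\<beta>\<^sub>v\<close> is admitted.\<close>

definition same_boundary_data ::
  "(int \<times> int) set \<Rightarrow> vertex set \<Rightarrow> ring_pattern \<Rightarrow> (vertex \<Rightarrow> real) \<Rightarrow> ring_pattern \<Rightarrow> (vertex \<Rightarrow> real) \<Rightarrow> bool"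
where
  "same_boundary_data Q D P0 \<beta>0 P \<beta> \<longleftrightarrow>
     ((\<forall>v\<in>D. rad_in P v = rad_in P0 v) \<or> (\<forall>v\<in>D. rad_out P v = rad_out P0 v) \<or> (\<forall>v\<in>D. \<beta> v = \<beta>0 v)) \<and>
     (\<forall>v\<in>boundary_white Q - D. cone_angle Q P v = cone_angle Q P0 v)"

text \<open>The variables \<open>\<beta>\<close> determine a ring pattern only up to a rotation of the sphere. The last clause
  fixes the rotation in the limit, at one edge of the quad graph.\<close>

definition ring_deformation ::
  "(int \<times> int) set \<Rightarrow> vertex set \<Rightarrow> ring_pattern \<Rightarrow> (vertex \<Rightarrow> real) \<Rightarrow>
   (real \<Rightarrow> ring_pattern) \<Rightarrow> (real \<Rightarrow> vertex \<Rightarrow> real) \<Rightarrow> bool"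
where
  "ring_deformation Q D P0 \<beta>0 P \<beta> \<longleftrightarrow>
     (\<forall>\<^sub>F \<epsilon> in at_right 0. ring_pattern_on Q (1 - \<epsilon>) (P \<epsilon>) \<and> ring_variables Q (1 - \<epsilon>) (P \<epsilon>) (\<beta> \<epsilon>)
        \<and> same_boundary_data Q D P0 \<beta>0 (P \<epsilon>) (\<beta> \<epsilon>)) \<and>
     (\<forall>v\<in>white Q. ((\<lambda>\<epsilon>. \<beta> \<epsilon> v) \<longlongrightarrow> \<beta>0 v) (at_right 0)) \<and>
     (\<exists>v\<in>white Q. \<exists>b\<in>black Q. (h_edge Q v b \<or> v_edge Q v b) \<and>
        ((\<lambda>\<epsilon>. centre (P \<epsilon>) v) \<longlongrightarrow> centre P0 v) (at_right 0) \<and>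
        ((\<lambda>\<epsilon>. pt (P \<epsilon>) b) \<longlongrightarrow> pt P0 b) (at_right 0))"


section \<open>S1-isothermic surfaces\<close>

text \<open>An oriented sphere is a pair of centre and signed radius. Scaling of a sphere by \<open>\<mu>\<close> is
  scalar multiplication of the pair.\<close>

type_synonym osphere = "(real^3) \<times> real"

definition reverse :: "osphere \<Rightarrow> osphere" where
  "reverse s = (fst s, - snd s)"

definition lorentz :: "real^5 \<Rightarrow> real^5 \<Rightarrow> real" where
  "lorentz x y = x$1 * y$1 + x$2 * y$2 + x$3 * y$3 + x$4 * y$4 - x$5 * y$5"

definition emb :: "real^3 \<Rightarrow> real^5" where
  "emb c = (c$1) *\<^sub>R axis 1 1 + (c$2) *\<^sub>R axis 2 1 + (c$3) *\<^sub>R axis 3 1"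

definition e_zero :: "real^5" where
  "e_zero = (1/2) *\<^sub>R (axis 5 1 - axis 4 1)"

definition e_inf :: "real^5" where
  "e_inf = (1/2) *\<^sub>R (axis 4 1 + axis 5 1)"

definition lift :: "osphere \<Rightarrow> real^5" where
  "lift s = (1 / snd s) *\<^sub>R (emb (fst s) + e_zero + ((norm (fst s))\<^sup>2 - (snd s)\<^sup>2) *\<^sub>R e_inf)"

text \<open>The two signs select the vertex of the face that plays the role of \<open>v\<close>.\<close>

definition s1_isothermic :: "(int \<times> int) set \<Rightarrow> (vertex \<Rightarrow> osphere) \<Rightarrow> bool" where
  "s1_isothermic Q s \<longleftrightarrow>
     (\<forall>v\<in>s_verts Q. snd (s v) \<noteq> 0) \<and>
     (\<forall>a b. g_face Q (a, b) \<longrightarrow> (\<forall>\<sigma>\<in>{1, -1}. \<forall>\<tau>\<in>{1, -1}. \<exists>r::real.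
        lift (s (a + \<sigma>, b + \<tau>)) - lift (s (a - \<sigma>, b - \<tau>))
          = r *\<^sub>R (lift (s (a - \<sigma>, b + \<tau>)) - lift (s (a + \<sigma>, b - \<tau>))))) \<and>
     (\<forall>v w. g_hedge Q v w \<longrightarrow> lorentz (lift (s v)) (lift (s w)) = -1) \<and>
     (\<forall>v w. g_vedge Q v w \<longrightarrow> lorentz (lift (s v)) (lift (s w)) = 1)"

definition christoffel_dual ::
  "(int \<times> int) set \<Rightarrow> real \<Rightarrow> (vertex \<Rightarrow> osphere) \<Rightarrow> (vertex \<Rightarrow> osphere) \<Rightarrow> bool"
where
  "christoffel_dual Q l s s' \<longleftrightarrow>
     (\<forall>v\<in>s_verts Q. snd (s' v) = l / snd (s v)) \<and>
     (\<forall>v w. g_edge Q v w \<longrightarrow>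
        fst (s' w) - fst (s' v) = (l / (snd (s v) * snd (s w))) *\<^sub>R (fst (s w) - fst (s v)))"

definition s1_cmc_pair :: "(int \<times> int) set \<Rightarrow> (vertex \<Rightarrow> osphere) \<Rightarrow> (vertex \<Rightarrow> osphere) \<Rightarrow> bool" where
  "s1_cmc_pair Q s s' \<longleftrightarrow>
     s1_isothermic Q s \<and> s1_isothermic Q s' \<and> (\<exists>l>0. christoffel_dual Q l s s') \<and>
     (\<exists>t\<in>{s', \<lambda>v. reverse (s' v)}. \<forall>v w. g_edge Q v w \<longrightarrow>
        (\<exists>r::real. lift (t w) - lift (s v) = r *\<^sub>R (lift (t v) - lift (s w))))"

text \<open>Vector-valued mixed area of two quadrilaterals with parallel edges, as a multiple of the common
  unit normal: the polarisation of the oriented area \<open>1/2 (f\<^sub>3 - f\<^sub>1) \<times> (f\<^sub>4 - f\<^sub>2)\<close>.\<close>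

definition mixed_area ::
  "(real^3) \<times> (real^3) \<times> (real^3) \<times> (real^3) \<Rightarrow> (real^3) \<times> (real^3) \<times> (real^3) \<times> (real^3) \<Rightarrow> real^3"
where
  "mixed_area = (\<lambda>(f1, f2, f3, f4) (g1, g2, g3, g4).
     (1/4) *\<^sub>R (cross3 (f3 - f1) (g4 - g2) + cross3 (g3 - g1) (f4 - f2)))"

definition face_quad :: "vertex \<Rightarrow> (vertex \<Rightarrow> real^3) \<Rightarrow> (real^3) \<times> (real^3) \<times> (real^3) \<times> (real^3)" where
  "face_quad = (\<lambda>(a, b) f. (f (a - 1, b - 1), f (a + 1, b - 1), f (a + 1, b + 1), f (a - 1, b + 1)))"

definition has_mean_curvature ::
  "(int \<times> int) set \<Rightarrow> (vertex \<Rightarrow> real^3) \<Rightarrow> (vertex \<Rightarrow> real^3) \<Rightarrow> real \<Rightarrow> bool"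
where
  "has_mean_curvature Q c n H \<longleftrightarrow> (\<forall>x. g_face Q x \<longrightarrow>
     mixed_area (face_quad x c) (face_quad x c) \<noteq> 0 \<and>
     mixed_area (face_quad x c) (face_quad x n) = - H *\<^sub>R mixed_area (face_quad x c) (face_quad x c))"

definition koebe_vertex :: "real \<Rightarrow> ring_pattern \<Rightarrow> vertex \<Rightarrow> real^3" where
  "koebe_vertex q P v = (1 / (sqrt q * cos (rad_in P v))) *\<^sub>R centre P v"

text \<open>The signs of the radii alternate along vertical edges, so only their absolute values are given
  by the pattern.\<close>

definition associated_pair ::
  "(int \<times> int) set \<Rightarrow> real \<Rightarrow> ring_pattern \<Rightarrow> (vertex \<Rightarrow> real) \<Rightarrow>
   (vertex \<Rightarrow> osphere) \<Rightarrow> (vertex \<Rightarrow> osphere) \<Rightarrow> bool"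
where
  "associated_pair Q q P \<beta> s s' \<longleftrightarrow>
     s1_cmc_pair Q s s' \<and>
     has_mean_curvature Q (\<lambda>v. fst (s v)) (\<lambda>v. fst (s' v) - fst (s v)) 1 \<and>
     (\<forall>v\<in>s_verts Q.
        fst (s v) - fst (s' v) = koebe_vertex q P v \<and>
        \<bar>snd (s v)\<bar> = 1 / (2 * sqrt q) * ((jacobi_dn (\<beta> v) q + jacobi_cn (\<beta> v) q) / jacobi_sn (\<beta> v) q) \<and>
        \<bar>snd (s' v)\<bar> = 1 / (2 * sqrt q) * ((jacobi_dn (\<beta> v) q - jacobi_cn (\<beta> v) q) / jacobi_sn (\<beta> v) q))"

definition koebe_net :: "(int \<times> int) set \<Rightarrow> (vertex \<Rightarrow> osphere) \<Rightarrow> bool" where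
  "koebe_net Q s \<longleftrightarrow>
     s1_isothermic Q s \<and>
     (\<forall>a b. g_face Q (a, b) \<longrightarrow>
        coplanar {fst (s (a - 1, b - 1)), fst (s (a + 1, b - 1)), fst (s (a + 1, b + 1)), fst (s (a - 1, b + 1))}) \<and>
     (\<forall>v w. g_edge Q v w \<longrightarrow>
        (\<exists>x\<in>closed_segment (fst (s v)) (fst (s w)). norm x = 1 \<and> x \<bullet> (fst (s w) - fst (s v)) = 0)) \<and>
     (\<forall>v\<in>s_verts Q. (norm (fst (s v)))\<^sup>2 = 1 + (snd (s v))\<^sup>2)"

definition s1_minimal :: "(int \<times> int) set \<Rightarrow> (vertex \<Rightarrow> osphere) \<Rightarrow> bool" where
  "s1_minimal Q m \<longleftrightarrow> s1_isothermic Q m \<and> (\<exists>k l. koebe_net Q k \<and> l > 0 \<and> christoffel_dual Q l k m)"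

end

theory Submission
  imports Defs
begin

text \<open>For \<open>q < 1\<close> the Koebe net \<open>k\<close> of the ring pattern has faces whose horizontal and vertical edges touch
  two concentric circles. Averaging \<open>k\<close> with the net in which these circles are exchanged gives a
  quadrilateral tangential to one circle: a face of \<open>c\<close>, with tangent lengths \<open>d\<close>. Its
  Christoffel dual, with constant \<open>\<lambda> = (1 - q\<^sup>2) / 4 q\<close>, is a face of \<open>c\<^sup>*\<close>, so \<open>c\<^sup>*\<close> is the
  potential of the form \<open>\<omega>(v, w) = \<lambda> / (d\<^sub>v d\<^sub>w - \<lambda>) (k\<^sub>w - k\<^sub>v)\<close>, which is closed around the faces and hence
  exact. Fixing \<open>c - c\<^sup>* = k\<close> gives the pair, and since \<open>\<lambda> / \<epsilon>\<close> tends to \<open>1/2\<close>, the limits of \<open>c\<close> and \<open>c\<^sup>* / \<epsilon>\<close> are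
  the Koebe net of the circle pattern and its dual.\<close>

section \<open>Connectivity of the graph and of its complement\<close>

text \<open>The form \<open>\<omega>\<close> is forced: if the Gauss map is \<open>k\<close> and the
  dual edge is \<open>\<lambda> / (d_v d_w)\<close> times the edge of \<open>c\<close>, then
  \<open>(1 - \<lambda> / (d_v d_w)) (c_w - c_v) = k_w - k_v\<close>. The constant is the product of
  the two prescribed radii, \<open>(S' + S) (S' - S) / (4 q C^2)\<close>, where
  \<open>S'^2 - S^2 = (1 - q^2) C^2\<close>. Two obstacles shape the proof. Closedness is available
  only at complete faces, while the boundary of the graph has incomplete ones; exactness therefore
  rests on the topology of the region, used in the form that missing squares are linked to infinity.
  Moreover the potential has to depend continuously on the form, so it is written as one explicit
  expression rather than chosen anew for each \<open>\<epsilon>\<close>. Secondly, a ring pattern is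
  described partly by orders of points, which need not survive a limit. They are first converted
  into vector identities for right-angled spherical triangles. These pass to \<open>q = 1\<close>,
  so that the same lemmas treat the patterns with \<open>q < 1\<close> and their limit. Convergence
  of the positions is obtained from the radii and one fixed edge by propagation through the
  squares.\<close>

definition cell :: "int \<times> int \<Rightarrow> (real \<times> real) set" where
  "cell = (\<lambda>(i, j). cbox (of_int i, of_int j) (of_int i + 1, of_int j + 1))"

definition cell_adj :: "int \<times> int \<Rightarrow> int \<times> int \<Rightarrow> bool" where
  "cell_adj a b \<longleftrightarrow> (fst a = fst b \<and> \<bar>snd a - snd b\<bar> = 1) \<or> (snd a = snd b \<and> \<bar>fst a - fst b\<bar> = 1)"

text \<open>Chains pass through common sides only, not through corners. The relation is reflexive
  even at squares outside \<open>S\<close>.\<close>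

definition linked :: "(int \<times> int) set \<Rightarrow> int \<times> int \<Rightarrow> int \<times> int \<Rightarrow> bool" where
  "linked S = (\<lambda>a b. a \<in> S \<and> b \<in> S \<and> cell_adj a b)\<^sup>*\<^sup>*"

lemma mem_cell: "x \<in> cell (i, j) \<longleftrightarrow>
    of_int i \<le> fst x \<and> fst x \<le> of_int i + 1 \<and> of_int j \<le> snd x \<and> snd x \<le> of_int j + 1"
  by (cases x) (auto simp: cell_def cbox_Pair_eq)

lemma region_eq_Union_cell: "region Q = (\<Union>a\<in>Q. cell a)"
  by (simp add: region_def cell_def)

lemma linked_refl: "linked S a a"
  by (simp add: linked_def)

lemma linked_trans: "linked S a b \<Longrightarrow> linked S b c \<Longrightarrow> linked S a c"
  by (simp add: linked_def)

lemma cell_adj_sym: "cell_adj a b \<Longrightarrow> cell_adj b a"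
  by (auto simp: cell_adj_def)

lemma linked_sym: "linked S a b \<Longrightarrow> linked S b a"
  unfolding linked_def
  by (induction rule: rtranclp_induct) (auto intro: converse_rtranclp_into_rtranclp cell_adj_sym)

lemma linked_step: "a \<in> S \<Longrightarrow> b \<in> S \<Longrightarrow> cell_adj a b \<Longrightarrow> linked S a b"
  by (auto simp: linked_def)

text \<open>From \<open>(i, j)\<close> the chain goes to \<open>(k, j)\<close> and then to
  \<open>(k, l)\<close>: the intermediate square also contains \<open>x\<close>, and two squares
  with a common point differ by at most one in each coordinate.\<close>

lemma linked_common_point:
  assumes a: "x \<in> cell a" and b: "x \<in> cell b" and S: "\<And>c. x \<in> cell c \<Longrightarrow> c \<in> S"
  shows "linked S a b"
proof -
  obtain i j k l where ab: "a = (i, j)" "b = (k, l)"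
    by (cases a, cases b) auto
  have c: "(k, j) \<in> S" "a \<in> S" "b \<in> S"
    using a b S unfolding ab mem_cell by (auto simp: mem_cell)
  have "real_of_int i \<le> of_int (k + 1)" "real_of_int k \<le> of_int (i + 1)"
    "real_of_int j \<le> of_int (l + 1)" "real_of_int l \<le> of_int (j + 1)"
    using a b unfolding ab mem_cell by auto
  then have "\<bar>i - k\<bar> \<le> 1" "\<bar>j - l\<bar> \<le> 1"
    unfolding of_int_le_iff by auto
  then have "linked S a (k, j)" "linked S (k, j) b"
    using c unfolding ab by (cases "i = k"; cases "j = l"; force simp: cell_adj_def intro: linked_refl linked_step)+
  then show ?thesis
    by (rule linked_trans)
qed

definition cell_of :: "real \<times> real \<Rightarrow> int \<times> int" where
  "cell_of x = (\<lfloor>fst x\<rfloor>, \<lfloor>snd x\<rfloor>)"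

lemma mem_cell_of: "x \<in> cell (cell_of x)"
  unfolding cell_of_def mem_cell by linarith

text \<open>Rounding down is discontinuous, but the closed square selected by a nearby point still
  contains \<open>x\<close>. This is the local step of the connectedness argument.\<close>

lemma cell_of_nearby: "\<exists>e>0. \<forall>y\<in>ball x e. x \<in> cell (cell_of y)"
proof -
  have *: "\<exists>e>0. \<forall>t. \<bar>t - s\<bar> < e \<longrightarrow> of_int \<lfloor>t\<rfloor> \<le> s \<and> s \<le> of_int \<lfloor>t\<rfloor> + 1" for s :: real
  proof (intro exI conjI allI impI)
    \<comment> \<open>The distances from \<open>s\<close> to the integers strictly above and
      strictly below it, which stay positive when \<open>s\<close> is itself an integer.\<close>
    show "0 < min (of_int \<lfloor>s\<rfloor> + 1 - s) (s - of_int \<lceil>s\<rceil> + 1)" by linarith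
    fix t assume t: "\<bar>t - s\<bar> < min (of_int \<lfloor>s\<rfloor> + 1 - s) (s - of_int \<lceil>s\<rceil> + 1)"
    then have "t < of_int (\<lfloor>s\<rfloor> + 1)" "of_int (\<lceil>s\<rceil> - 1) \<le> t"
      unfolding of_int_add of_int_diff of_int_1 by linarith+
    then have "\<lfloor>t\<rfloor> \<le> \<lfloor>s\<rfloor>" "\<lceil>s\<rceil> - 1 \<le> \<lfloor>t\<rfloor>"
      by (simp_all only: floor_less_iff[symmetric] le_floor_iff[symmetric])
    then show "of_int \<lfloor>t\<rfloor> \<le> s" "s \<le> of_int \<lfloor>t\<rfloor> + 1"
      by linarith+
  qed
  obtain e1 e2 where e: "e1 > 0" "e2 > 0"
    and 1: "\<And>t. \<bar>t - fst x\<bar> < e1 \<Longrightarrow> of_int \<lfloor>t\<rfloor> \<le> fst x \<and> fst x \<le> of_int \<lfloor>t\<rfloor> + 1"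
    and 2: "\<And>t. \<bar>t - snd x\<bar> < e2 \<Longrightarrow> of_int \<lfloor>t\<rfloor> \<le> snd x \<and> snd x \<le> of_int \<lfloor>t\<rfloor> + 1"
    using *[of "fst x"] *[of "snd x"] by blast
  show ?thesis
  proof (intro exI conjI ballI)
    show "min e1 e2 > 0" using e by simp
    fix y assume "y \<in> ball x (min e1 e2)"
    then have "dist (fst y) (fst x) < e1" "dist (snd y) (snd x) < e2"
      using dist_fst_le[of y x] dist_snd_le[of y x] by (auto simp: dist_commute)
    then show "x \<in> cell (cell_of y)"
      using 1[of "fst y"] 2[of "snd y"] by (auto simp: cell_of_def mem_cell dist_real_def)
  qed
qed

text \<open>Linkedness of the selected squares is an equivalence relation that is locally constant
  along \<open>X\<close>, since the squares selected near \<open>z\<close> all contain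
  \<open>z\<close>. It serves for the interior of the region as well as for its complement.\<close>

lemma connected_imp_linked:
  assumes X: "connected X" and S: "\<And>x c. x \<in> X \<Longrightarrow> x \<in> cell c \<Longrightarrow> c \<in> S"
    and x: "x \<in> X" "x \<in> cell a" and y: "y \<in> X" "y \<in> cell b"
  shows "linked S a b"
proof -
  have "linked S (cell_of x) (cell_of y)"
  proof (rule connected_equivalence_relation[OF X x(1) y(1)])
    fix z assume z: "z \<in> X"
    obtain e where e: "e > 0" "\<forall>y\<in>ball z e. z \<in> cell (cell_of y)"
      using cell_of_nearby by blast
    show "\<exists>T. openin (top_of_set X) T \<and> z \<in> T \<and> (\<forall>w\<in>T. linked S (cell_of z) (cell_of w))"
    proof (intro exI conjI ballI)
      show "openin (top_of_set X) (X \<inter> ball z e)" by (simp add: openin_open_Int)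
      show "z \<in> X \<inter> ball z e" using z e by simp
      fix w assume "w \<in> X \<inter> ball z e"
      then show "linked S (cell_of z) (cell_of w)"
        using e S[OF z] by (intro linked_common_point[of z]) (auto intro: mem_cell_of)
    qed
  qed (auto intro: linked_sym linked_trans)
  moreover have "linked S a (cell_of x)" "linked S (cell_of y) b"
    using linked_common_point[OF x(2) mem_cell_of S[OF x(1)]]
      linked_common_point[OF mem_cell_of y(2) S[OF y(1)]] by auto
  ultimately show ?thesis
    by (meson linked_trans)
qed

lemma cell_mid: "(of_int i + 1/2, of_int j + 1/2) \<in> cell (k, l) \<longleftrightarrow> (k, l) = (i, j)"
proof
  assume "(of_int i + 1/2, of_int j + 1/2) \<in> cell (k, l)"
  then have "real_of_int k < of_int (i + 1)" "real_of_int i < of_int (k + 1)"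
    "real_of_int l < of_int (j + 1)" "real_of_int j < of_int (l + 1)"
    unfolding mem_cell by auto
  then show "(k, l) = (i, j)"
    unfolding of_int_less_iff by simp
qed (simp add: mem_cell)

text \<open>Moving from \<open>x\<close> a little towards the midpoint of the square stays in a ball
  inside the region but enters the open square, which no other square meets.\<close>

lemma interior_cell_subset:
  assumes "x \<in> interior (region Q)" "x \<in> cell c"
  shows "c \<in> Q"
proof -
  obtain i j where c: "c = (i, j)" by (cases c)
  define m where "m = (real_of_int i + 1/2, real_of_int j + 1/2)"
  obtain e where e: "e > 0" "ball x e \<subseteq> region Q"
    using assms(1) by (meson mem_interior)
  define u where "u = (1/2) * min 1 (e / (norm (m - x) + 1))"
  define y where "y = x + u *\<^sub>R (m - x)"
  have n: "norm (m - x) + 1 > 0" by (simp add: add_nonneg_pos)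
  have u: "0 < u" "u \<le> 1/2" using e n by (auto simp: u_def)
  have "u * norm (m - x) < e"
  proof -
    have "u \<le> (1/2) * (e / (norm (m - x) + 1))"
      unfolding u_def by (rule mult_left_mono) simp_all
    then have "u * (norm (m - x) + 1) \<le> e / 2" using n by (simp add: field_simps)
    moreover have "u * norm (m - x) \<le> u * (norm (m - x) + 1)" using u by simp
    ultimately show ?thesis using e by linarith
  qed
  then have "y \<in> ball x e"
    using u by (simp add: y_def dist_norm)
  then obtain k l where kl: "(k, l) \<in> Q" "y \<in> cell (k, l)"
    using e by (auto simp: region_eq_Union_cell)
  have strict: "of_int a < s + u * (of_int a + 1/2 - s) \<and> s + u * (of_int a + 1/2 - s) < of_int a + 1"
    if "of_int a \<le> s" "s \<le> of_int a + 1" for a :: int and s :: real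
  proof -
    have "(1 - u) * (s - of_int a) \<ge> 0" "(1 - u) * (of_int a + 1 - s) \<ge> 0"
      using u that by auto
    then show ?thesis using u(1) by (simp add: algebra_simps)
  qed
  have "of_int i < fst y \<and> fst y < of_int i + 1" "of_int j < snd y \<and> snd y < of_int j + 1"
    using assms(2) strict[of i "fst x"] strict[of j "snd x"] unfolding c mem_cell y_def m_def by auto
  with kl(2) have "real_of_int k < of_int (i + 1)" "real_of_int i < of_int (k + 1)"
    "real_of_int l < of_int (j + 1)" "real_of_int j < of_int (l + 1)"
    unfolding mem_cell by auto
  then have "k = i" "l = j"
    unfolding of_int_less_iff by simp_all
  with kl c show ?thesis by simp
qed

lemma mid_in_interior: "(i, j) \<in> Q \<Longrightarrow> (of_int i + 1/2, of_int j + 1/2) \<in> interior (region Q)"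
proof (rule interiorI)
  show "open (box (real_of_int i, real_of_int j) (of_int i + 1, of_int j + 1))" by (rule open_box)
  show "(real_of_int i + 1/2, real_of_int j + 1/2) \<in> box (real_of_int i, real_of_int j) (of_int i + 1, of_int j + 1)"
    by (auto simp: mem_box Basis_prod_def)
  assume "(i, j) \<in> Q"
  then show "box (real_of_int i, real_of_int j) (of_int i + 1, of_int j + 1) \<subseteq> region Q"
    using box_subset_cbox by (fastforce simp: region_eq_Union_cell cell_def)
qed

lemma s_quad_graph_linked:
  assumes "s_quad_graph Q" "a \<in> Q" "b \<in> Q"
  shows "linked Q a b"
proof -
  obtain i j k l where ab: "a = (i, j)" "b = (k, l)" by (cases a, cases b)
  show ?thesis
  proof (rule connected_imp_linked)
    show "connected (interior (region Q))" using assms(1) by (simp add: s_quad_graph_def)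
    show "(of_int i + 1/2, of_int j + 1/2) \<in> cell a" "(of_int k + 1/2, of_int l + 1/2) \<in> cell b"
      by (auto simp: ab cell_mid)
    show "(of_int i + 1/2, of_int j + 1/2) \<in> interior (region Q)"
      "(of_int k + 1/2, of_int l + 1/2) \<in> interior (region Q)"
      using assms ab by (auto intro: mid_in_interior)
  qed (rule interior_cell_subset)
qed

text \<open>A finite union of closed convex sets is an absolute neighbourhood retract, hence locally
  path connected; with simple connectivity this gives the Borsukian property. It yields both the
  connected complement and the unicoherence used against pinches.\<close>

lemma s_quad_graph_Borsukian:
  assumes "s_quad_graph Q"
  shows "Borsukian (region Q)"
proof (rule simply_connected_imp_Borsukian)
  show "simply_connected (region Q)" using assms by (simp add: s_quad_graph_def)
  have "ANR (\<Union>(cell ` Q))"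
    using assms by (intro ANR_finite_Union_convex_closed) (auto simp: s_quad_graph_def cell_def)
  then show "locally path_connected (region Q)"
    by (simp add: region_eq_Union_cell ANR_imp_locally_path_connected)
qed

lemma compact_region: "finite Q \<Longrightarrow> compact (region Q)"
  by (auto simp: region_eq_Union_cell cell_def split: prod.splits intro!: compact_UN)

text \<open>A compact Borsukian set does not separate the plane. The separation theorem concerns
  complex numbers, so the region is transported by \<open>h\<close> and the complement back by
  \<open>g\<close>.\<close>

lemma s_quad_graph_connected_Compl:
  assumes "s_quad_graph Q"
  shows "connected (- region Q)"
proof -
  define h where "h = (\<lambda>x::real \<times> real. Complex (fst x) (snd x))"
  define g where "g = (\<lambda>z. (Re z, Im z))"
  have gh: "g (h x) = x" "h (g w) = w" for x w
    by (simp_all add: g_def h_def)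
  have "continuous_on UNIV h" "continuous_on UNIV g"
    unfolding h_def g_def Complex_eq by (intro continuous_intros)+
  then have hg: "homeomorphism UNIV UNIV h g"
    using gh by (intro homeomorphismI) simp_all
  have "region Q homeomorphic h ` region Q"
    unfolding homeomorphic_def
    using homeomorphism_of_subsets[OF hg subset_UNIV subset_UNIV refl] by (intro exI)
  then have "Borsukian (h ` region Q)"
    by (rule homeomorphic_Borsukian[OF s_quad_graph_Borsukian[OF assms]])
  moreover have "compact (h ` region Q)"
    using assms compact_region homeomorphism_cont1[OF hg]
    by (meson compact_continuous_image continuous_on_subset s_quad_graph_def subset_UNIV)
  ultimately have "connected (- (h ` region Q))"
    using Borsukian_separation_compact by blast
  then have "connected (g ` (- (h ` region Q)))"
    using homeomorphism_cont2[OF hg] by (meson connected_continuous_image continuous_on_subset subset_UNIV)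
  moreover have "g ` (- (h ` region Q)) = - region Q"
  proof -
    have h: "h x \<in> h ` region Q \<longleftrightarrow> x \<in> region Q" for x
      by (metis gh(1) imageE imageI)
    show ?thesis
    proof (intro equalityI subsetI)
      fix x assume "x \<in> - region Q"
      then show "x \<in> g ` (- (h ` region Q))"
        using gh(1)[of x] h[of x] by (intro image_eqI[of _ _ "h x"]) simp_all
    next
      fix x assume "x \<in> g ` (- (h ` region Q))"
      then obtain w where "x = g w" "w \<notin> h ` region Q" by blast
      then show "x \<in> - region Q" using h[of x] gh(2)[of w] by simp
    qed
  qed
  ultimately show ?thesis by simp
qed

lemma s_quad_graph_Compl_linked:
  assumes "s_quad_graph Q" "a \<notin> Q" "b \<notin> Q"
  shows "linked (- Q) a b"
proof -
  obtain i j k l where ab: "a = (i, j)" "b = (k, l)" by (cases a, cases b)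
  show ?thesis
  proof (rule connected_imp_linked[OF s_quad_graph_connected_Compl[OF assms(1)]])
    show "(of_int i + 1/2, of_int j + 1/2) \<in> cell a" "(of_int k + 1/2, of_int l + 1/2) \<in> cell b"
      by (auto simp: ab cell_mid)
    show "(of_int i + 1/2, of_int j + 1/2) \<in> - region Q" "(of_int k + 1/2, of_int l + 1/2) \<in> - region Q"
      using assms ab by (auto simp: region_eq_Union_cell cell_mid)
  qed (auto simp: region_eq_Union_cell)
qed

text \<open>The region is unicoherent. It is the union of the two cells at the pinch and of what remains of it
  outside a small square about the pinch; both sets are closed and connected, but their intersection
  falls into two pieces.\<close>

lemma no_pinch_aux:
  assumes Q: "s_quad_graph Q"
    and z: "z = (of_int x, of_int y)"
    and ab: "a \<in> Q" "b \<in> Q" "z \<in> cell a" "z \<in> cell b" "cell a \<inter> cell b \<subseteq> {z}"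
    and other: "\<And>c. c \<in> Q \<Longrightarrow> z \<in> cell c \<Longrightarrow> c = a \<or> c = b"
  shows False
proof -
  \<comment> \<open>Half-side \<open>1/4\<close> keeps \<open>B\<close> away from the midpoints of
    lattice edges and of squares, and lets it meet only squares that contain
    \<open>z\<close>.\<close>
  define B where "B = {p :: real \<times> real. \<bar>fst p - of_int x\<bar> < 1/4 \<and> \<bar>snd p - of_int y\<bar> < 1/4}"
  define U where "U = region Q - B"
  have clcell: "closed (cell c)" "convex (cell c)" for c
    by (auto simp: cell_def split: prod.splits)
  have opB: "open B"
    unfolding B_def by (intro open_Collect_conj open_Collect_less continuous_intros)
  have near: "z \<in> cell c" if "p \<in> cell c" "p \<in> B" for p c
  proof -
    obtain i j where c: "c = (i, j)" by (cases c)
    have "real_of_int i < of_int (x + 1)" "real_of_int x < of_int (i + 2)"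
      "real_of_int j < of_int (y + 1)" "real_of_int y < of_int (j + 2)"
      using that unfolding c mem_cell B_def mem_Collect_eq abs_less_iff of_int_add of_int_1 of_int_numeral
      by linarith+
    then have "i \<le> x" "x \<le> i + 1" "j \<le> y" "y \<le> j + 1"
      unfolding of_int_less_iff by simp_all
    then have "real_of_int i \<le> of_int x" "real_of_int x \<le> of_int (i + 1)"
      "real_of_int j \<le> of_int y" "real_of_int y \<le> of_int (j + 1)"
      unfolding of_int_le_iff by simp_all
    then show ?thesis by (simp add: c z mem_cell)
  qed
  \<comment> \<open>A square with one corner cut away is the union of two rectangles that share the
    opposite corner.\<close>
  have piece: "connected (cell c - B)" for c
  proof (cases "z \<in> cell c")
    case False
    then have "cell c - B = cell c" using near by blast
    then show ?thesis by (simp add: clcell convex_connected)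
  next
    case True
    obtain i j where c: "c = (i, j)" by (cases c)
    have "real_of_int i \<le> of_int x" "real_of_int x \<le> of_int (i + 1)"
      "real_of_int j \<le> of_int y" "real_of_int y \<le> of_int (j + 1)"
      using True unfolding c mem_cell z by auto
    then have ij: "i = x \<or> i = x - 1" "j = y \<or> j = y - 1"
      unfolding of_int_le_iff by linarith+
    define s :: real where "s = (if i = x then 1 else -1)"
    define t :: real where "t = (if j = y then 1 else -1)"
    have 1: "\<bar>fst p - of_int x\<bar> = s * (fst p - of_int x) \<and> \<bar>snd p - of_int y\<bar> = t * (snd p - of_int y)" if "p \<in> cell c" for p
      using that ij unfolding c mem_cell s_def t_def by auto
    have eq: "cell c - B = (cell c \<inter> {p :: real \<times> real. s * (fst p - of_int x) \<ge> 1/4}) \<union> (cell c \<inter> {p :: real \<times> real. t * (snd p - of_int y) \<ge> 1/4})"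
      using 1 unfolding B_def by force
    have h: "convex {p :: real \<times> real. s * (fst p - of_int x) \<ge> 1/4}" "convex {p :: real \<times> real. t * (snd p - of_int y) \<ge> 1/4}"
    proof -
      have "{p :: real \<times> real. s * (fst p - of_int x) \<ge> 1/4} = {p. inner (s, 0) p \<ge> 1/4 + s * of_int x}"
           "{p :: real \<times> real. t * (snd p - of_int y) \<ge> 1/4} = {p. inner (0, t) p \<ge> 1/4 + t * of_int y}"
        by (auto simp: algebra_simps)
      then show "convex {p :: real \<times> real. s * (fst p - of_int x) \<ge> 1/4}" "convex {p :: real \<times> real. t * (snd p - of_int y) \<ge> 1/4}"
        by (simp_all only: convex_halfspace_ge)
    qed
    have far: "(of_int x + s, of_int y + t) \<in> cell c"
      using ij unfolding c mem_cell s_def t_def by auto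
    have "s * s = 1" "t * t = 1" by (auto simp: s_def t_def)
    then have "(of_int x + s, of_int y + t) \<in> (cell c \<inter> {p :: real \<times> real. s * (fst p - of_int x) \<ge> 1/4}) \<inter> (cell c \<inter> {p :: real \<times> real. t * (snd p - of_int y) \<ge> 1/4})"
      using far by simp
    then show ?thesis
      unfolding eq using h clcell by (intro connected_Un convex_connected convex_Int) blast+
  qed
  have UQ: "cell c - B \<subseteq> U" if "c \<in> Q" for c
    using that by (auto simp: U_def region_eq_Union_cell)
  \<comment> \<open>Connected pieces are joined along a chain: consecutive squares share the
    midpoint of their common side, which lies outside \<open>B\<close>.\<close>
  have conn: "\<forall>p\<in>cell c - B. \<forall>p'\<in>cell c' - B. connected_component U p p'" if "linked Q c c'" "c \<in> Q" for c c'
    using that(1) unfolding linked_def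
  proof (induction rule: rtranclp_induct)
    case base
    then show ?case using piece[of c] UQ[OF that(2)] by (auto intro: connected_componentI)
  next
    case (step c1 c2)
    obtain i j k l where c12: "c1 = (i, j)" "c2 = (k, l)" by (cases c1, cases c2)
    have "\<exists>m. m \<in> cell c1 - B \<and> m \<in> cell c2 - B"
    proof -
      have m: "(of_int i + 1/2, of_int h) \<notin> B" "(of_int h, of_int j + 1/2) \<notin> B" for h
      proof -
        have *: "\<not> \<bar>of_int i + 1/2 - real_of_int x\<bar> < 1/4" for i x
        proof
          assume "\<bar>of_int i + 1/2 - real_of_int x\<bar> < 1/4"
          then have "real_of_int x < of_int (i + 1)" "of_int i < real_of_int x"
            unfolding abs_less_iff of_int_add of_int_1 by linarith+
          then show False unfolding of_int_less_iff by simp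
        qed
        show "(of_int i + 1/2, of_int h) \<notin> B" "(of_int h, of_int j + 1/2) \<notin> B"
          using *[of i x] *[of j y] by (auto simp: B_def)
      qed
      have "(k = i \<and> (l = j + 1 \<or> l = j - 1)) \<or> (l = j \<and> (k = i + 1 \<or> k = i - 1))"
        using step.hyps(2) unfolding c12 cell_adj_def by auto
      then show ?thesis
      proof (elim disjE conjE)
        assume "k = i" "l = j + 1"
        then show ?thesis using m(1)[of "j + 1"]
          by (intro exI[of _ "(of_int i + 1/2, of_int (j + 1))"]) (auto simp: c12 mem_cell)
      next
        assume "k = i" "l = j - 1"
        then show ?thesis using m(1)[of j]
          by (intro exI[of _ "(of_int i + 1/2, of_int j)"]) (auto simp: c12 mem_cell)
      next
        assume "l = j" "k = i + 1"
        then show ?thesis using m(2)[of "i + 1"]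
          by (intro exI[of _ "(of_int (i + 1), of_int j + 1/2)"]) (auto simp: c12 mem_cell)
      next
        assume "l = j" "k = i - 1"
        then show ?thesis using m(2)[of i]
          by (intro exI[of _ "(of_int i, of_int j + 1/2)"]) (auto simp: c12 mem_cell)
      qed
    qed
    then obtain m where m: "m \<in> cell c1 - B" "m \<in> cell c2 - B" by blast
    show ?case
    proof (intro ballI)
      fix p p' assume p: "p \<in> cell c - B" "p' \<in> cell c2 - B"
      have "connected_component U p m" using step.IH p(1) m(1) by blast
      moreover have "connected_component U m p'"
        using piece[of c2] UQ[of c2] step.hyps(2) m(2) p(2) by (auto intro: connected_componentI)
      ultimately show "connected_component U p p'" by (rule connected_component_trans)
    qed
  qed
  have "connected U"
    unfolding connected_iff_connected_component
    using conn s_quad_graph_linked[OF Q] by (fastforce simp: U_def region_eq_Union_cell)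
  moreover have "connected (cell a \<union> cell b)"
    using clcell ab by (intro connected_Un convex_connected) auto
  moreover have reg: "region Q = (cell a \<union> cell b) \<union> U"
    using near other ab by (fastforce simp: U_def region_eq_Union_cell)
  moreover have "closed (region Q)"
    using compact_imp_closed[OF compact_region] Q by (simp add: s_quad_graph_def)
  then have "closed U" unfolding U_def using opB by (rule closed_Diff)
  moreover have "closed (cell a \<union> cell b)" using clcell by blast
  ultimately have "connected ((cell a \<union> cell b) \<inter> U)"
    using Borsukian_imp_unicoherent[OF s_quad_graph_Borsukian[OF Q]]
    by (intro unicoherentD[of "region Q"]) (auto intro!: closed_subset)
  moreover have "(cell a \<union> cell b) \<inter> U = (cell a - B) \<union> (cell b - B)"
    using ab by (auto simp: U_def region_eq_Union_cell)
  ultimately have C: "connected ((cell a - B) \<union> (cell b - B))" by simp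
  have "closed (cell a - B)" "closed (cell b - B)" using closed_Diff[OF clcell(1) opB] by blast+
  moreover have "z \<in> B" by (simp add: z B_def)
  then have "(cell a - B) \<inter> (cell b - B) = {}" using ab by blast
  moreover have "cell c - B \<noteq> {}" for c
  proof -
    obtain i j where c: "c = (i, j)" by (cases c)
    have "(of_int i + 1/2, of_int j + 1/2) \<notin> B"
    proof
      assume "(of_int i + 1/2, of_int j + 1/2) \<in> B"
      then have "real_of_int x < of_int (i + 1)" "of_int i < real_of_int x"
        unfolding B_def mem_Collect_eq abs_less_iff of_int_add of_int_1 fst_conv by linarith+
      then show False unfolding of_int_less_iff by simp
    qed
    then show ?thesis using cell_mid[of i j i j] c by blast
  qed
  ultimately show False
    using connected_closedD[OF C, of "cell a - B" "cell b - B"] by blast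
qed

text \<open>A connected interior does not exclude pinches, since the two squares could be joined by
  a ring of squares around a hole; simple connectivity does. The consequence used later is that the
  two halves of an edge of the graph have squares of \<open>Q\<close> on a common side.\<close>

lemma no_pinch:
  assumes Q: "s_quad_graph Q"
  shows "(x - 1, y) \<in> Q \<Longrightarrow> (x, y - 1) \<in> Q \<Longrightarrow> (x, y) \<in> Q \<or> (x - 1, y - 1) \<in> Q"
    and "(x, y) \<in> Q \<Longrightarrow> (x - 1, y - 1) \<in> Q \<Longrightarrow> (x - 1, y) \<in> Q \<or> (x, y - 1) \<in> Q"
proof -
  have c: "c \<in> {(x, y), (x - 1, y), (x, y - 1), (x - 1, y - 1)}" if "(of_int x, of_int y) \<in> cell c" for c
  proof -
    obtain i j where c: "c = (i, j)" by (cases c)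
    have "real_of_int i \<le> of_int x" "real_of_int x \<le> of_int (i + 1)"
      "real_of_int j \<le> of_int y" "real_of_int y \<le> of_int (j + 1)"
      using that unfolding c mem_cell by auto
    then have "i = x \<or> i = x - 1" "j = y \<or> j = y - 1"
      unfolding of_int_le_iff by linarith+
    then show ?thesis by (auto simp: c)
  qed
  show "(x - 1, y) \<in> Q \<Longrightarrow> (x, y - 1) \<in> Q \<Longrightarrow> (x, y) \<in> Q \<or> (x - 1, y - 1) \<in> Q"
  proof (rule ccontr)
    assume "(x - 1, y) \<in> Q" "(x, y - 1) \<in> Q" "\<not> ((x, y) \<in> Q \<or> (x - 1, y - 1) \<in> Q)"
    then show False
      using c by (intro no_pinch_aux[OF Q refl, of "(x - 1, y)" "(x, y - 1)" x y]) (force simp: mem_cell)+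
  qed
  show "(x, y) \<in> Q \<Longrightarrow> (x - 1, y - 1) \<in> Q \<Longrightarrow> (x - 1, y) \<in> Q \<or> (x, y - 1) \<in> Q"
  proof (rule ccontr)
    assume "(x, y) \<in> Q" "(x - 1, y - 1) \<in> Q" "\<not> ((x - 1, y) \<in> Q \<or> (x, y - 1) \<in> Q)"
    then show False
      using c by (intro no_pinch_aux[OF Q refl, of "(x, y)" "(x - 1, y - 1)" x y]) (force simp: mem_cell)+
  qed
qed


section \<open>Potentials of closed forms\<close>

text \<open>Discrete integral from \<open>0\<close> to \<open>n\<close>; the sign for negative
  \<open>n\<close> makes \<open>int_sum_plus1\<close> hold for all integers.\<close>

definition int_sum :: "(int \<Rightarrow> 'a::ab_group_add) \<Rightarrow> int \<Rightarrow> 'a" where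
  "int_sum f n = (if 0 \<le> n then \<Sum>k=0..<n. f k else - (\<Sum>k=n..<0. f k))"

lemma int_sum_0 [simp]: "int_sum f 0 = 0"
  by (simp add: int_sum_def)

lemma int_sum_plus1: "int_sum f (n + 1) = int_sum f n + f n"
proof (cases "0 \<le> n")
  case True
  then have "{0..<n + 1} = insert n {0..<n}" by auto
  with True show ?thesis by (simp add: int_sum_def)
next
  case False
  then have "{n..<0} = insert n {n + 1..<0}" by auto
  with False show ?thesis by (cases "n = -1") (simp_all add: int_sum_def)
qed

lemma int_sum_diff: "int_sum (\<lambda>k. f k - g k) n = int_sum f n - int_sum g n"
  by (simp add: int_sum_def sum_subtractf)

lemma int_sum_telescope: "int_sum (\<lambda>k. f (k + 1) - f k) n = f n - f 0"
proof (induction n rule: int_induct[of _ 0])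
  case (step1 i)
  then show ?case by (simp add: int_sum_plus1)
next
  case (step2 i)
  have "int_sum (\<lambda>k. f (k + 1) - f k) i = int_sum (\<lambda>k. f (k + 1) - f k) (i - 1) + (f i - f (i - 1))"
    using int_sum_plus1[of "\<lambda>k. f (k + 1) - f k" "i - 1"] by simp
  with step2 show ?case by (simp add: algebra_simps)
qed simp

lemma tendsto_int_sum:
  fixes g :: "int \<Rightarrow> 'a::real_normed_vector"
  shows "(\<And>k. ((\<lambda>x. f x k) \<longlongrightarrow> g k) F) \<Longrightarrow> ((\<lambda>x. int_sum (f x) n) \<longlongrightarrow> int_sum g n) F"
  unfolding int_sum_def by (auto intro!: tendsto_intros)

definition curl :: "(int \<Rightarrow> int \<Rightarrow> 'a) \<Rightarrow> (int \<Rightarrow> int \<Rightarrow> 'a) \<Rightarrow> int \<Rightarrow> int \<Rightarrow> 'a::ab_group_add" where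
  "curl h v i j = h i j + v (i + 1) j - h i (j + 1) - v i j"

text \<open>Integration along the first axis and then up the column \<open>i\<close>.\<close>

definition pot0 :: "(int \<Rightarrow> int \<Rightarrow> 'a) \<Rightarrow> (int \<Rightarrow> int \<Rightarrow> 'a) \<Rightarrow> int \<Rightarrow> int \<Rightarrow> 'a::ab_group_add" where
  "pot0 h v i j = int_sum (\<lambda>i. h i 0) i + int_sum (v i) j"

text \<open>Vertical differences are right by construction. For horizontal ones, vanishing curl
  turns the difference of neighbouring column sums into a telescoping sum.\<close>

lemma pot0_diff:
  assumes "\<And>i j. curl h v i j = 0"
  shows "pot0 h v i (j + 1) - pot0 h v i j = v i j" "pot0 h v (i + 1) j - pot0 h v i j = h i j"
proof -
  show "pot0 h v i (j + 1) - pot0 h v i j = v i j"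
    by (simp add: pot0_def int_sum_plus1)
  have "v (i + 1) k - v i k = h i (k + 1) - h i k" for k
    using assms[of i k] by (simp add: curl_def algebra_simps)
  then have "int_sum (v (i + 1)) j - int_sum (v i) j = h i j - h i 0"
    by (simp flip: int_sum_diff add: int_sum_telescope)
  then show "pot0 h v (i + 1) j - pot0 h v i j = h i j"
    unfolding pot0_def int_sum_plus1 by (simp add: algebra_simps)
qed

section \<open>Edges and faces of the graph in lattice coordinates\<close>

abbreviation ge_h :: "(int \<times> int) set \<Rightarrow> int \<Rightarrow> int \<Rightarrow> bool" where
  "ge_h Q i j \<equiv> g_hedge Q (2 * i, 2 * j) (2 * i + 2, 2 * j)"

abbreviation ge_v :: "(int \<times> int) set \<Rightarrow> int \<Rightarrow> int \<Rightarrow> bool" where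
  "ge_v Q i j \<equiv> g_vedge Q (2 * i, 2 * j) (2 * i, 2 * j + 2)"

definition face_cells :: "int \<Rightarrow> int \<Rightarrow> (int \<times> int) set" where
  "face_cells i j = {2 * i, 2 * i + 1} \<times> {2 * j, 2 * j + 1}"

lemma mem_corners: "(x, y) \<in> corners (i, j) \<longleftrightarrow> (x = i \<or> x = i + 1) \<and> (y = j \<or> y = j + 1)"
  by (auto simp: corners_def)

lemma h_edge_iff: "h_edge Q u w \<longleftrightarrow> \<bar>fst u - fst w\<bar> = 1 \<and> snd u = snd w \<and>
    ((min (fst u) (fst w), snd u) \<in> Q \<or> (min (fst u) (fst w), snd u - 1) \<in> Q)"
proof -
  obtain a b c d where [simp]: "u = (a, b)" "w = (c, d)" by (cases u, cases w)
  have "(\<exists>s\<in>Q. (a, b) \<in> corners s \<and> (c, b) \<in> corners s) \<longleftrightarrow>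
      ((min a c, b) \<in> Q \<or> (min a c, b - 1) \<in> Q)" if "\<bar>a - c\<bar> = 1"
  proof
    assume "\<exists>s\<in>Q. (a, b) \<in> corners s \<and> (c, b) \<in> corners s"
    then obtain i j where ij: "(i, j) \<in> Q" "(a, b) \<in> corners (i, j)" "(c, b) \<in> corners (i, j)" by auto
    then have "i = min a c" "j = b \<or> j = b - 1" using that unfolding mem_corners by auto
    with ij show "(min a c, b) \<in> Q \<or> (min a c, b - 1) \<in> Q" by auto
  next
    assume R: "(min a c, b) \<in> Q \<or> (min a c, b - 1) \<in> Q"
    have m: "a = min a c \<or> a = min a c + 1" "c = min a c \<or> c = min a c + 1" using that by auto
    show "\<exists>s\<in>Q. (a, b) \<in> corners s \<and> (c, b) \<in> corners s"
      using R by (elim disjE) (rule bexI[rotated], assumption, use m in \<open>simp add: mem_corners\<close>)+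
  qed
  then show ?thesis unfolding h_edge_def by auto
qed

lemma v_edge_iff: "v_edge Q u w \<longleftrightarrow> fst u = fst w \<and> \<bar>snd u - snd w\<bar> = 1 \<and>
    ((fst u, min (snd u) (snd w)) \<in> Q \<or> (fst u - 1, min (snd u) (snd w)) \<in> Q)"
proof -
  obtain a b c d where [simp]: "u = (a, b)" "w = (c, d)" by (cases u, cases w)
  have "(\<exists>s\<in>Q. (a, b) \<in> corners s \<and> (a, d) \<in> corners s) \<longleftrightarrow>
      ((a, min b d) \<in> Q \<or> (a - 1, min b d) \<in> Q)" if "\<bar>b - d\<bar> = 1"
  proof
    assume "\<exists>s\<in>Q. (a, b) \<in> corners s \<and> (a, d) \<in> corners s"
    then obtain i j where ij: "(i, j) \<in> Q" "(a, b) \<in> corners (i, j)" "(a, d) \<in> corners (i, j)" by auto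
    then have "j = min b d" "i = a \<or> i = a - 1" using that unfolding mem_corners by auto
    with ij show "(a, min b d) \<in> Q \<or> (a - 1, min b d) \<in> Q" by auto
  next
    assume R: "(a, min b d) \<in> Q \<or> (a - 1, min b d) \<in> Q"
    have m: "b = min b d \<or> b = min b d + 1" "d = min b d \<or> d = min b d + 1" using that by auto
    show "\<exists>s\<in>Q. (a, b) \<in> corners s \<and> (a, d) \<in> corners s"
      using R by (elim disjE) (rule bexI[rotated], assumption, use m in \<open>simp add: mem_corners\<close>)+
  qed
  then show ?thesis unfolding v_edge_def by auto
qed

lemma mem_verts: "(x, y) \<in> verts Q \<longleftrightarrow> (x, y) \<in> Q \<or> (x - 1, y) \<in> Q \<or> (x, y - 1) \<in> Q \<or> (x - 1, y - 1) \<in> Q"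
proof
  assume "(x, y) \<in> verts Q"
  then obtain i j where "(i, j) \<in> Q" "(x, y) \<in> corners (i, j)" by (auto simp: verts_def)
  then show "(x, y) \<in> Q \<or> (x - 1, y) \<in> Q \<or> (x, y - 1) \<in> Q \<or> (x - 1, y - 1) \<in> Q"
    unfolding mem_corners by auto
next
  assume "(x, y) \<in> Q \<or> (x - 1, y) \<in> Q \<or> (x, y - 1) \<in> Q \<or> (x - 1, y - 1) \<in> Q"
  then show "(x, y) \<in> verts Q"
    unfolding verts_def by (elim disjE) (rule UN_I, assumption, simp add: mem_corners)+
qed

lemma mem_s_verts: "(x, y) \<in> s_verts Q \<longleftrightarrow> even x \<and> even y \<and>
    ((x, y) \<in> Q \<or> (x - 1, y) \<in> Q \<or> (x, y - 1) \<in> Q \<or> (x - 1, y - 1) \<in> Q)"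
  unfolding s_verts_def by (auto simp: mem_verts)

lemma mem_c_verts: "(x, y) \<in> c_verts Q \<longleftrightarrow> odd x \<and> odd y \<and>
    ((x, y) \<in> Q \<or> (x - 1, y) \<in> Q \<or> (x, y - 1) \<in> Q \<or> (x - 1, y - 1) \<in> Q)"
  unfolding c_verts_def by (auto simp: mem_verts)

lemma ge_h_iff: "ge_h Q i j \<longleftrightarrow>
    ((2 * i, 2 * j) \<in> Q \<or> (2 * i, 2 * j - 1) \<in> Q) \<and> ((2 * i + 1, 2 * j) \<in> Q \<or> (2 * i + 1, 2 * j - 1) \<in> Q)"
proof -
  have "(\<exists>b. h_edge Q (2 * i, 2 * j) b \<and> h_edge Q b (2 * i + 2, 2 * j)) \<longleftrightarrow>
     ((2 * i, 2 * j) \<in> Q \<or> (2 * i, 2 * j - 1) \<in> Q) \<and> ((2 * i + 1, 2 * j) \<in> Q \<or> (2 * i + 1, 2 * j - 1) \<in> Q)"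
    (is "?L = ?R")
  proof
    assume ?L
    then obtain b where b: "h_edge Q (2 * i, 2 * j) b" "h_edge Q b (2 * i + 2, 2 * j)" by blast
    then have "b = (2 * i + 1, 2 * j)" unfolding h_edge_iff by (cases b) auto
    with b show ?R unfolding h_edge_iff by simp
  next
    assume ?R
    then show ?L by (intro exI[of _ "(2 * i + 1, 2 * j)"]) (simp add: h_edge_iff)
  qed
  then show ?thesis
    unfolding g_hedge_def mem_s_verts by (auto simp: algebra_simps)
qed

lemma ge_v_iff: "ge_v Q i j \<longleftrightarrow>
    ((2 * i, 2 * j) \<in> Q \<or> (2 * i - 1, 2 * j) \<in> Q) \<and> ((2 * i, 2 * j + 1) \<in> Q \<or> (2 * i - 1, 2 * j + 1) \<in> Q)"
proof -
  have "(\<exists>b. v_edge Q (2 * i, 2 * j) b \<and> v_edge Q b (2 * i, 2 * j + 2)) \<longleftrightarrow>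
     ((2 * i, 2 * j) \<in> Q \<or> (2 * i - 1, 2 * j) \<in> Q) \<and> ((2 * i, 2 * j + 1) \<in> Q \<or> (2 * i - 1, 2 * j + 1) \<in> Q)"
    (is "?L = ?R")
  proof
    assume ?L
    then obtain b where b: "v_edge Q (2 * i, 2 * j) b" "v_edge Q b (2 * i, 2 * j + 2)" by blast
    then have "b = (2 * i, 2 * j + 1)" unfolding v_edge_iff by (cases b) auto
    with b show ?R unfolding v_edge_iff by simp
  next
    assume ?R
    then show ?L by (intro exI[of _ "(2 * i, 2 * j + 1)"]) (simp add: v_edge_iff)
  qed
  then show ?thesis
    unfolding g_vedge_def mem_s_verts by (auto simp: algebra_simps)
qed

lemma g_face_iff: "g_face Q (x, y) \<longleftrightarrow> odd x \<and> odd y \<and> {(x, y), (x - 1, y), (x, y - 1), (x - 1, y - 1)} \<subseteq> Q"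
  unfolding g_face_def interior_vertex_def mem_c_verts by auto

text \<open>The cells missing from \<open>Q\<close> are linked to infinity, and crossing from one of them to the next never
  crosses an edge of the graph. So a nonface is the curl of a form that vanishes on the graph.\<close>

definition null_form :: "(int \<times> int) set \<Rightarrow> (int \<Rightarrow> int \<Rightarrow> real) \<Rightarrow> (int \<Rightarrow> int \<Rightarrow> real) \<Rightarrow> bool" where
  "null_form Q h v \<longleftrightarrow> (\<forall>i j. (ge_h Q i j \<longrightarrow> h i j = 0) \<and> (ge_v Q i j \<longrightarrow> v i j = 0))"

text \<open>By linearity, a multiple of such a form removes the curl at \<open>f\<close> from any
  given form without changing its values on the edges of the graph.\<close>

definition spans_face :: "(int \<times> int) set \<Rightarrow> int \<times> int \<Rightarrow> bool" where
  "spans_face Q f \<longleftrightarrow> (\<exists>h v. null_form Q h v \<and> (\<forall>i j. curl h v i j = of_bool ((i, j) = f)))"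

lemma spans_face_step:
  assumes "spans_face Q f" "null_form Q h v"
    and "\<And>i j. curl h v i j = of_bool ((i, j) = f') - of_bool ((i, j) = f)"
  shows "spans_face Q f'"
proof -
  obtain h0 v0 where 0: "null_form Q h0 v0" "\<And>i j. curl h0 v0 i j = of_bool ((i, j) = f)"
    using assms(1) by (auto simp: spans_face_def)
  have "null_form Q (\<lambda>i j. h0 i j + h i j) (\<lambda>i j. v0 i j + v i j)"
    using 0 assms(2) by (simp add: null_form_def)
  moreover have "curl (\<lambda>i j. h0 i j + h i j) (\<lambda>i j. v0 i j + v i j) i j = of_bool ((i, j) = f')" for i j
  proof -
    have "curl (\<lambda>i j. h0 i j + h i j) (\<lambda>i j. v0 i j + v i j) i j = curl h0 v0 i j + curl h v i j"
      by (simp add: curl_def)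
    then show ?thesis using 0 assms(3) by simp
  qed
  ultimately show ?thesis unfolding spans_face_def by blast
qed

text \<open>Index of the two by two block of squares, face or nonface, that contains the given
  square.\<close>

definition half :: "int \<times> int \<Rightarrow> int \<times> int" where
  "half = (\<lambda>(x, y). (x div 2, y div 2))"

text \<open>Only the step from odd to even \<open>x\<close> leaves the block. The vertical edge
  crossed there has missing squares on both sides of one of its halves, so it is no edge of the
  graph, and the form supported on it has curls of opposite sign in the two blocks.\<close>

lemma spans_face_right:
  assumes a: "(x, y) \<notin> Q" "(x + 1, y) \<notin> Q"
  shows "spans_face Q (half (x, y)) \<longleftrightarrow> spans_face Q (half (x + 1, y))"
proof (cases "even x")
  case True
  then show ?thesis by (simp add: half_def)
next
  case False
  then obtain k where x: "x = 2 * k + 1" by (auto elim: oddE)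
  define l where "l = y div 2"
  have y: "y = 2 * l \<or> y = 2 * l + 1" by (auto simp: l_def)
  define e :: "real \<Rightarrow> int \<Rightarrow> int \<Rightarrow> real" where "e = (\<lambda>s i j. s * of_bool (i = k + 1 \<and> j = l))"
  have "\<not> ge_v Q (k + 1) l"
    using a y unfolding ge_v_iff x by (auto simp: algebra_simps)
  then have n: "null_form Q (\<lambda>i j. 0) (e s)" for s
    by (auto simp: null_form_def e_def)
  have c: "curl (\<lambda>i j. 0) (e s) i j = s * of_bool ((i, j) = (k, l)) - s * of_bool ((i, j) = (k + 1, l))" for s i j
    by (simp add: curl_def e_def)
  have h: "half (x, y) = (k, l)" "half (x + 1, y) = (k + 1, l)"
    by (simp_all add: half_def x l_def)
  show ?thesis
    unfolding h
    using spans_face_step[OF _ n[of 1], of "(k + 1, l)" "(k, l)"] spans_face_step[OF _ n[of "-1"], of "(k, l)" "(k + 1, l)"]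
    by (auto simp: c)
qed

lemma spans_face_up:
  assumes a: "(x, y) \<notin> Q" "(x, y + 1) \<notin> Q"
  shows "spans_face Q (half (x, y)) \<longleftrightarrow> spans_face Q (half (x, y + 1))"
proof (cases "even y")
  case True
  then show ?thesis by (simp add: half_def)
next
  case False
  then obtain l where y: "y = 2 * l + 1" by (auto elim: oddE)
  define k where "k = x div 2"
  have x: "x = 2 * k \<or> x = 2 * k + 1" by (auto simp: k_def)
  define e :: "real \<Rightarrow> int \<Rightarrow> int \<Rightarrow> real" where "e = (\<lambda>s i j. s * of_bool (i = k \<and> j = l + 1))"
  have "\<not> ge_h Q k (l + 1)"
    using a x unfolding ge_h_iff y by (auto simp: algebra_simps)
  then have n: "null_form Q (e s) (\<lambda>i j. 0)" for s
    by (auto simp: null_form_def e_def)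
  have c: "curl (e s) (\<lambda>i j. 0) i j = s * of_bool ((i, j) = (k, l + 1)) - s * of_bool ((i, j) = (k, l))" for s i j
    by (simp add: curl_def e_def)
  have h: "half (x, y) = (k, l)" "half (x, y + 1) = (k, l + 1)"
    by (simp_all add: half_def y k_def)
  show ?thesis
    unfolding h
    using spans_face_step[OF _ n[of 1], of "(k, l)" "(k, l + 1)"] spans_face_step[OF _ n[of "-1"], of "(k, l + 1)" "(k, l)"]
    by (auto simp: c)
qed

text \<open>A form equal to \<open>1\<close> on the vertical edges of a row, from the right side of
  the block to infinity, has curl at that block only; to the right of all squares it avoids the
  graph.\<close>

lemma spans_face_far:
  assumes "\<And>i j. (i, j) \<in> Q \<Longrightarrow> i < 2 * k"
  shows "spans_face Q (k, l)"
proof -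
  define e :: "int \<Rightarrow> int \<Rightarrow> real" where "e = (\<lambda>i j. of_bool (i > k \<and> j = l))"
  have "null_form Q (\<lambda>i j. 0) e"
  proof -
    have "\<not> ge_v Q i j" if "i > k" for i j
    proof
      assume "ge_v Q i j"
      then have "(2 * i, 2 * j) \<in> Q \<or> (2 * i - 1, 2 * j) \<in> Q" by (simp add: ge_v_iff)
      with assms[of "2 * i" "2 * j"] assms[of "2 * i - 1" "2 * j"] that show False by auto
    qed
    then show ?thesis by (auto simp: null_form_def e_def)
  qed
  moreover have "curl (\<lambda>i j. 0) e i j = of_bool ((i, j) = (k, l))" for i j
    by (auto simp: curl_def e_def)
  ultimately show ?thesis unfolding spans_face_def by blast
qed

text \<open>Some square of the block is missing. It is linked, through missing squares, to one far
  to the right, and the property is carried along this chain from the far end.\<close>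

lemma spans_nonface:
  assumes Q: "s_quad_graph Q" and f: "\<not> g_face Q (2 * k + 1, 2 * l + 1)"
  shows "spans_face Q (k, l)"
proof -
  obtain a where a: "a \<notin> Q" "half a = (k, l)"
    using f unfolding g_face_iff by (force simp: half_def)
  \<comment> \<open>Inserting \<open>0\<close> makes \<open>B\<close> positive, so that
    \<open>i < B\<close> gives \<open>i < 2 * B\<close>.\<close>
  define B where "B = Max (insert 0 (fst ` Q)) + 1"
  have "finite (insert 0 (fst ` Q))" using Q by (simp add: s_quad_graph_def)
  then have B: "B > 0" "i < B" if "(i, j) \<in> Q" for i j
    using Max_ge[of "insert 0 (fst ` Q)" 0] Max_ge[of "insert 0 (fst ` Q)" i] image_eqI[of i fst "(i, j)" Q] that
    unfolding B_def by simp_all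
  obtain c where "c \<in> Q" using Q by (auto simp: s_quad_graph_def)
  then have B2: "B > 0" "i < 2 * B" if "(i, j) \<in> Q" for i j
    using B(1)[of "fst c" "snd c"] B(2)[OF that] by auto
  then have B3: "(2 * B, 0) \<notin> Q" by fastforce
  have "spans_face Q (half b)" if "linked (- Q) (2 * B, 0) b" for b
    using that unfolding linked_def
  proof (induction rule: rtranclp_induct)
    case base
    then show ?case using spans_face_far[of Q B 0] B2 by (auto simp: half_def)
  next
    case (step c1 c2)
    obtain x y x' y' where c: "c1 = (x, y)" "c2 = (x', y')" by (cases c1, cases c2)
    consider "x' = x" "y' = y + 1" | "x' = x" "y = y' + 1" | "x' = x + 1" "y' = y" | "x = x' + 1" "y' = y"
      using step.hyps unfolding c cell_adj_def by fastforce
    then show ?case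
      using step.IH step.hyps spans_face_up[of x y Q] spans_face_up[of x y' Q]
        spans_face_right[of x y Q] spans_face_right[of x' y Q]
      unfolding c by cases auto
  qed
  then show ?thesis
    using s_quad_graph_Compl_linked[OF Q B3 a(1)] a(2) by metis
qed

section \<open>Orientation of edges and exactness of closed forms\<close>

lemma h_edge_sym: "h_edge Q u w \<Longrightarrow> h_edge Q w u"
  unfolding h_edge_def by (auto simp: abs_minus_commute)

lemma v_edge_sym: "v_edge Q u w \<Longrightarrow> v_edge Q w u"
  unfolding v_edge_def by (auto simp: abs_minus_commute)

lemma g_hedge_sym: "g_hedge Q v w \<Longrightarrow> g_hedge Q w v"
  unfolding g_hedge_def by (blast intro: h_edge_sym)

lemma g_vedge_sym: "g_vedge Q v w \<Longrightarrow> g_vedge Q w v"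
  unfolding g_vedge_def by (blast intro: v_edge_sym)

lemma g_hedge_cases:
  assumes "g_hedge Q v w"
  obtains i j where "ge_h Q i j" "v = (2 * i, 2 * j)" "w = (2 * i + 2, 2 * j)"
  | i j where "ge_h Q i j" "w = (2 * i, 2 * j)" "v = (2 * i + 2, 2 * j)"
proof -
  obtain x y where v: "v = (x, y)" by (cases v)
  obtain b where b: "h_edge Q v b" "h_edge Q b w" and s: "v \<in> s_verts Q" "w \<in> s_verts Q" "v \<noteq> w"
    using assms by (auto simp: g_hedge_def)
  have w: "w = (x + 2, y) \<or> w = (x - 2, y)"
    using b s(3) unfolding h_edge_iff v by (cases b; cases w) auto
  have "even x" "even y" using s(1) unfolding v mem_s_verts by auto
  then obtain i j where ij: "x = 2 * i" "y = 2 * j" by (auto elim!: evenE)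
  show thesis
    using w
  proof
    assume w: "w = (x + 2, y)"
    then show thesis using assms that(1)[of i j] unfolding v ij by simp
  next
    assume w: "w = (x - 2, y)"
    then have vw: "w = (2 * (i - 1), 2 * j)" "v = (2 * (i - 1) + 2, 2 * j)" by (simp_all add: v ij)
    show thesis
      using g_hedge_sym[OF assms] by (intro that(2)[OF _ vw]) (simp only: vw)
  qed
qed

lemma g_vedge_cases:
  assumes "g_vedge Q v w"
  obtains i j where "ge_v Q i j" "v = (2 * i, 2 * j)" "w = (2 * i, 2 * j + 2)"
  | i j where "ge_v Q i j" "w = (2 * i, 2 * j)" "v = (2 * i, 2 * j + 2)"
proof -
  obtain x y where v: "v = (x, y)" by (cases v)
  obtain b where b: "v_edge Q v b" "v_edge Q b w" and s: "v \<in> s_verts Q" "w \<in> s_verts Q" "v \<noteq> w"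
    using assms by (auto simp: g_vedge_def)
  have w: "w = (x, y + 2) \<or> w = (x, y - 2)"
    using b s(3) unfolding v_edge_iff v by (cases b; cases w) auto
  have "even x" "even y" using s(1) unfolding v mem_s_verts by auto
  then obtain i j where ij: "x = 2 * i" "y = 2 * j" by (auto elim!: evenE)
  show thesis
    using w
  proof
    assume w: "w = (x, y + 2)"
    then show thesis using assms that(1)[of i j] unfolding v ij by simp
  next
    assume w: "w = (x, y - 2)"
    then have vw: "w = (2 * i, 2 * (j - 1))" "v = (2 * i, 2 * (j - 1) + 2)" by (simp_all add: v ij)
    show thesis
      using g_vedge_sym[OF assms] by (intro that(2)[OF _ vw]) (simp only: vw)
  qed
qed

text \<open>Closedness is required at complete faces only; that this suffices for exactness is the
  content of \<open>exists_potential\<close>.\<close>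

definition closed_form :: "(int \<times> int) set \<Rightarrow> (vertex \<Rightarrow> vertex \<Rightarrow> 'a::real_normed_vector) \<Rightarrow> bool" where
  "closed_form Q \<omega> \<longleftrightarrow> (\<forall>v w. g_edge Q v w \<longrightarrow> \<omega> w v = - \<omega> v w) \<and>
     (\<forall>a b. g_face Q (a, b) \<longrightarrow> \<omega> (a - 1, b - 1) (a + 1, b - 1) + \<omega> (a + 1, b - 1) (a + 1, b + 1)
        + \<omega> (a + 1, b + 1) (a - 1, b + 1) + \<omega> (a - 1, b + 1) (a - 1, b - 1) = 0)"

lemma g_face_edges:
  assumes "g_face Q (2 * i + 1, 2 * j + 1)"
  shows "ge_h Q i j" "ge_h Q i (j + 1)" "ge_v Q i j" "ge_v Q (i + 1) j"
  using assms unfolding g_face_iff ge_h_iff ge_v_iff by (simp_all add: algebra_simps)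

text \<open>Extended by zero off the graph, a closed form may have curl at nonfaces. Subtracting
  that curl times the forms of \<open>spans_nonface\<close> makes it closed on the whole lattice
  without changing it on the graph. The potential is one fixed expression in finitely many values of
  the form, so that it passes to limits.\<close>

lemma exists_potential:
  assumes Q: "s_quad_graph Q"
  obtains pot :: "(vertex \<Rightarrow> vertex \<Rightarrow> 'a::real_normed_vector) \<Rightarrow> vertex \<Rightarrow> 'a"
  where "\<And>\<omega> v w. closed_form Q \<omega> \<Longrightarrow> g_edge Q v w \<Longrightarrow> pot \<omega> w - pot \<omega> v = \<omega> v w"
    and "\<And>\<omega> \<omega>0 F v. (\<And>v w. g_edge Q v w \<Longrightarrow> ((\<lambda>x. \<omega> x v w) \<longlongrightarrow> \<omega>0 v w) F) \<Longrightarrow>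
           ((\<lambda>x. pot (\<omega> x) v) \<longlongrightarrow> pot \<omega>0 v) F"
proof -
  define nf where "nf = {(i, j). \<not> g_face Q (2 * i + 1, 2 * j + 1)}"
  obtain N where N: "\<And>i j. (i, j) \<in> Q \<Longrightarrow> \<bar>i\<bar> \<le> N \<and> \<bar>j\<bar> \<le> N"
  proof -
    have "finite ((\<lambda>(i, j). \<bar>i\<bar> + \<bar>j\<bar>) ` Q)" using Q by (simp add: s_quad_graph_def)
    then have *: "\<bar>i\<bar> + \<bar>j\<bar> \<le> Max ((\<lambda>(i, j). \<bar>i\<bar> + \<bar>j\<bar>) ` Q)" if "(i, j) \<in> Q" for i j
      using that by (intro Max_ge) force+
    show thesis by (rule that[of "Max ((\<lambda>(i, j). \<bar>i\<bar> + \<bar>j\<bar>) ` Q)"]) (use * in force)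
  qed
  \<comment> \<open>Finitely many nonfaces suffice: outside this box all edges of a block are
    absent, so the extended form has no curl there. The margin exceeds that of
    \<open>outside\<close> by one on account of the right and upper edges of a block.\<close>
  define F where "F = nf \<inter> ({- N - 2..N + 2} \<times> {- N - 2..N + 2})"
  have finF: "finite F" by (simp add: F_def)
  have outside: "\<not> ge_h Q i j" "\<not> ge_v Q i j" if "(i, j) \<notin> {- N - 1..N + 1} \<times> {- N - 1..N + 1}" for i j
    using that N unfolding ge_h_iff ge_v_iff by fastforce+
  have "\<forall>f\<in>nf. \<exists>p. null_form Q (fst p) (snd p) \<and> (\<forall>i j. curl (fst p) (snd p) i j = of_bool ((i, j) = f))"
    using spans_nonface[OF Q] by (force simp: nf_def spans_face_def)
  then obtain \<eta> where \<eta>: "\<And>f. f \<in> nf \<Longrightarrow> null_form Q (fst (\<eta> f)) (snd (\<eta> f))"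
      "\<And>f i j. f \<in> nf \<Longrightarrow> curl (fst (\<eta> f)) (snd (\<eta> f)) i j = of_bool ((i, j) = f)"
    by (metis (no_types, lifting))
  define H :: "(vertex \<Rightarrow> vertex \<Rightarrow> 'a) \<Rightarrow> int \<Rightarrow> int \<Rightarrow> 'a" where
    "H = (\<lambda>\<omega> i j. if ge_h Q i j then \<omega> (2 * i, 2 * j) (2 * i + 2, 2 * j) else 0)"
  define V :: "(vertex \<Rightarrow> vertex \<Rightarrow> 'a) \<Rightarrow> int \<Rightarrow> int \<Rightarrow> 'a" where
    "V = (\<lambda>\<omega> i j. if ge_v Q i j then \<omega> (2 * i, 2 * j) (2 * i, 2 * j + 2) else 0)"
  \<comment> \<open>The weight of each correcting form is the curl at its nonface; the corrections
    vanish on the edges of the graph.\<close>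
  define H' where "H' = (\<lambda>\<omega> i j. H \<omega> i j - (\<Sum>f\<in>F. fst (\<eta> f) i j *\<^sub>R curl (H \<omega>) (V \<omega>) (fst f) (snd f)))"
  define V' where "V' = (\<lambda>\<omega> i j. V \<omega> i j - (\<Sum>f\<in>F. snd (\<eta> f) i j *\<^sub>R curl (H \<omega>) (V \<omega>) (fst f) (snd f)))"
  define pot where "pot = (\<lambda>\<omega> (x, y). pot0 (H' \<omega>) (V' \<omega>) (x div 2) (y div 2))"
  have H': "H' \<omega> i j = \<omega> (2 * i, 2 * j) (2 * i + 2, 2 * j)" if "ge_h Q i j" for \<omega> i j
  proof -
    have "fst (\<eta> f) i j = 0" if "f \<in> F" for f
      using \<eta>(1)[of f] that \<open>ge_h Q i j\<close> by (auto simp: F_def null_form_def)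
    then show ?thesis using that by (simp add: H'_def H_def)
  qed
  have V': "V' \<omega> i j = \<omega> (2 * i, 2 * j) (2 * i, 2 * j + 2)" if "ge_v Q i j" for \<omega> i j
  proof -
    have "snd (\<eta> f) i j = 0" if "f \<in> F" for f
      using \<eta>(1)[of f] that \<open>ge_v Q i j\<close> by (auto simp: F_def null_form_def)
    then show ?thesis using that by (simp add: V'_def V_def)
  qed
  have curl0: "curl (H' \<omega>) (V' \<omega>) i j = 0" if \<omega>: "closed_form Q \<omega>" for \<omega> i j
  proof -
    let ?c = "\<lambda>f. curl (H \<omega>) (V \<omega>) (fst f) (snd f)"
    have "curl (H' \<omega>) (V' \<omega>) i j = curl (H \<omega>) (V \<omega>) i j - (\<Sum>f\<in>F. curl (fst (\<eta> f)) (snd (\<eta> f)) i j *\<^sub>R ?c f)"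
      by (simp add: curl_def H'_def V'_def sum.distrib sum_subtractf algebra_simps)
    also have "(\<Sum>f\<in>F. curl (fst (\<eta> f)) (snd (\<eta> f)) i j *\<^sub>R ?c f) = (\<Sum>f\<in>F. if f = (i, j) then ?c f else 0)"
      using \<eta>(2) by (intro sum.cong) (auto simp: F_def)
    also have "\<dots> = (if (i, j) \<in> F then curl (H \<omega>) (V \<omega>) i j else 0)"
      using finF by (simp add: sum.delta)
    finally have eq: "curl (H' \<omega>) (V' \<omega>) i j = (if (i, j) \<in> F then 0 else curl (H \<omega>) (V \<omega>) i j)"
      by simp
    have "curl (H \<omega>) (V \<omega>) i j = 0" if "(i, j) \<notin> F"
    proof (cases "(i, j) \<in> nf")
      case True
      then have "(i, j) \<notin> {- N - 2..N + 2} \<times> {- N - 2..N + 2}" using that by (auto simp: F_def)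
      then have "(i, j) \<notin> {- N - 1..N + 1} \<times> {- N - 1..N + 1}" "(i + 1, j) \<notin> {- N - 1..N + 1} \<times> {- N - 1..N + 1}"
        "(i, j + 1) \<notin> {- N - 1..N + 1} \<times> {- N - 1..N + 1}" by auto
      note * = outside[OF this(1)] outside[OF this(2)] outside[OF this(3)]
      show ?thesis unfolding curl_def H_def V_def by (simp only: * if_False) simp
    next
      case False
      then have f: "g_face Q (2 * i + 1, 2 * j + 1)" by (simp add: nf_def)
      note e = g_face_edges[OF f]
      have o: "\<omega> w v = - \<omega> v w" if "g_edge Q v w" for v w
        using \<omega> that unfolding closed_form_def by blast
      have "\<omega> (2 * i, 2 * j) (2 * i + 2, 2 * j) + \<omega> (2 * i + 2, 2 * j) (2 * i + 2, 2 * j + 2)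
        + \<omega> (2 * i + 2, 2 * j + 2) (2 * i, 2 * j + 2) + \<omega> (2 * i, 2 * j + 2) (2 * i, 2 * j) = 0"
        using \<omega> f unfolding closed_form_def by (force simp: algebra_simps)
      moreover have "\<omega> (2 * i + 2, 2 * j + 2) (2 * i, 2 * j + 2) = - \<omega> (2 * i, 2 * j + 2) (2 * i + 2, 2 * j + 2)"
        using e(2) by (intro o) (simp add: g_edge_def)
      moreover have "\<omega> (2 * i, 2 * j + 2) (2 * i, 2 * j) = - \<omega> (2 * i, 2 * j) (2 * i, 2 * j + 2)"
        using e(3) by (intro o) (simp add: g_edge_def)
      ultimately show ?thesis
        using e unfolding curl_def H_def V_def by (simp add: algebra_simps)
    qed
    with eq show ?thesis by simp
  qed
  have p: "pot \<omega> w - pot \<omega> v = \<omega> v w" if \<omega>: "closed_form Q \<omega>" and e: "g_edge Q v w" for \<omega> v w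
  proof -
    have o: "\<omega> v w = - \<omega> w v" using \<omega> e unfolding closed_form_def by (metis minus_minus)
    note d = pot0_diff[OF curl0[OF \<omega>]]
    from e consider "g_hedge Q v w" | "g_vedge Q v w" by (auto simp: g_edge_def)
    then show ?thesis
    proof cases
      case 1
      then show ?thesis
        by (cases rule: g_hedge_cases) (use o d(2) H'[of _ _ \<omega>] in \<open>auto simp: pot_def algebra_simps\<close>)
    next
      case 2
      then show ?thesis
        by (cases rule: g_vedge_cases) (use o d(1) V'[of _ _ \<omega>] in \<open>auto simp: pot_def algebra_simps\<close>)
    qed
  qed
  have t: "((\<lambda>x. pot (\<omega> x) v) \<longlongrightarrow> pot \<omega>0 v) F"
    if e: "\<And>v w. g_edge Q v w \<Longrightarrow> ((\<lambda>x. \<omega> x v w) \<longlongrightarrow> \<omega>0 v w) F" for \<omega> :: "'b \<Rightarrow> _" and \<omega>0 F v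
  proof -
    have H: "((\<lambda>x. H (\<omega> x) i j) \<longlongrightarrow> H \<omega>0 i j) F" for i j
      using e[of "(2 * i, 2 * j)" "(2 * i + 2, 2 * j)"] by (simp add: H_def g_edge_def)
    have V: "((\<lambda>x. V (\<omega> x) i j) \<longlongrightarrow> V \<omega>0 i j) F" for i j
      using e[of "(2 * i, 2 * j)" "(2 * i, 2 * j + 2)"] by (simp add: V_def g_edge_def)
    have c: "((\<lambda>x. curl (H (\<omega> x)) (V (\<omega> x)) i j) \<longlongrightarrow> curl (H \<omega>0) (V \<omega>0) i j) F" for i j
      unfolding curl_def by (intro tendsto_intros H V)
    show ?thesis
      unfolding pot_def pot0_def H'_def V'_def
      by (cases v) (auto intro!: tendsto_intros tendsto_int_sum H V c)
  qed
  show thesis by (rule that[of pot]) (use p t in blast)+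
qed


section \<open>Jacobi elliptic functions for modulus tending to 1\<close>

lemma one_minus_sin_pos:
  assumes "0 < q" "q < (1::real)"
  shows "0 < 1 - q\<^sup>2 * (sin \<theta>)\<^sup>2"
proof -
  have "(sin \<theta>)\<^sup>2 \<le> 1" by (simp add: abs_square_le_1)
  then have "q\<^sup>2 * (sin \<theta>)\<^sup>2 \<le> q\<^sup>2" by (simp add: mult_left_le)
  moreover have "q\<^sup>2 < 1" using assms by (simp add: power_less_one_iff)
  ultimately show ?thesis by linarith
qed

lemma ellF_deriv:
  assumes "0 < q" "q < 1"
  shows "(ellF q has_real_derivative 1 / sqrt (1 - q\<^sup>2 * (sin \<phi>)\<^sup>2)) (at \<phi>)"
proof -
  let ?f = "\<lambda>\<theta>. 1 / sqrt (1 - q\<^sup>2 * (sin \<theta>)\<^sup>2)"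
  define a b where "a = min 0 \<phi> - 1" and "b = max 0 \<phi> + 1"
  have ab: "a \<le> 0" "0 \<le> b" "a < \<phi>" "\<phi> < b" by (auto simp: a_def b_def)
  have ne: "1 - q\<^sup>2 * (sin \<theta>)\<^sup>2 \<noteq> 0" for \<theta> using one_minus_sin_pos[OF assms, of \<theta>] by simp
  have "continuous_on {a..b} ?f"
    by (intro continuous_intros) (use ne in auto)
  then have "((\<lambda>u. LBINT y=ereal 0..ereal u. ?f y) has_vector_derivative ?f \<phi>) (at \<phi> within {a..b})"
    using ab by (intro interval_integral_FTC2) auto
  then have "((\<lambda>u. LBINT y=ereal 0..ereal u. ?f y) has_real_derivative ?f \<phi>) (at \<phi> within {a..b})"
    by (simp add: has_real_derivative_iff_has_vector_derivative)
  moreover have "at \<phi> within {a..b} = at \<phi>"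
    using ab by (intro at_within_interior) (simp add: interior_atLeastAtMost_real)
  moreover have "ellF q = (\<lambda>u. LBINT y=ereal 0..ereal u. ?f y)"
    by (simp add: ellF_def fun_eq_iff)
  ultimately show ?thesis by simp
qed

lemma ellF_strict_mono:
  assumes "0 < q" "q < 1" "x < y"
  shows "ellF q x < ellF q y"
proof (rule DERIV_pos_imp_increasing[OF assms(3)])
  fix z assume "x \<le> z" "z \<le> y"
  show "\<exists>d. (ellF q has_real_derivative d) (at z) \<and> 0 < d"
    using ellF_deriv[OF assms(1,2), of z] one_minus_sin_pos[OF assms(1,2), of z] by auto
qed

lemma ellF_0: "ellF q 0 = 0"
  by (simp add: ellF_def zero_ereal_def)

lemma sin_arctan_sinh: "sin (arctan (sinh t)) = tanh (t :: real)"
  and cos_arctan_sinh: "cos (arctan (sinh t)) = 1 / cosh (t :: real)"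
proof -
  have "sqrt (1 + (sinh t)\<^sup>2) = cosh t"
    using cosh_square_eq[of t] by (simp add: real_sqrt_unique add.commute)
  then show "sin (arctan (sinh t)) = tanh t" "cos (arctan (sinh t)) = 1 / cosh t"
    by (simp_all add: sin_arctan cos_arctan tanh_def)
qed

lemma ellF_gd_deriv:
  assumes "0 < q" "q < 1"
  shows "((\<lambda>t. ellF q (arctan (sinh t))) has_real_derivative 1 / sqrt (1 + (1 - q\<^sup>2) * (sinh t)\<^sup>2)) (at t)"
proof -
  have c: "cosh t > 0" "(cosh t)\<^sup>2 = 1 + (sinh t)\<^sup>2" using cosh_square_eq[of t] by auto
  have "((\<lambda>t. ellF q (arctan (sinh t))) has_real_derivative
      1 / sqrt (1 - q\<^sup>2 * (tanh t)\<^sup>2) * (inverse (1 + (sinh t)\<^sup>2) * cosh t)) (at t)"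
    unfolding sin_arctan_sinh[symmetric]
    by (rule DERIV_chain2[OF ellF_deriv[OF assms]]) (auto intro!: derivative_eq_intros)
  moreover have "1 / sqrt (1 - q\<^sup>2 * (tanh t)\<^sup>2) * (inverse (1 + (sinh t)\<^sup>2) * cosh t)
      = 1 / (sqrt (1 - q\<^sup>2 * (tanh t)\<^sup>2) * cosh t)"
    unfolding c(2)[symmetric] using c(1) by (simp add: power2_eq_square field_simps)
  moreover have "sqrt (1 - q\<^sup>2 * (tanh t)\<^sup>2) * cosh t = sqrt (1 + (1 - q\<^sup>2) * (sinh t)\<^sup>2)"
  proof -
    have "sqrt (1 - q\<^sup>2 * (tanh t)\<^sup>2) * cosh t = sqrt ((1 - q\<^sup>2 * (tanh t)\<^sup>2) * (cosh t)\<^sup>2)"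
      using c(1) by (simp add: real_sqrt_mult)
    also have "(1 - q\<^sup>2 * (tanh t)\<^sup>2) * (cosh t)\<^sup>2 = (cosh t)\<^sup>2 - q\<^sup>2 * (sinh t)\<^sup>2"
      using c(1) by (simp add: tanh_def field_simps)
    finally show ?thesis using c by (simp add: algebra_simps)
  qed
  ultimately show ?thesis by simp
qed

text \<open>\<open>arctan \<circ> sinh\<close> is the amplitude of modulus 1, so substituting it removes the singularity that the
  integrand of \<open>ellF\<close> develops as \<open>q\<close> tends to 1.\<close>

lemma ellF_gd_bounds:
  assumes "0 < q" "q < 1"
  shows "\<bar>ellF q (arctan (sinh t)) - t\<bar> \<le> (1 - q\<^sup>2) * (sinh t)\<^sup>2 * \<bar>t\<bar>"
proof -
  let ?G = "\<lambda>t. ellF q (arctan (sinh t)) - t"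
  have q: "0 < 1 - q\<^sup>2" using assms by (simp add: power_less_one_iff)
  have *: "\<bar>1 / sqrt (1 + x) - 1\<bar> \<le> x" if "x \<ge> 0" for x :: real
  proof -
    have s: "1 \<le> sqrt (1 + x)" "sqrt (1 + x) \<le> 1 + x"
      using that by (auto simp: real_le_lsqrt power2_eq_square algebra_simps)
    then have "1 / sqrt (1 + x) \<le> 1" "1 / sqrt (1 + x) \<ge> 1 / (1 + x)"
      using that by (auto intro!: divide_left_mono mult_pos_pos)
    moreover have "1 / (1 + x) \<ge> 1 - x" using that by (simp add: field_simps)
    ultimately show ?thesis by linarith
  qed
  have mono: "(sinh s)\<^sup>2 \<le> (sinh t)\<^sup>2" if "s \<in> closed_segment 0 t" for s
  proof -
    have "\<bar>s\<bar> \<le> \<bar>t\<bar>" using that by (auto simp: closed_segment_eq_real_ivl split: if_splits)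
    then have "sinh \<bar>s\<bar> \<le> sinh \<bar>t\<bar>" by (simp only: sinh_real_le_iff)
    moreover have "sinh \<bar>x\<bar> = \<bar>sinh x\<bar>" for x :: real
      by (cases "0 \<le> x") simp_all
    ultimately have "\<bar>sinh s\<bar> \<le> \<bar>sinh t\<bar>" by (simp only:)
    then show ?thesis by (simp add: abs_le_square_iff)
  qed
  \<comment> \<open>Mean value bound: on the whole segment the derivative deviates from
    \<open>1\<close> by at most \<open>(1 - q\<^sup>2) * (sinh t)\<^sup>2\<close>.\<close>
  have "norm (?G t - ?G 0) \<le> (1 - q\<^sup>2) * (sinh t)\<^sup>2 * norm (t - 0)"
  proof (rule field_differentiable_bound[OF convex_closed_segment[of 0 t], where f' = "\<lambda>s. 1 / sqrt (1 + (1 - q\<^sup>2) * (sinh s)\<^sup>2) - 1"])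
    fix s assume s: "s \<in> closed_segment 0 t"
    show "(?G has_real_derivative 1 / sqrt (1 + (1 - q\<^sup>2) * (sinh s)\<^sup>2) - 1) (at s within closed_segment 0 t)"
      by (rule DERIV_subset[OF _ subset_UNIV]) (intro DERIV_diff ellF_gd_deriv[OF assms] DERIV_ident)
    have "\<bar>1 / sqrt (1 + (1 - q\<^sup>2) * (sinh s)\<^sup>2) - 1\<bar> \<le> (1 - q\<^sup>2) * (sinh s)\<^sup>2"
      using q by (intro *) simp
    also have "\<dots> \<le> (1 - q\<^sup>2) * (sinh t)\<^sup>2" using q mono[OF s] by simp
    finally show "norm (1 / sqrt (1 + (1 - q\<^sup>2) * (sinh s)\<^sup>2) - 1) \<le> (1 - q\<^sup>2) * (sinh t)\<^sup>2" by simp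
  qed auto
  then show ?thesis by (simp add: ellF_0)
qed

text \<open>The integrand is at least \<open>1\<close>, so the integral grows at least as fast as
  its argument, and the intermediate value theorem applies between \<open>- \<bar>u\<bar>\<close>
  and \<open>\<bar>u\<bar>\<close>.\<close>

lemma ellF_surj:
  assumes "0 < q" "q < 1"
  shows "\<exists>\<phi>. ellF q \<phi> = u"
proof -
  have lower: "ellF q y - ellF q x \<ge> y - x" if "x \<le> y" for x y
  proof -
    have "(\<lambda>x. ellF q x - x) x \<le> (\<lambda>x. ellF q x - x) y"
    proof (rule DERIV_nonneg_imp_nondecreasing[OF that])
      fix z
      have p: "0 < 1 - q\<^sup>2 * (sin z)\<^sup>2" by (rule one_minus_sin_pos[OF assms])
      then have "sqrt (1 - q\<^sup>2 * (sin z)\<^sup>2) \<le> 1" by simp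
      then have "1 / sqrt (1 - q\<^sup>2 * (sin z)\<^sup>2) - 1 \<ge> 0" using p by simp
      moreover have "((\<lambda>x. ellF q x - x) has_real_derivative 1 / sqrt (1 - q\<^sup>2 * (sin z)\<^sup>2) - 1) (at z)"
        by (intro DERIV_diff ellF_deriv[OF assms] DERIV_ident)
      ultimately show "\<exists>y. ((\<lambda>x. ellF q x - x) has_real_derivative y) (at z) \<and> 0 \<le> y" by blast
    qed
    then show ?thesis by simp
  qed
  have "isCont (ellF q) x" for x using ellF_deriv[OF assms] DERIV_isCont by blast
  then have c: "continuous_on {- \<bar>u\<bar>..\<bar>u\<bar>} (ellF q)" by (simp add: continuous_at_imp_continuous_on)
  have "ellF q (- \<bar>u\<bar>) \<le> u" "u \<le> ellF q \<bar>u\<bar>"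
    using lower[of 0 "\<bar>u\<bar>"] lower[of "- \<bar>u\<bar>" 0] by (auto simp: ellF_0)
  then show ?thesis using IVT'[of "ellF q" "- \<bar>u\<bar>" u "\<bar>u\<bar>"] c by auto
qed

text \<open>For \<open>q < 1\<close> the integral is a strictly increasing bijection, so the
  definite description denotes its inverse.\<close>

lemma jacobi_am_eq:
  assumes "0 < q" "q < 1"
  shows "ellF q (jacobi_am q u) = u"
proof -
  have *: "(\<forall>\<theta>\<in>closed_segment 0 \<phi>. q\<^sup>2 * (sin \<theta>)\<^sup>2 < 1)" for \<phi>
    using one_minus_sin_pos[OF assms] by auto
  obtain \<phi> where \<phi>: "ellF q \<phi> = u" using ellF_surj[OF assms] by blast
  have "jacobi_am q u = \<phi>"
    unfolding jacobi_am_def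
  proof (rule the_equality)
    show "(\<forall>\<theta>\<in>closed_segment 0 \<phi>. q\<^sup>2 * (sin \<theta>)\<^sup>2 < 1) \<and> ellF q \<phi> = u" using * \<phi> by blast
    fix \<psi> assume "(\<forall>\<theta>\<in>closed_segment 0 \<psi>. q\<^sup>2 * (sin \<theta>)\<^sup>2 < 1) \<and> ellF q \<psi> = u"
    then show "\<psi> = \<phi>"
      using \<phi> ellF_strict_mono[OF assms, of \<psi> \<phi>] ellF_strict_mono[OF assms, of \<phi> \<psi>]
      by (cases \<psi> \<phi> rule: linorder_cases) auto
  qed
  then show ?thesis using \<phi> by simp
qed

text \<open>Pointwise convergence of increasing functions passes to their inverses: for a fixed
  \<open>t\<close> on either side of \<open>u0\<close>, the value of \<open>ellF\<close> at
  \<open>arctan (sinh t)\<close> is eventually on the same side of \<open>u x\<close>, and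
  monotonicity bounds the amplitude by \<open>arctan (sinh t)\<close>.\<close>

lemma jacobi_am_tendsto:
  assumes q: "(q \<longlongrightarrow> 1) F" "\<forall>\<^sub>F x in F. 0 < q x \<and> q x < 1" and u: "(u \<longlongrightarrow> u0) F"
  shows "((\<lambda>x. jacobi_am (q x) (u x)) \<longlongrightarrow> arctan (sinh u0)) F"
proof -
  have lim: "((\<lambda>x. ellF (q x) (arctan (sinh t))) \<longlongrightarrow> t) F" for t
  proof (rule LIM_zero_cancel)
    show "((\<lambda>x. ellF (q x) (arctan (sinh t)) - t) \<longlongrightarrow> 0) F"
    proof (rule Lim_null_comparison)
      show "\<forall>\<^sub>F x in F. norm (ellF (q x) (arctan (sinh t)) - t) \<le> (1 - (q x)\<^sup>2) * (sinh t)\<^sup>2 * \<bar>t\<bar>"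
        using q(2) by eventually_elim (use ellF_gd_bounds in auto)
      have "((\<lambda>x. (1 - (q x)\<^sup>2) * (sinh t)\<^sup>2 * \<bar>t\<bar>) \<longlongrightarrow> (1 - 1\<^sup>2) * (sinh t)\<^sup>2 * \<bar>t\<bar>) F"
        by (intro tendsto_intros q)
      then show "((\<lambda>x. (1 - (q x)\<^sup>2) * (sinh t)\<^sup>2 * \<bar>t\<bar>) \<longlongrightarrow> 0) F" by simp
    qed
  qed
  have less: "\<phi> < \<psi>" if "ellF p \<phi> < ellF p \<psi>" "0 < p" "p < 1" for p \<phi> \<psi>
    using that ellF_strict_mono[of p \<psi> \<phi>] by (cases \<phi> \<psi> rule: linorder_cases) auto
  have tendsto_less: "\<forall>\<^sub>F x in F. f x < g x" if f: "(f \<longlongrightarrow> l) F" and g: "(g \<longlongrightarrow> m) F" and "l < m"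
    for f g :: "'a \<Rightarrow> real" and l m
  proof -
    have "\<forall>\<^sub>F x in F. 0 < g x - f x"
      using tendsto_diff[OF g f] \<open>l < m\<close> by (intro order_tendstoD) auto
    then show ?thesis by simp
  qed
  have gd: "((\<lambda>t. arctan (sinh t)) \<longlongrightarrow> arctan (sinh u0)) G" if "G \<le> at u0" for G
  proof -
    have "isCont (\<lambda>t::real. arctan (sinh t)) u0" by (intro continuous_intros)
    then show ?thesis using that unfolding isCont_def by (rule tendsto_mono[rotated])
  qed
  show ?thesis
  proof (rule order_tendstoI)
    fix a assume a: "a < arctan (sinh u0)"
    have "\<forall>\<^sub>F t in at_left u0. t < u0 \<and> a < arctan (sinh t)"
      by (intro eventually_conj order_tendstoD[OF gd[of "at_left u0"]] a)
         (auto simp: eventually_at_filter at_within_le_at)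
    then obtain t where t: "t < u0" "a < arctan (sinh t)"
      using eventually_happens'[OF trivial_limit_at_left_real] by blast
    have "\<forall>\<^sub>F x in F. ellF (q x) (arctan (sinh t)) < u x"
      using tendsto_less[OF lim u t(1)] .
    then show "\<forall>\<^sub>F x in F. a < jacobi_am (q x) (u x)"
      using q(2)
    proof eventually_elim
      case (elim x)
      then have "arctan (sinh t) < jacobi_am (q x) (u x)"
        using less[of "q x" "arctan (sinh t)" "jacobi_am (q x) (u x)"] jacobi_am_eq[of "q x" "u x"] by simp
      then show ?case using t by simp
    qed
  next
    fix a assume a: "arctan (sinh u0) < a"
    have "\<forall>\<^sub>F t in at_right u0. u0 < t \<and> arctan (sinh t) < a"
      by (intro eventually_conj order_tendstoD[OF gd[of "at_right u0"]] a)
         (auto simp: eventually_at_filter at_within_le_at)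
    then obtain t where t: "u0 < t" "arctan (sinh t) < a"
      using eventually_happens'[OF trivial_limit_at_right_real] by blast
    have "\<forall>\<^sub>F x in F. u x < ellF (q x) (arctan (sinh t))"
      using tendsto_less[OF u lim t(1)] .
    then show "\<forall>\<^sub>F x in F. jacobi_am (q x) (u x) < a"
      using q(2)
    proof eventually_elim
      case (elim x)
      then have "jacobi_am (q x) (u x) < arctan (sinh t)"
        using less[of "q x" "jacobi_am (q x) (u x)" "arctan (sinh t)"] jacobi_am_eq[of "q x" "u x"] by simp
      then show ?case using t by simp
    qed
  qed
qed

text \<open>The limits of \<open>cn\<close> and \<open>dn\<close> coincide because
  \<open>1 - tanh^2 = 1 / cosh^2\<close>; this is why the two circles of a ring merge.\<close>

lemma jacobi_tendsto:
  assumes q: "(q \<longlongrightarrow> 1) F" "\<forall>\<^sub>F x in F. 0 < q x \<and> q x < 1" and u: "(u \<longlongrightarrow> u0) F"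
  shows "((\<lambda>x. jacobi_sn (u x) (q x)) \<longlongrightarrow> tanh u0) F" "((\<lambda>x. jacobi_cn (u x) (q x)) \<longlongrightarrow> 1 / cosh u0) F"
    "((\<lambda>x. jacobi_dn (u x) (q x)) \<longlongrightarrow> 1 / cosh u0) F"
proof -
  note am = jacobi_am_tendsto[OF assms]
  show sn: "((\<lambda>x. jacobi_sn (u x) (q x)) \<longlongrightarrow> tanh u0) F"
    unfolding jacobi_sn_def sin_arctan_sinh[symmetric] by (rule isCont_tendsto_compose[OF _ am]) simp
  show "((\<lambda>x. jacobi_cn (u x) (q x)) \<longlongrightarrow> 1 / cosh u0) F"
    unfolding jacobi_cn_def cos_arctan_sinh[symmetric] by (rule isCont_tendsto_compose[OF _ am]) simp
  have "((\<lambda>x. jacobi_dn (u x) (q x)) \<longlongrightarrow> sqrt (1 - 1\<^sup>2 * (tanh u0)\<^sup>2)) F"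
    unfolding jacobi_dn_def jacobi_sn_def[symmetric] by (intro tendsto_intros sn q)
  moreover have "sqrt (1 - 1\<^sup>2 * (tanh u0)\<^sup>2) = 1 / cosh u0"
  proof (rule real_sqrt_unique)
    show "(1 / cosh u0)\<^sup>2 = 1 - 1\<^sup>2 * (tanh u0)\<^sup>2"
      using cosh_square_eq[of u0] add_pos_nonneg[OF zero_less_one zero_le_power2[of "sinh u0"]]
      by (simp add: tanh_def field_simps)
  qed simp
  ultimately show "((\<lambda>x. jacobi_dn (u x) (q x)) \<longlongrightarrow> 1 / cosh u0) F" by simp
qed


section \<open>Lifts of spheres and tangential quadrilaterals\<close>

lemma exhaust_5:
  fixes x :: 5
  shows "x = 1 \<or> x = 2 \<or> x = 3 \<or> x = 4 \<or> x = 5"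
proof (induct x)
  case (of_int z)
  then have "0 \<le> z" and "z < 5" by simp_all
  then have "z = 0 \<or> z = 1 \<or> z = 2 \<or> z = 3 \<or> z = 4" by arith
  then show ?case by auto
qed

lemma forall_5: "(\<forall>i::5. P i) \<longleftrightarrow> P 1 \<and> P 2 \<and> P 3 \<and> P 4 \<and> P 5"
  by (metis exhaust_5)

lemma lift_nth:
  "lift (c, d) $ 1 = c $ 1 / d" "lift (c, d) $ 2 = c $ 2 / d" "lift (c, d) $ 3 = c $ 3 / d"
  "lift (c, d) $ 4 = ((norm c)\<^sup>2 - d\<^sup>2 - 1) / d / 2" "lift (c, d) $ 5 = ((norm c)\<^sup>2 - d\<^sup>2 + 1) / d / 2"
  by (simp_all add: lift_def emb_def e_zero_def e_inf_def axis_def add_divide_distrib diff_divide_distrib algebra_simps)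

text \<open>Components four and five are half the difference and half the sum of \<open>n\<close>
  and \<open>u\<close>, so they can be traded for the reciprocal radius and the power of the origin
  divided by the radius.\<close>

lemma lift_diff_eq_iff:
  "lift (c1, d1) - lift (c2, d2) = r *\<^sub>R (lift (c3, d3) - lift (c4, d4)) \<longleftrightarrow>
     1 / d1 - 1 / d2 = r * (1 / d3 - 1 / d4) \<and>
     (1 / d1) *\<^sub>R c1 - (1 / d2) *\<^sub>R c2 = r *\<^sub>R ((1 / d3) *\<^sub>R c3 - (1 / d4) *\<^sub>R c4) \<and>
     ((norm c1)\<^sup>2 - d1\<^sup>2) / d1 - ((norm c2)\<^sup>2 - d2\<^sup>2) / d2
       = r * (((norm c3)\<^sup>2 - d3\<^sup>2) / d3 - ((norm c4)\<^sup>2 - d4\<^sup>2) / d4)"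
proof -
  define u where "u = (\<lambda>d::real. 1 / d)"
  define n where "n = (\<lambda>(c :: real^3) d. ((norm c)\<^sup>2 - d\<^sup>2) / d)"
  have 4: "lift (c, d) $ 4 = (n c d - u d) / 2" "lift (c, d) $ 5 = (n c d + u d) / 2" for c d
    by (simp_all add: lift_nth n_def u_def diff_divide_distrib add_divide_distrib)
  have "(n c1 d1 - u d1) / 2 - (n c2 d2 - u d2) / 2 = r * ((n c3 d3 - u d3) / 2 - (n c4 d4 - u d4) / 2) \<and>
        (n c1 d1 + u d1) / 2 - (n c2 d2 + u d2) / 2 = r * ((n c3 d3 + u d3) / 2 - (n c4 d4 + u d4) / 2) \<longleftrightarrow>
        u d1 - u d2 = r * (u d3 - u d4) \<and> n c1 d1 - n c2 d2 = r * (n c3 d3 - n c4 d4)"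
    (is "?A1 = ?B1 \<and> ?A2 = ?B2 \<longleftrightarrow> ?U \<and> ?N")
  proof -
    have "?A1 = ((n c1 d1 - n c2 d2) - (u d1 - u d2)) / 2" "?A2 = ((n c1 d1 - n c2 d2) + (u d1 - u d2)) / 2"
      "?B1 = (r * (n c3 d3 - n c4 d4) - r * (u d3 - u d4)) / 2" "?B2 = (r * (n c3 d3 - n c4 d4) + r * (u d3 - u d4)) / 2"
      by (simp_all add: diff_divide_distrib add_divide_distrib algebra_simps)
    moreover have "(a - b) / 2 = (a' - b') / 2 \<and> (a + b) / 2 = (a' + b') / 2 \<longleftrightarrow> b = b' \<and> a = a'" for a b a' b' :: real
      by auto
    ultimately show ?thesis by (simp only:)
  qed
  then show ?thesis
    unfolding vec_eq_iff forall_5 forall_3 vector_minus_component vector_scaleR_component 4 lift_nth(1-3)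
    by (auto simp: n_def u_def)
qed

lemma lorentz_lift:
  assumes "d \<noteq> 0" "d' \<noteq> 0"
  shows "lorentz (lift (c, d)) (lift (c', d')) = (d\<^sup>2 + d'\<^sup>2 - (norm (c - c'))\<^sup>2) / (2 * d * d')"
proof -
  have N: "(norm (c - c'))\<^sup>2 = (norm c)\<^sup>2 + (norm c')\<^sup>2 - 2 * (c \<bullet> c')"
    by (simp add: power2_norm_eq_inner inner_diff inner_commute)
  define n n' where nn': "n = (norm c)\<^sup>2 - d\<^sup>2" "n' = (norm c')\<^sup>2 - d'\<^sup>2"
  have "lorentz (lift (c, d)) (lift (c', d')) = (c \<bullet> c') / (d * d')
      + (n - 1) / d / 2 * ((n' - 1) / d' / 2) - (n + 1) / d / 2 * ((n' + 1) / d' / 2)"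
    unfolding lorentz_def lift_nth nn' by (simp add: inner_vec_def sum_3 add_divide_distrib)
  also have "\<dots> = (c \<bullet> c') / (d * d') - (n + n') / (2 * d * d')"
  proof -
    have "(n - 1) / d / 2 * ((n' - 1) / d' / 2) - (n + 1) / d / 2 * ((n' + 1) / d' / 2) = - ((n + n') / (2 * d * d'))"
      using assms by (simp add: field_simps)
    then show ?thesis by simp
  qed
  also have "\<dots> = (2 * (c \<bullet> c') - n - n') / (2 * d * d')"
    by (simp add: diff_divide_distrib add_divide_distrib)
  finally have "lorentz (lift (c, d)) (lift (c', d')) = (2 * (c \<bullet> c') - n - n') / (2 * d * d')" .
  then show ?thesis unfolding nn' N by simp
qed

text \<open>The centres of the spheres are \<open>\<bar>d + \<sigma> * d'\<bar>\<close> apart;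
  \<open>\<sigma> = 1\<close> is the case of horizontal edges, \<open>\<sigma> = -1\<close> that of
  vertical ones.\<close>

lemma lorentz_lift_touching:
  assumes "d \<noteq> 0" "d' \<noteq> 0" "\<sigma>\<^sup>2 = 1" "norm E = 1" "c' - c = (d + \<sigma> * d') *\<^sub>R E"
  shows "lorentz (lift (c, d)) (lift (c', d')) = - \<sigma>"
proof -
  have "(norm (c - c'))\<^sup>2 = (d + \<sigma> * d')\<^sup>2"
    using assms(4,5) by (metis norm_minus_commute norm_scaleR mult.right_neutral power2_abs)
  also have "\<dots> = d\<^sup>2 + d'\<^sup>2 + 2 * \<sigma> * d * d'"
    using assms(3) by (simp add: power2_sum power_mult_distrib)
  finally show ?thesis
    using assms(1,2) by (simp add: lorentz_lift field_simps)
qed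

section \<open>Quadrilaterals tangent to a circle, in complex coordinates of their plane\<close>

definition plane_pt :: "real^3 \<Rightarrow> real^3 \<Rightarrow> complex \<Rightarrow> real^3" where
  "plane_pt f g z = Re z *\<^sub>R f + Im z *\<^sub>R g"

lemma plane_pt_linear:
  "plane_pt f g (z + w) = plane_pt f g z + plane_pt f g w"
  "plane_pt f g (z - w) = plane_pt f g z - plane_pt f g w"
  "plane_pt f g (of_real r * z) = r *\<^sub>R plane_pt f g z"
  by (simp_all add: plane_pt_def algebra_simps)

definition orthonormal_pair :: "real^3 \<Rightarrow> real^3 \<Rightarrow> bool" where
  "orthonormal_pair f g \<longleftrightarrow> norm f = 1 \<and> norm g = 1 \<and> f \<bullet> g = 0"

lemma norm_plane_pt:
  assumes "orthonormal_pair f g"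
  shows "norm (plane_pt f g z) = cmod z"
proof -
  have "f \<bullet> f = 1" "g \<bullet> g = 1" "f \<bullet> g = 0"
    using assms by (auto simp: orthonormal_pair_def norm_eq_1)
  then have "(norm (plane_pt f g z))\<^sup>2 = (cmod z)\<^sup>2"
    unfolding cmod_power2 unfolding power2_norm_eq_inner plane_pt_def
    by (simp add: inner_add inner_commute power2_eq_square)
  then show ?thesis by (simp add: power2_eq_iff_nonneg)
qed

lemma cross3_plane_pt: "cross3 (plane_pt f g z) (plane_pt f g w) = Im (cnj z * w) *\<^sub>R cross3 f g"
  using cross_skew[of g f]
  by (simp add: plane_pt_def cross_add_left cross_add_right cross_mult_left cross_mult_right algebra_simps)

lemma cross3_orthonormal:
  assumes "orthonormal_pair f g"
  shows "cross3 f g \<noteq> 0"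
  using norm_cross[of f g] assms by (auto simp: orthonormal_pair_def)

text \<open>A quadrilateral with edges tangent to a circle of radius \<open>\<bar>\<rho>\<bar>\<close> about \<open>t\<close>; its edge \<open>x\<^sub>i x\<^sub>i\<^sub>+\<^sub>1\<close>
  touches the circle at the point with coordinate \<open>\<rho> z\<^sub>i\<close>, and \<open>\<bar>d\<^sub>i\<bar>\<close> is the distance from \<open>x\<^sub>i\<close> to the
  points of contact.\<close>

definition tangential ::
  "real^3 \<Rightarrow> real^3 \<Rightarrow> real^3 \<Rightarrow> real^3 \<Rightarrow> real \<Rightarrow> real \<Rightarrow> real \<Rightarrow> real \<Rightarrow> bool"
where
  "tangential x1 x2 x3 x4 d1 d2 d3 d4 \<longleftrightarrow> (\<exists>f g t \<rho> z1 z2 z3 z4.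
     orthonormal_pair f g \<and> \<rho> \<noteq> 0 \<and> cmod z1 = 1 \<and> cmod z2 = 1 \<and> cmod z3 = 1 \<and> cmod z4 = 1 \<and>
     (d1 > 0 \<and> d2 > 0 \<and> d3 > 0 \<and> d4 > 0 \<or> d1 < 0 \<and> d2 < 0 \<and> d3 < 0 \<and> d4 < 0) \<and>
     z4 * Complex \<rho> d1 = z1 * Complex \<rho> (- d1) \<and> z1 * Complex \<rho> d2 = z2 * Complex \<rho> (- d2) \<and>
     z2 * Complex \<rho> d3 = z3 * Complex \<rho> (- d3) \<and> z3 * Complex \<rho> d4 = z4 * Complex \<rho> (- d4) \<and>
     x1 = t + plane_pt f g (z1 * Complex \<rho> (- d1)) \<and> x2 = t + plane_pt f g (z2 * Complex \<rho> (- d2)) \<and>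
     x3 = t + plane_pt f g (z3 * Complex \<rho> (- d3)) \<and> x4 = t + plane_pt f g (z4 * Complex \<rho> (- d4)))"

lemma tangential_translate:
  assumes "tangential x1 x2 x3 x4 d1 d2 d3 d4"
    and "y2 - y1 = x2 - x1" "y3 - y2 = x3 - x2" "y4 - y3 = x4 - x3"
  shows "tangential y1 y2 y3 y4 d1 d2 d3 d4"
proof -
  define a where "a = y1 - x1"
  have 1: "y1 = a + x1" by (simp add: a_def)
  have 2: "y2 = a + x2" using assms(2) by (simp add: a_def algebra_simps)
  have 3: "y3 = a + x3" using assms(3) by (simp add: 2 algebra_simps)
  have 4: "y4 = a + x4" using assms(4) by (simp add: 3 algebra_simps)
  note y = 1 2 3 4
  show ?thesis
    using assms(1) unfolding tangential_def y
    by (elim exE, rename_tac f g t \<rho> z1 z2 z3 z4)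
       (rule_tac x = f in exI, rule_tac x = g in exI, rule_tac x = "a + t" in exI, rule_tac x = \<rho> in exI,
        rule_tac x = z1 in exI, rule_tac x = z2 in exI, rule_tac x = z3 in exI, rule_tac x = z4 in exI,
        simp add: add.assoc)
qed

text \<open>Turning over the plane, \<open>g\<close> to \<open>- g\<close>, conjugates all
  coordinates and so changes the sign of every tangent length.\<close>

lemma tangential_uminus:
  assumes "tangential x1 x2 x3 x4 d1 d2 d3 d4"
  shows "tangential x1 x2 x3 x4 (- d1) (- d2) (- d3) (- d4)"
proof -
  have 1: "orthonormal_pair f g \<Longrightarrow> orthonormal_pair f (- g)" for f g
    by (simp add: orthonormal_pair_def)
  have 2: "plane_pt f g (z * Complex \<rho> d) = plane_pt f (- g) (cnj z * Complex \<rho> (- d))" for f g z \<rho> d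
    by (simp add: plane_pt_def algebra_simps)
  have 3: "z * Complex \<rho> d = w * Complex \<rho> d' \<Longrightarrow> cnj z * Complex \<rho> (- d) = cnj w * Complex \<rho> (- d')" for z w \<rho> d d'
    by (drule arg_cong[of _ _ cnj]) (simp add: complex_cnj)
  obtain f g t \<rho> z1 z2 z3 z4 where
    *: "orthonormal_pair f g" "\<rho> \<noteq> 0" "cmod z1 = 1" "cmod z2 = 1" "cmod z3 = 1" "cmod z4 = 1"
     "d1 > 0 \<and> d2 > 0 \<and> d3 > 0 \<and> d4 > 0 \<or> d1 < 0 \<and> d2 < 0 \<and> d3 < 0 \<and> d4 < 0"
     "z4 * Complex \<rho> d1 = z1 * Complex \<rho> (- d1)" "z1 * Complex \<rho> d2 = z2 * Complex \<rho> (- d2)"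
     "z2 * Complex \<rho> d3 = z3 * Complex \<rho> (- d3)" "z3 * Complex \<rho> d4 = z4 * Complex \<rho> (- d4)"
     "x1 = t + plane_pt f g (z1 * Complex \<rho> (- d1))" "x2 = t + plane_pt f g (z2 * Complex \<rho> (- d2))"
     "x3 = t + plane_pt f g (z3 * Complex \<rho> (- d3))" "x4 = t + plane_pt f g (z4 * Complex \<rho> (- d4))"
    using assms unfolding tangential_def by auto
  show ?thesis
    unfolding tangential_def
    apply (rule exI[of _ f], rule exI[of _ "- g"], rule exI[of _ t], rule exI[of _ \<rho>], rule exI[of _ "cnj z1"],
        rule exI[of _ "cnj z2"], rule exI[of _ "cnj z3"], rule exI[of _ "cnj z4"])
    using *(1-7) 1[OF *(1)] 3[OF *(8)] 3[OF *(9)] 3[OF *(10)] 3[OF *(11)]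
      2[of f g z1 \<rho> "- d1"] 2[of f g z2 \<rho> "- d2"] 2[of f g z3 \<rho> "- d3"] 2[of f g z4 \<rho> "- d4"] *(12-15)
    by auto
qed

text \<open>In terms of the points of contact the relation between the lifts of the four vertex spheres becomes the
  rational identity \<open>contact_identity\<close>.\<close>

lemma tangential_corner:
  assumes "z * Complex \<rho> d = z' * Complex \<rho> (- d)" "d \<noteq> 0" "cmod z = 1"
  shows "z' \<noteq> z" "of_real \<rho> * of_real (1 / d) = \<i> * (z + z') / (z' - z)"
    "of_real (1 / d) * (z' * Complex \<rho> (- d)) = 2 * \<i> * z * z' / (z' - z)"
proof -
  have z: "z \<noteq> 0" using assms(3) by auto
  have e: "z * (of_real \<rho> + \<i> * of_real d) = z' * (of_real \<rho> - \<i> * of_real d)"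
    using assms(1) by (simp add: Complex_eq)
  then have e': "of_real \<rho> * (z' - z) = \<i> * of_real d * (z + z')"
    by (simp add: algebra_simps)
  show "z' \<noteq> z" using e' z assms(2) by auto
  then have ne: "z' - z \<noteq> 0" by simp
  show "of_real \<rho> * of_real (1 / d) = \<i> * (z + z') / (z' - z)"
    using e' ne assms(2) by (simp add: field_simps)
  have "(z' - z) * (z' * (of_real \<rho> - \<i> * of_real d)) = z' * (\<i> * of_real d * (z + z') - \<i> * of_real d * (z' - z))"
    unfolding e'[symmetric] by (simp add: algebra_simps)
  also have "\<dots> = of_real d * (2 * \<i> * z * z')" by (simp add: algebra_simps)
  finally show "of_real (1 / d) * (z' * Complex \<rho> (- d)) = 2 * \<i> * z * z' / (z' - z)"
    using ne assms(2) by (simp add: Complex_eq field_simps)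
qed

text \<open>Over the common denominators \<open>?D\<close> and \<open>?E\<close>, both sides consist
  of the factor \<open>z2 * z4 - z1 * z3\<close> and one cubic numerator; the two changes of sign on
  the right cancel.\<close>

lemma contact_identity:
  fixes z1 z2 z3 z4 :: complex
  assumes "z2 \<noteq> z1" "z3 \<noteq> z2" "z4 \<noteq> z3" "z1 \<noteq> z4"
  shows "((z1 + z2) / (z2 - z1) + (z3 + z4) / (z4 - z3)) * (z4 * z1 / (z1 - z4) + z2 * z3 / (z3 - z2))
       = ((z4 + z1) / (z1 - z4) + (z2 + z3) / (z3 - z2)) * (z1 * z2 / (z2 - z1) + z3 * z4 / (z4 - z3))"
proof -
  have ne: "z2 - z1 \<noteq> 0" "z3 - z2 \<noteq> 0" "z4 - z3 \<noteq> 0" "z1 - z4 \<noteq> 0" using assms by auto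
  let ?D = "(z2 - z1) * (z4 - z3)" and ?E = "(z1 - z4) * (z3 - z2)"
  have 1: "(z1 + z2) / (z2 - z1) + (z3 + z4) / (z4 - z3) = 2 * (z2 * z4 - z1 * z3) / ?D"
    using ne by (simp add: divide_simps) (simp add: algebra_simps)
  have 2: "(z4 + z1) / (z1 - z4) + (z2 + z3) / (z3 - z2) = 2 * (z1 * z3 - z2 * z4) / ?E"
    using ne by (simp add: divide_simps) (simp add: algebra_simps)
  have 3: "z4 * z1 / (z1 - z4) + z2 * z3 / (z3 - z2) = (z1 * z3 * z4 - z1 * z2 * z4 + z1 * z2 * z3 - z2 * z3 * z4) / ?E"
    using ne by (simp add: divide_simps) (simp add: algebra_simps)
  have 4: "z1 * z2 / (z2 - z1) + z3 * z4 / (z4 - z3) = - (z1 * z3 * z4 - z1 * z2 * z4 + z1 * z2 * z3 - z2 * z3 * z4) / ?D"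
    using ne by (simp add: divide_simps) (simp add: algebra_simps)
  show ?thesis unfolding 1 2 3 4 by (simp add: algebra_simps)
qed

lemma tangentialE:
  assumes "tangential x1 x2 x3 x4 d1 d2 d3 d4"
  obtains f g t \<rho> z1 z2 z3 z4 where
    "orthonormal_pair f g" "\<rho> \<noteq> 0" "cmod z1 = 1" "cmod z2 = 1" "cmod z3 = 1" "cmod z4 = 1"
    "d1 > 0 \<and> d2 > 0 \<and> d3 > 0 \<and> d4 > 0 \<or> d1 < 0 \<and> d2 < 0 \<and> d3 < 0 \<and> d4 < 0"
    "z4 * Complex \<rho> d1 = z1 * Complex \<rho> (- d1)" "z1 * Complex \<rho> d2 = z2 * Complex \<rho> (- d2)"
    "z2 * Complex \<rho> d3 = z3 * Complex \<rho> (- d3)" "z3 * Complex \<rho> d4 = z4 * Complex \<rho> (- d4)"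
    "x1 = t + plane_pt f g (z1 * Complex \<rho> (- d1))" "x2 = t + plane_pt f g (z2 * Complex \<rho> (- d2))"
    "x3 = t + plane_pt f g (z3 * Complex \<rho> (- d3))" "x4 = t + plane_pt f g (z4 * Complex \<rho> (- d4))"
  using assms unfolding tangential_def by auto

text \<open>These are the components of a linear relation between lifts. The numbers
  \<open>\<rho> / d\<close> and the vertices divided by \<open>d\<close> are rational in the points
  of contact, so \<open>contact_identity\<close> applies; the last component follows from the first
  two because a vertex has squared distance \<open>\<rho>\<^sup>2 + d\<^sup>2\<close> from the
  centre.\<close>

lemma tangential_weighted_diagonals:
  assumes "tangential x1 x2 x3 x4 d1 d2 d3 d4"
  obtains a where "a \<noteq> 0" "1 / d1 + 1 / d3 = a * (1 / d2 + 1 / d4)"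
    "(1 / d1) *\<^sub>R x1 + (1 / d3) *\<^sub>R x3 = a *\<^sub>R ((1 / d2) *\<^sub>R x2 + (1 / d4) *\<^sub>R x4)"
    "((norm x1)\<^sup>2 - d1\<^sup>2) / d1 + ((norm x3)\<^sup>2 - d3\<^sup>2) / d3
      = a * (((norm x2)\<^sup>2 - d2\<^sup>2) / d2 + ((norm x4)\<^sup>2 - d4\<^sup>2) / d4)"
proof -
  obtain f g t \<rho> z1 z2 z3 z4 where T:
    "orthonormal_pair f g" "\<rho> \<noteq> 0" "cmod z1 = 1" "cmod z2 = 1" "cmod z3 = 1" "cmod z4 = 1"
    "d1 > 0 \<and> d2 > 0 \<and> d3 > 0 \<and> d4 > 0 \<or> d1 < 0 \<and> d2 < 0 \<and> d3 < 0 \<and> d4 < 0"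
    "z4 * Complex \<rho> d1 = z1 * Complex \<rho> (- d1)" "z1 * Complex \<rho> d2 = z2 * Complex \<rho> (- d2)"
    "z2 * Complex \<rho> d3 = z3 * Complex \<rho> (- d3)" "z3 * Complex \<rho> d4 = z4 * Complex \<rho> (- d4)"
    "x1 = t + plane_pt f g (z1 * Complex \<rho> (- d1))" "x2 = t + plane_pt f g (z2 * Complex \<rho> (- d2))"
    "x3 = t + plane_pt f g (z3 * Complex \<rho> (- d3))" "x4 = t + plane_pt f g (z4 * Complex \<rho> (- d4))"
    by (rule tangentialE[OF assms])
  have d: "d1 \<noteq> 0" "d2 \<noteq> 0" "d3 \<noteq> 0" "d4 \<noteq> 0" using T(7) by auto
  \<comment> \<open>Forced by the first equation; the common sign of the \<open>d\<close> keeps both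
    sums away from zero.\<close>
  define a where "a = (1 / d1 + 1 / d3) / (1 / d2 + 1 / d4)"
  have s: "1 / d1 + 1 / d3 \<noteq> 0" "1 / d2 + 1 / d4 \<noteq> 0"
  proof -
    have pm: "u > 0 \<and> v > 0 \<or> u < 0 \<and> v < 0 \<Longrightarrow> 1 / u + 1 / v \<noteq> 0" for u v :: real
      using add_pos_pos[of "1 / u" "1 / v"] add_neg_neg[of "1 / u" "1 / v"] by auto
    show "1 / d1 + 1 / d3 \<noteq> 0" "1 / d2 + 1 / d4 \<noteq> 0"
      using T(7) by (auto intro!: pm)
  qed
  have A: "1 / d1 + 1 / d3 = a * (1 / d2 + 1 / d4)" using s by (simp add: a_def)
  define c1 c2 c3 c4 where c_defs: "c1 = z1 * Complex \<rho> (- d1)" "c2 = z2 * Complex \<rho> (- d2)"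
    "c3 = z3 * Complex \<rho> (- d3)" "c4 = z4 * Complex \<rho> (- d4)"
  note k1 = tangential_corner[OF T(8) d(1) T(6)] and k2 = tangential_corner[OF T(9) d(2) T(3)]
    and k3 = tangential_corner[OF T(10) d(3) T(4)] and k4 = tangential_corner[OF T(11) d(4) T(5)]
  define u1 u2 u3 u4 where u_defs: "u1 = complex_of_real (1 / d1)" "u2 = complex_of_real (1 / d2)"
    "u3 = complex_of_real (1 / d3)" "u4 = complex_of_real (1 / d4)"
  have "of_real \<rho> * ((u2 + u4) * (u1 * c1 + u3 * c3)) = of_real \<rho> * ((u1 + u3) * (u2 * c2 + u4 * c4))"
  proof -
    have "of_real \<rho> * ((u2 + u4) * (u1 * c1 + u3 * c3))
      = (of_real \<rho> * u2 + of_real \<rho> * u4) * (u1 * c1 + u3 * c3)" by (simp add: algebra_simps)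
    also have "\<dots> = (\<i> * (z1 + z2) / (z2 - z1) + \<i> * (z3 + z4) / (z4 - z3))
       * (2 * \<i> * z4 * z1 / (z1 - z4) + 2 * \<i> * z2 * z3 / (z3 - z2))"
      unfolding u_defs c_defs k1 k2 k3 k4 ..
    also have "\<dots> = (2 * \<i> * \<i>) * (((z1 + z2) / (z2 - z1) + (z3 + z4) / (z4 - z3)) * (z4 * z1 / (z1 - z4) + z2 * z3 / (z3 - z2)))"
      by (simp only: times_divide_eq_right[symmetric] mult.assoc) (simp only: algebra_simps)
    also have "\<dots> = (2 * \<i> * \<i>) * (((z4 + z1) / (z1 - z4) + (z2 + z3) / (z3 - z2)) * (z1 * z2 / (z2 - z1) + z3 * z4 / (z4 - z3)))"
      using contact_identity[OF k2(1) k3(1) k4(1) k1(1)] by simp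
    also have "\<dots> = (\<i> * (z4 + z1) / (z1 - z4) + \<i> * (z2 + z3) / (z3 - z2))
       * (2 * \<i> * z1 * z2 / (z2 - z1) + 2 * \<i> * z3 * z4 / (z4 - z3))"
      by (simp only: times_divide_eq_right[symmetric] mult.assoc) (simp only: algebra_simps)
    also have "\<dots> = (of_real \<rho> * u1 + of_real \<rho> * u3) * (u2 * c2 + u4 * c4)"
      unfolding u_defs c_defs k1 k2 k3 k4 ..
    finally show ?thesis by (simp add: algebra_simps)
  qed
  then have "(u2 + u4) * (u1 * c1 + u3 * c3) = (u1 + u3) * (u2 * c2 + u4 * c4)"
    using T(2) by simp
  moreover have "u1 + u3 = of_real (1 / d1 + 1 / d3)" "u2 + u4 = of_real (1 / d2 + 1 / d4)"
    unfolding u_defs of_real_add by (rule refl)+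
  then have "u1 + u3 = of_real a * (u2 + u4)" "u2 + u4 \<noteq> 0"
    using s(2) unfolding A of_real_mult by (simp_all only: of_real_eq_0_iff not_False_eq_True)
  ultimately have "u1 * c1 + u3 * c3 = of_real a * (u2 * c2 + u4 * c4)"
    by (simp add: mult.commute mult.left_commute)
  then have "plane_pt f g (u1 * c1 + u3 * c3) = plane_pt f g (of_real a * (u2 * c2 + u4 * c4))" by simp
  then have P: "(1 / d1) *\<^sub>R plane_pt f g c1 + (1 / d3) *\<^sub>R plane_pt f g c3
      = a *\<^sub>R ((1 / d2) *\<^sub>R plane_pt f g c2 + (1 / d4) *\<^sub>R plane_pt f g c4)"
    unfolding plane_pt_linear u_defs .
  \<comment> \<open>The power of the origin over \<open>d\<close> is a combination of
    \<open>1 / d\<close> and the weighted vertex, with coefficients common to all four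
    vertices.\<close>
  have N: "((norm (t + plane_pt f g (z * Complex \<rho> (- d))))\<^sup>2 - d\<^sup>2) / d
      = (1 / d) * ((norm t)\<^sup>2 + \<rho>\<^sup>2) + 2 * (t \<bullet> ((1 / d) *\<^sub>R plane_pt f g (z * Complex \<rho> (- d))))"
    if "cmod z = 1" "d \<noteq> 0" for z d
  proof -
    have "(norm (plane_pt f g (z * Complex \<rho> (- d))))\<^sup>2 = \<rho>\<^sup>2 + d\<^sup>2"
      unfolding norm_plane_pt[OF T(1)] norm_mult that(1) by (simp add: cmod_power2)
    then have "(norm (t + plane_pt f g (z * Complex \<rho> (- d))))\<^sup>2 - d\<^sup>2
      = (norm t)\<^sup>2 + \<rho>\<^sup>2 + 2 * (t \<bullet> plane_pt f g (z * Complex \<rho> (- d)))"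
      unfolding power2_norm_eq_inner by (simp add: inner_add inner_commute)
    then show ?thesis by (simp add: add_divide_distrib)
  qed
  show thesis
  proof (rule that)
    show "a \<noteq> 0" using s by (simp add: a_def)
    show "1 / d1 + 1 / d3 = a * (1 / d2 + 1 / d4)" by (rule A)
    have "(1 / d1) *\<^sub>R x1 + (1 / d3) *\<^sub>R x3 = (1 / d1 + 1 / d3) *\<^sub>R t + ((1 / d1) *\<^sub>R plane_pt f g c1 + (1 / d3) *\<^sub>R plane_pt f g c3)"
      unfolding T(12-15) c_defs by (simp add: algebra_simps)
    also have "\<dots> = a *\<^sub>R ((1 / d2) *\<^sub>R x2 + (1 / d4) *\<^sub>R x4)"
      unfolding A P unfolding T(12-15) c_defs by (simp add: algebra_simps)
    finally show "(1 / d1) *\<^sub>R x1 + (1 / d3) *\<^sub>R x3 = a *\<^sub>R ((1 / d2) *\<^sub>R x2 + (1 / d4) *\<^sub>R x4)" .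
    have "((norm x1)\<^sup>2 - d1\<^sup>2) / d1 + ((norm x3)\<^sup>2 - d3\<^sup>2) / d3
       = (1 / d1 + 1 / d3) * ((norm t)\<^sup>2 + \<rho>\<^sup>2) + 2 * (t \<bullet> ((1 / d1) *\<^sub>R plane_pt f g c1 + (1 / d3) *\<^sub>R plane_pt f g c3))"
      unfolding T(12-15) N[OF T(3) d(1)] N[OF T(5) d(3)] c_defs by (simp add: inner_add algebra_simps)
    also have "\<dots> = a * (((norm x2)\<^sup>2 - d2\<^sup>2) / d2 + ((norm x4)\<^sup>2 - d4\<^sup>2) / d4)"
      unfolding A P unfolding T(12-15) N[OF T(4) d(2)] N[OF T(6) d(4)] c_defs by (simp add: inner_add algebra_simps)
    finally show "((norm x1)\<^sup>2 - d1\<^sup>2) / d1 + ((norm x3)\<^sup>2 - d3\<^sup>2) / d3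
      = a * (((norm x2)\<^sup>2 - d2\<^sup>2) / d2 + ((norm x4)\<^sup>2 - d4\<^sup>2) / d4)" .
  qed
qed

text \<open>Opposite signs at \<open>x3\<close> and \<open>x4\<close> turn the weighted sums over
  the diagonals into differences of lifts.\<close>

lemma tangential_lift:
  assumes "tangential x1 x2 x3 x4 d1 d2 (- d3) (- d4)"
  obtains a where "a \<noteq> 0" "lift (x3, d3) - lift (x1, d1) = a *\<^sub>R (lift (x4, d4) - lift (x2, d2))"
proof -
  obtain a where a: "a \<noteq> 0" "1 / d1 + 1 / - d3 = a * (1 / d2 + 1 / - d4)"
    "(1 / d1) *\<^sub>R x1 + (1 / - d3) *\<^sub>R x3 = a *\<^sub>R ((1 / d2) *\<^sub>R x2 + (1 / - d4) *\<^sub>R x4)"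
    "((norm x1)\<^sup>2 - d1\<^sup>2) / d1 + ((norm x3)\<^sup>2 - (- d3)\<^sup>2) / - d3
      = a * (((norm x2)\<^sup>2 - d2\<^sup>2) / d2 + ((norm x4)\<^sup>2 - (- d4)\<^sup>2) / - d4)"
    by (rule tangential_weighted_diagonals[OF assms])
  have "lift (x1, d1) - lift (x3, d3) = a *\<^sub>R (lift (x2, d2) - lift (x4, d4))"
    unfolding lift_diff_eq_iff using a(2-4) by (simp add: minus_divide_right[symmetric])
  then have "lift (x3, d3) - lift (x1, d1) = a *\<^sub>R (lift (x4, d4) - lift (x2, d2))"
    by (metis minus_diff_eq scaleR_minus_right)
  then show thesis using that a(1) by blast
qed

text \<open>Two vertices on one tangent have coordinates \<open>z * (\<rho> - \<i> * d)\<close> and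
  \<open>z * (\<rho> + \<i> * d')\<close>, and since \<open>z\<close> has modulus \<open>1\<close>
  the product is \<open>(\<rho> + \<i> * d) * (\<rho> + \<i> * d')\<close>.\<close>

lemma adjacent_contacts:
  assumes "cmod z = 1"
  shows "Re (cnj (z * Complex \<rho> (- d)) * (z * Complex \<rho> d')) = \<rho>\<^sup>2 - d * d'"
    "Im (cnj (z * Complex \<rho> (- d)) * (z * Complex \<rho> d')) = \<rho> * (d + d')"
proof -
  have z: "(Re z)\<^sup>2 + (Im z)\<^sup>2 = 1" using assms by (simp add: cmod_def)
  have "Re (cnj (z * Complex \<rho> (- d)) * (z * Complex \<rho> d')) = (\<rho>\<^sup>2 - d * d') * ((Re z)\<^sup>2 + (Im z)\<^sup>2)"
    "Im (cnj (z * Complex \<rho> (- d)) * (z * Complex \<rho> d')) = \<rho> * (d + d') * ((Re z)\<^sup>2 + (Im z)\<^sup>2)"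
    by (simp_all add: power2_eq_square algebra_simps)
  then show "Re (cnj (z * Complex \<rho> (- d)) * (z * Complex \<rho> d')) = \<rho>\<^sup>2 - d * d'"
    "Im (cnj (z * Complex \<rho> (- d)) * (z * Complex \<rho> d')) = \<rho> * (d + d')"
    unfolding z by simp_all
qed

text \<open>Up to sign the area is \<open>\<rho>\<close> times half the perimeter, and half the
  perimeter is the sum of the tangent lengths, which have a common sign.\<close>

lemma tangential_area:
  assumes "tangential x1 x2 x3 x4 d1 d2 d3 d4"
  shows "mixed_area (x1, x2, x3, x4) (x1, x2, x3, x4) \<noteq> 0"
proof -
  obtain f g t \<rho> z1 z2 z3 z4 where T:
    "orthonormal_pair f g" "\<rho> \<noteq> 0" "cmod z1 = 1" "cmod z2 = 1" "cmod z3 = 1" "cmod z4 = 1"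
    "d1 > 0 \<and> d2 > 0 \<and> d3 > 0 \<and> d4 > 0 \<or> d1 < 0 \<and> d2 < 0 \<and> d3 < 0 \<and> d4 < 0"
    "z4 * Complex \<rho> d1 = z1 * Complex \<rho> (- d1)" "z1 * Complex \<rho> d2 = z2 * Complex \<rho> (- d2)"
    "z2 * Complex \<rho> d3 = z3 * Complex \<rho> (- d3)" "z3 * Complex \<rho> d4 = z4 * Complex \<rho> (- d4)"
    "x1 = t + plane_pt f g (z1 * Complex \<rho> (- d1))" "x2 = t + plane_pt f g (z2 * Complex \<rho> (- d2))"
    "x3 = t + plane_pt f g (z3 * Complex \<rho> (- d3))" "x4 = t + plane_pt f g (z4 * Complex \<rho> (- d4))"
    by (rule tangentialE[OF assms])
  define c1 c2 c3 c4 where c_defs: "c1 = z1 * Complex \<rho> (- d1)" "c2 = z2 * Complex \<rho> (- d2)"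
    "c3 = z3 * Complex \<rho> (- d3)" "c4 = z4 * Complex \<rho> (- d4)"
  have e: "c1 = z4 * Complex \<rho> d1" "c2 = z1 * Complex \<rho> d2" "c3 = z2 * Complex \<rho> d3" "c4 = z3 * Complex \<rho> d4"
    by (simp_all only: c_defs T(8-11))
  have adj: "Im (cnj c1 * c2) = \<rho> * (d1 + d2)" "Im (cnj c2 * c3) = \<rho> * (d2 + d3)"
    "Im (cnj c3 * c4) = \<rho> * (d3 + d4)" "Im (cnj c4 * c1) = \<rho> * (d4 + d1)"
    by (subst c_defs(1), subst e(2), rule adjacent_contacts(2)[OF T(3)])
       (subst c_defs(2), subst e(3), rule adjacent_contacts(2)[OF T(4)],
        subst c_defs(3), subst e(4), rule adjacent_contacts(2)[OF T(5)],
        subst c_defs(4), subst e(1), rule adjacent_contacts(2)[OF T(6)])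
  have "Im (cnj (c3 - c1) * (c4 - c2)) = Im (cnj c3 * c4) + Im (cnj c2 * c3) + Im (cnj c4 * c1) + Im (cnj c1 * c2)"
    by (simp add: algebra_simps)
  also have "\<dots> = 2 * \<rho> * (d1 + d2 + d3 + d4)" unfolding adj by (simp add: algebra_simps)
  finally have "Im (cnj (c3 - c1) * (c4 - c2)) = 2 * \<rho> * (d1 + d2 + d3 + d4)" .
  moreover have "d1 + d2 + d3 + d4 \<noteq> 0" using T(7) by (elim disjE conjE) linarith+
  ultimately have im: "Im (cnj (c3 - c1) * (c4 - c2)) \<noteq> 0" using T(2) by simp
  have "mixed_area (x1, x2, x3, x4) (x1, x2, x3, x4) = (1/2) *\<^sub>R cross3 (x3 - x1) (x4 - x2)"
    by (simp add: mixed_area_def flip: scaleR_2)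
  also have "\<dots> = (1/2) *\<^sub>R (Im (cnj (c3 - c1) * (c4 - c2)) *\<^sub>R cross3 f g)"
    unfolding T(12-15) by (simp add: c_defs cross3_plane_pt flip: plane_pt_linear)
  finally show ?thesis using im cross3_orthonormal[OF T(1)] by simp
qed

text \<open>In the coordinates of the plane the Christoffel dual is \<open>\<plusminus> \<i> l c / (\<rho> d)\<close> with alternating signs.\<close>

lemma tangential_dual_edge:
  assumes "\<rho> \<noteq> 0" "d \<noteq> 0" "d' \<noteq> 0"
  shows "\<i> * of_real (l / (\<rho> * d')) * (z * Complex \<rho> d') + \<i> * of_real (l / (\<rho> * d)) * (z * Complex \<rho> (- d))
    = of_real (l / (d * d')) * (z * Complex \<rho> d' - z * Complex \<rho> (- d))"
proof -
  have 1: "\<i> * of_real (l / (\<rho> * d')) * Complex \<rho> d' = Complex (- l / \<rho>) (l / d')"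
    "\<i> * of_real (l / (\<rho> * d)) * Complex \<rho> (- d) = Complex (l / \<rho>) (l / d)"
    using assms by (simp_all add: complex_eq_iff)
  have "\<i> * of_real (l / (\<rho> * d')) * (z * Complex \<rho> d') + \<i> * of_real (l / (\<rho> * d)) * (z * Complex \<rho> (- d))
    = z * (\<i> * of_real (l / (\<rho> * d')) * Complex \<rho> d' + \<i> * of_real (l / (\<rho> * d)) * Complex \<rho> (- d))"
    by (simp only: algebra_simps)
  also have "\<dots> = z * (of_real (l / (d * d')) * (Complex \<rho> d' - Complex \<rho> (- d)))"
    unfolding 1 using assms by (simp add: complex_eq_iff field_simps)
  finally show ?thesis by (simp only: algebra_simps)
qed

text \<open>Multiplying the vertex coordinates by \<open>\<i> * l / (\<rho> * d)\<close> with
  alternating signs gives points whose consecutive differences are the required edges, so the dual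
  closes up. It is tangent to a circle of signed radius \<open>l / \<rho>\<close>, two opposite
  points of contact being reversed.\<close>

lemma tangential_dual:
  assumes tan: "tangential x1 x2 x3 x4 d1 d2 d3 d4" and "l \<noteq> 0"
  shows tangential_dual_closed: "(l / (d1 * d2)) *\<^sub>R (x2 - x1) - (l / (d2 * d3)) *\<^sub>R (x3 - x2)
      + (l / (d3 * d4)) *\<^sub>R (x4 - x3) - (l / (d4 * d1)) *\<^sub>R (x1 - x4) = 0" (is ?closed)
    and "y2 - y1 = (l / (d1 * d2)) *\<^sub>R (x2 - x1) \<Longrightarrow> y3 - y2 = - (l / (d2 * d3)) *\<^sub>R (x3 - x2) \<Longrightarrow>
      y4 - y3 = (l / (d3 * d4)) *\<^sub>R (x4 - x3) \<Longrightarrow>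
      tangential y1 y2 y3 y4 (l / d1) (l / d2) (l / d3) (l / d4) \<and>
      mixed_area (x1, x2, x3, x4) (y1, y2, y3, y4) = 0" (is "?A \<Longrightarrow> ?B \<Longrightarrow> ?C \<Longrightarrow> ?T \<and> ?M")
proof -
  obtain f g t \<rho> z1 z2 z3 z4 where T:
    "orthonormal_pair f g" "\<rho> \<noteq> 0" "cmod z1 = 1" "cmod z2 = 1" "cmod z3 = 1" "cmod z4 = 1"
    "d1 > 0 \<and> d2 > 0 \<and> d3 > 0 \<and> d4 > 0 \<or> d1 < 0 \<and> d2 < 0 \<and> d3 < 0 \<and> d4 < 0"
    "z4 * Complex \<rho> d1 = z1 * Complex \<rho> (- d1)" "z1 * Complex \<rho> d2 = z2 * Complex \<rho> (- d2)"
    "z2 * Complex \<rho> d3 = z3 * Complex \<rho> (- d3)" "z3 * Complex \<rho> d4 = z4 * Complex \<rho> (- d4)"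
    "x1 = t + plane_pt f g (z1 * Complex \<rho> (- d1))" "x2 = t + plane_pt f g (z2 * Complex \<rho> (- d2))"
    "x3 = t + plane_pt f g (z3 * Complex \<rho> (- d3))" "x4 = t + plane_pt f g (z4 * Complex \<rho> (- d4))"
    by (rule tangentialE[OF tan])
  have d: "d1 \<noteq> 0" "d2 \<noteq> 0" "d3 \<noteq> 0" "d4 \<noteq> 0" using T(7) by auto
  define c1 c2 c3 c4 where c_defs: "c1 = z1 * Complex \<rho> (- d1)" "c2 = z2 * Complex \<rho> (- d2)"
    "c3 = z3 * Complex \<rho> (- d3)" "c4 = z4 * Complex \<rho> (- d4)"
  have e: "c1 = z4 * Complex \<rho> d1" "c2 = z1 * Complex \<rho> d2" "c3 = z2 * Complex \<rho> d3" "c4 = z3 * Complex \<rho> d4"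
    by (simp_all only: c_defs T(8-11))
  have x: "x1 = t + plane_pt f g c1" "x2 = t + plane_pt f g c2" "x3 = t + plane_pt f g c3" "x4 = t + plane_pt f g c4"
    using T(12-15) by (simp_all only: c_defs)
  define b where "b = (\<lambda>d. \<i> * complex_of_real (l / (\<rho> * d)))"
  define Y1 Y2 Y3 Y4 where Y: "Y1 = - (b d1 * c1)" "Y2 = b d2 * c2" "Y3 = - (b d3 * c3)" "Y4 = b d4 * c4"
  have E12: "Y2 - Y1 = of_real (l / (d1 * d2)) * (c2 - c1)"
    using tangential_dual_edge[OF T(2) d(1,2), of l z1]
    unfolding Y b_def e(2)[symmetric] c_defs(1)[symmetric] by simp
  have E23: "Y3 - Y2 = of_real (- (l / (d2 * d3))) * (c3 - c2)"
    using tangential_dual_edge[OF T(2) d(2,3), of l z2]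
    unfolding Y b_def e(3)[symmetric] c_defs(2)[symmetric] of_real_minus by (simp add: algebra_simps)
  have E34: "Y4 - Y3 = of_real (l / (d3 * d4)) * (c4 - c3)"
    using tangential_dual_edge[OF T(2) d(3,4), of l z3]
    unfolding Y b_def e(4)[symmetric] c_defs(3)[symmetric] by simp
  have E41: "Y1 - Y4 = of_real (- (l / (d4 * d1))) * (c1 - c4)"
    using tangential_dual_edge[OF T(2) d(4,1), of l z4]
    unfolding Y b_def e(1)[symmetric] c_defs(4)[symmetric] of_real_minus by (simp add: algebra_simps)
  have P: "plane_pt f g Y2 - plane_pt f g Y1 = (l / (d1 * d2)) *\<^sub>R (x2 - x1)"
    "plane_pt f g Y3 - plane_pt f g Y2 = - (l / (d2 * d3)) *\<^sub>R (x3 - x2)"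
    "plane_pt f g Y4 - plane_pt f g Y3 = (l / (d3 * d4)) *\<^sub>R (x4 - x3)"
    "plane_pt f g Y1 - plane_pt f g Y4 = - (l / (d4 * d1)) *\<^sub>R (x1 - x4)"
    unfolding plane_pt_linear(2)[symmetric] E12 E23 E34 E41
    unfolding plane_pt_linear(3) plane_pt_linear(2) x by simp_all
  have "(l / (d1 * d2)) *\<^sub>R (x2 - x1) + - (l / (d2 * d3)) *\<^sub>R (x3 - x2)
      + (l / (d3 * d4)) *\<^sub>R (x4 - x3) + - (l / (d4 * d1)) *\<^sub>R (x1 - x4) = 0"
    unfolding P[symmetric] by simp
  then show ?closed by (simp only: scaleR_minus_left diff_conv_add_uminus)
  assume A: ?A and B: ?B and C: ?C
  define z1' z3' where z': "z1' = - z1" "z3' = - z3"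
  define \<rho>' where "\<rho>' = l / \<rho>"
  have k: "b d * Complex \<rho> (- d) = Complex \<rho>' (- (- (l / d)))" "b d * Complex \<rho> d = - Complex \<rho>' (- (l / d))" if "d \<noteq> 0" for d
    using T(2) that by (simp_all add: b_def \<rho>'_def complex_eq_iff)
  have Yz: "Y1 = z1' * Complex \<rho>' (- (- (l / d1)))" "Y2 = z2 * Complex \<rho>' (- (- (l / d2)))"
    "Y3 = z3' * Complex \<rho>' (- (- (l / d3)))" "Y4 = z4 * Complex \<rho>' (- (- (l / d4)))"
    unfolding k(1)[OF d(1), symmetric] k(1)[OF d(2), symmetric] k(1)[OF d(3), symmetric] k(1)[OF d(4), symmetric] Y c_defs z'
    by (simp_all only: mult.left_commute mult_minus_left)
  have Yz': "Y1 = z4 * Complex \<rho>' (- (l / d1))" "Y2 = z1' * Complex \<rho>' (- (l / d2))"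
    "Y3 = z2 * Complex \<rho>' (- (l / d3))" "Y4 = z3' * Complex \<rho>' (- (l / d4))"
  proof -
    have "Y1 = z4 * - (b d1 * Complex \<rho> d1)" "Y2 = z1' * - (b d2 * Complex \<rho> d2)"
      "Y3 = z2 * - (b d3 * Complex \<rho> d3)" "Y4 = z3' * - (b d4 * Complex \<rho> d4)"
      unfolding Y e z' by (simp_all only: mult.left_commute mult_minus_left mult_minus_right minus_minus)
    then show "Y1 = z4 * Complex \<rho>' (- (l / d1))" "Y2 = z1' * Complex \<rho>' (- (l / d2))"
    "Y3 = z2 * Complex \<rho>' (- (l / d3))" "Y4 = z3' * Complex \<rho>' (- (l / d4))"
      unfolding k(2)[OF d(1)] k(2)[OF d(2)] k(2)[OF d(3)] k(2)[OF d(4)] by simp_all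
  qed
  have "tangential (plane_pt f g Y1) (plane_pt f g Y2) (plane_pt f g Y3) (plane_pt f g Y4)
      (- (l / d1)) (- (l / d2)) (- (l / d3)) (- (l / d4))"
    unfolding tangential_def
  proof (intro exI conjI)
    show "orthonormal_pair f g" by (rule T(1))
    show "\<rho>' \<noteq> 0" using T(2) \<open>l \<noteq> 0\<close> by (simp add: \<rho>'_def)
    show "cmod z1' = 1" "cmod z2 = 1" "cmod z3' = 1" "cmod z4 = 1" using T(3-6) by (simp_all add: z')
    show "0 < - (l / d1) \<and> 0 < - (l / d2) \<and> 0 < - (l / d3) \<and> 0 < - (l / d4) \<or>
      - (l / d1) < 0 \<and> - (l / d2) < 0 \<and> - (l / d3) < 0 \<and> - (l / d4) < 0"
      using T(7) \<open>l \<noteq> 0\<close> by (cases "l > 0") (auto simp: divide_pos_pos divide_neg_neg divide_neg_pos divide_pos_neg)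
    show "plane_pt f g Y1 = 0 + plane_pt f g (z1' * Complex \<rho>' (- (- (l / d1))))"
      "plane_pt f g Y2 = 0 + plane_pt f g (z2 * Complex \<rho>' (- (- (l / d2))))"
      "plane_pt f g Y3 = 0 + plane_pt f g (z3' * Complex \<rho>' (- (- (l / d3))))"
      "plane_pt f g Y4 = 0 + plane_pt f g (z4 * Complex \<rho>' (- (- (l / d4))))"
      by (simp_all only: Yz[symmetric] add_0_left)
    show "z4 * Complex \<rho>' (- (l / d1)) = z1' * Complex \<rho>' (- (- (l / d1)))"
      "z1' * Complex \<rho>' (- (l / d2)) = z2 * Complex \<rho>' (- (- (l / d2)))"
      "z2 * Complex \<rho>' (- (l / d3)) = z3' * Complex \<rho>' (- (- (l / d3)))"
      "z3' * Complex \<rho>' (- (l / d4)) = z4 * Complex \<rho>' (- (- (l / d4)))"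
      by (simp_all only: Yz[symmetric] Yz'[symmetric])
  qed
  \<comment> \<open>The construction produces lengths of the opposite sign; turning over the plane
    corrects this.\<close>
  from tangential_uminus[OF this] have "tangential (plane_pt f g Y1) (plane_pt f g Y2) (plane_pt f g Y3) (plane_pt f g Y4)
      (l / d1) (l / d2) (l / d3) (l / d4)" by simp
  then have ?T
    by (rule tangential_translate) (simp_all only: A B C P)
  moreover have ?M
  proof -
    define h where "h = (\<lambda>z w. Re (cnj z * w))"
    have h_lin: "h (u + v) w = h u w + h v w" "h (u - v) w = h u w - h v w" "h w (u - v) = h w u - h w v"
      "h (of_real r * u) w = r * h u w" "h w (of_real r * u) = r * h w u" "h u v = h v u" for u v w r
      by (simp_all add: h_def algebra_simps)
    have adj: "h c1 c2 = \<rho>\<^sup>2 - d1 * d2" "h c2 c3 = \<rho>\<^sup>2 - d2 * d3" "h c3 c4 = \<rho>\<^sup>2 - d3 * d4" "h c4 c1 = \<rho>\<^sup>2 - d4 * d1"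
      unfolding h_def
      by (subst c_defs(1), subst e(2), rule adjacent_contacts(1)[OF T(3)])
         (subst c_defs(2), subst e(3), rule adjacent_contacts(1)[OF T(4)],
          subst c_defs(3), subst e(4), rule adjacent_contacts(1)[OF T(5)],
          subst c_defs(4), subst e(1), rule adjacent_contacts(1)[OF T(6)])
    have Im: "Im (cnj z * (\<i> * w)) = h z w" "Im (cnj (\<i> * z) * w) = - h z w" for z w
      by (simp_all add: h_def algebra_simps)
    define m where "m = l / \<rho>"
    have b: "b d = \<i> * (of_real m * of_real (1 / d))" for d
      by (simp add: b_def m_def)
    define w1 w2 w3 w4 where w: "w1 = of_real (1 / d1) * c1" "w2 = of_real (1 / d2) * c2"
      "w3 = of_real (1 / d3) * c3" "w4 = of_real (1 / d4) * c4"
    have Y31: "Y3 - Y1 = \<i> * (of_real m * (w1 - w3))" and Y42: "Y4 - Y2 = \<i> * (of_real m * (w4 - w2))"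
      unfolding Y b w by (simp_all add: algebra_simps)
    \<comment> \<open>Only products of neighbouring vertices occur here, and these are known from
      \<open>adj\<close>.\<close>
    have "h (c3 - c1) (w4 - w2) - h (w1 - w3) (c4 - c2) = 
       (1 / d4 + 1 / d3) * h c3 c4 - (1 / d2 + 1 / d3) * h c2 c3 - (1 / d4 + 1 / d1) * h c4 c1 + (1 / d2 + 1 / d1) * h c1 c2"
      unfolding w h_lin(2-5)
      by (simp add: h_lin(6)[of c3 c2] h_lin(6)[of c1 c4] algebra_simps)
    also have "\<dots> = 0"
      unfolding adj using d by (simp add: field_simps power2_eq_square)
    finally have z: "h (c3 - c1) (w4 - w2) - h (w1 - w3) (c4 - c2) = 0" .
    have "Im (cnj (c3 - c1) * (Y4 - Y2)) + Im (cnj (Y3 - Y1) * (c4 - c2))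
      = m * (h (c3 - c1) (w4 - w2) - h (w1 - w3) (c4 - c2))"
      unfolding Y31 Y42 Im h_lin(4,5) by (simp add: algebra_simps)
    then have i0: "Im (cnj (c3 - c1) * (Y4 - Y2)) + Im (cnj (Y3 - Y1) * (c4 - c2)) = 0" using z by simp
    have xd: "x3 - x1 = plane_pt f g (c3 - c1)" "x4 - x2 = plane_pt f g (c4 - c2)"
      unfolding x plane_pt_linear by simp_all
    have "y3 - y1 = (y3 - y2) + (y2 - y1)" "y4 - y2 = (y4 - y3) + (y3 - y2)" by simp_all
    then have yd: "y3 - y1 = plane_pt f g (Y3 - Y1)" "y4 - y2 = plane_pt f g (Y4 - Y2)"
      unfolding A B C P[symmetric] plane_pt_linear by simp_all
    show ?M
      unfolding mixed_area_def prod.case xd yd cross3_plane_pt scaleR_add_left[symmetric] i0 by simp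
  qed
  ultimately show "?T \<and> ?M" ..
qed


section \<open>Tangential nets and cmc pairs\<close>

text \<open>The numbers \<open>d\<close> are signed radii: in a face the sign is kept along
  horizontal edges and changes along vertical ones, whence the differences on vertical edges and the
  two minus signs in the face condition.\<close>

definition tangential_net :: "(int \<times> int) set \<Rightarrow> (vertex \<Rightarrow> real^3) \<Rightarrow> (vertex \<Rightarrow> real) \<Rightarrow> bool" where
  "tangential_net Q x d \<longleftrightarrow>
     (\<forall>v\<in>s_verts Q. d v \<noteq> 0) \<and>
     (\<forall>v w. g_hedge Q v w \<longrightarrow> (\<exists>E. norm E = 1 \<and> x w - x v = (d v + d w) *\<^sub>R E)) \<and>
     (\<forall>v w. g_vedge Q v w \<longrightarrow> (\<exists>E. norm E = 1 \<and> x w - x v = (d v - d w) *\<^sub>R E)) \<and>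
     (\<forall>a b. g_face Q (a, b) \<longrightarrow>
        tangential (x (a - 1, b - 1)) (x (a + 1, b - 1)) (x (a + 1, b + 1)) (x (a - 1, b + 1))
          (d (a - 1, b - 1)) (d (a + 1, b - 1)) (- d (a + 1, b + 1)) (- d (a - 1, b + 1)))"

lemma g_edge_verts: "g_edge Q v w \<Longrightarrow> v \<in> s_verts Q \<and> w \<in> s_verts Q"
  by (auto simp: g_edge_def g_hedge_def g_vedge_def)

text \<open>Another initial vertex of the face replaces the relation between the lifts by its
  negative or its inverse, which exists because the factor is nonzero.\<close>

lemma tangential_net_s1_isothermic:
  assumes "tangential_net Q x d"
  shows "s1_isothermic Q (\<lambda>v. (x v, d v))"
  unfolding s1_isothermic_def
proof (intro conjI allI impI ballI)
  show "\<And>v. v \<in> s_verts Q \<Longrightarrow> snd (x v, d v) \<noteq> 0"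
    using assms by (simp add: tangential_net_def)
  show "lorentz (lift (x v, d v)) (lift (x w, d w)) = - 1" if "g_hedge Q v w" for v w
  proof -
    have "d v \<noteq> 0" "d w \<noteq> 0" using assms that by (auto simp: tangential_net_def g_hedge_def)
    moreover obtain E where "norm E = 1" "x w - x v = (d v + d w) *\<^sub>R E"
      using assms \<open>g_hedge Q v w\<close> unfolding tangential_net_def by blast
    ultimately show ?thesis using lorentz_lift_touching[of "d v" "d w" 1 E "x w" "x v"] by simp
  qed
  show "lorentz (lift (x v, d v)) (lift (x w, d w)) = 1" if "g_vedge Q v w" for v w
  proof -
    have "d v \<noteq> 0" "d w \<noteq> 0" using assms that by (auto simp: tangential_net_def g_vedge_def)
    moreover obtain E where "norm E = 1" "x w - x v = (d v - d w) *\<^sub>R E"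
      using assms \<open>g_vedge Q v w\<close> unfolding tangential_net_def by blast
    ultimately show ?thesis using lorentz_lift_touching[of "d v" "d w" "-1" E "x w" "x v"] by simp
  qed
  fix a b \<sigma> \<tau> :: int
  assume f: "g_face Q (a, b)" and s: "\<sigma> \<in> {1, -1}" "\<tau> \<in> {1, -1}"
  let ?L = "\<lambda>i j. lift (x (i, j), d (i, j))"
  have T: "tangential (x (a - 1, b - 1)) (x (a + 1, b - 1)) (x (a + 1, b + 1)) (x (a - 1, b + 1))
          (d (a - 1, b - 1)) (d (a + 1, b - 1)) (- d (a + 1, b + 1)) (- d (a - 1, b + 1))"
    using assms f by (simp add: tangential_net_def)
  obtain r where r: "r \<noteq> 0" "?L (a + 1) (b + 1) - ?L (a - 1) (b - 1) = r *\<^sub>R (?L (a - 1) (b + 1) - ?L (a + 1) (b - 1))"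
    by (rule tangential_lift[OF T])
  have flip: "q - p = k *\<^sub>R (t - s)" if "p - q = k *\<^sub>R (s - t)" for p q s t :: "real^5" and k
    using arg_cong[OF that, of uminus] by (simp flip: scaleR_minus_right)
  have inv: "s - t = (1 / k) *\<^sub>R (p - q)" if "p - q = k *\<^sub>R (s - t)" "k \<noteq> 0" for p q s t :: "real^5" and k
    using that by simp
  note r' = flip[OF r(2)]
  note r'' = inv[OF r(2,1)] inv[OF r' r(1)]
  show "\<exists>r. lift (x (a + \<sigma>, b + \<tau>), d (a + \<sigma>, b + \<tau>)) - lift (x (a - \<sigma>, b - \<tau>), d (a - \<sigma>, b - \<tau>))
       = r *\<^sub>R (lift (x (a - \<sigma>, b + \<tau>), d (a - \<sigma>, b + \<tau>)) - lift (x (a + \<sigma>, b - \<tau>), d (a + \<sigma>, b - \<tau>)))"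
    using s
  proof (elim insertE emptyE)
    assume "\<sigma> = 1" "\<tau> = 1"
    then show ?thesis using r(2) by (intro exI[of _ r]) simp
  next
    assume "\<sigma> = 1" "\<tau> = -1"
    then show ?thesis using r''(2) by (intro exI[of _ "1 / r"]) simp
  next
    assume "\<sigma> = -1" "\<tau> = 1"
    then show ?thesis using r''(1) by (intro exI[of _ "1 / r"]) simp
  next
    assume "\<sigma> = -1" "\<tau> = -1"
    then show ?thesis using r' by (intro exI[of _ r]) simp
  qed
qed

definition dual_form :: "real \<Rightarrow> (vertex \<Rightarrow> real^3) \<Rightarrow> (vertex \<Rightarrow> real) \<Rightarrow> vertex \<Rightarrow> vertex \<Rightarrow> real^3" where
  "dual_form l x d v w = (l / (d v * d w)) *\<^sub>R (x w - x v)"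

lemma g_face_edges':
  assumes "g_face Q (a, b)"
  shows "g_hedge Q (a - 1, b - 1) (a + 1, b - 1)" "g_vedge Q (a + 1, b - 1) (a + 1, b + 1)"
    "g_hedge Q (a - 1, b + 1) (a + 1, b + 1)" "g_vedge Q (a - 1, b - 1) (a - 1, b + 1)"
proof -
  have "odd a" "odd b" using assms by (auto simp: g_face_iff)
  then obtain i j where "a = 2 * i + 1" "b = 2 * j + 1" by (auto elim!: oddE)
  with assms g_face_edges[of Q i j]
  show "g_hedge Q (a - 1, b - 1) (a + 1, b - 1)" "g_vedge Q (a + 1, b - 1) (a + 1, b + 1)"
    "g_hedge Q (a - 1, b + 1) (a + 1, b + 1)" "g_vedge Q (a - 1, b - 1) (a - 1, b + 1)"
    by (simp_all add: algebra_simps)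
qed

text \<open>The signs in the face condition of the net turn the alternating sum of
  \<open>tangential_dual_closed\<close> into a cyclic sum.\<close>

lemma dual_form_closed:
  assumes "tangential_net Q x d" "l \<noteq> 0"
  shows "closed_form Q (dual_form l x d)"
  unfolding closed_form_def
proof (intro conjI allI impI)
  show "dual_form l x d w v = - dual_form l x d v w" for v w
    by (simp add: dual_form_def mult.commute flip: scaleR_minus_right)
  fix a b assume f: "g_face Q (a, b)"
  then have "tangential (x (a - 1, b - 1)) (x (a + 1, b - 1)) (x (a + 1, b + 1)) (x (a - 1, b + 1))
          (d (a - 1, b - 1)) (d (a + 1, b - 1)) (- d (a + 1, b + 1)) (- d (a - 1, b + 1))"
    using assms(1) by (simp add: tangential_net_def)
  from tangential_dual_closed[OF this assms(2)]
  show "dual_form l x d (a - 1, b - 1) (a + 1, b - 1) + dual_form l x d (a + 1, b - 1) (a + 1, b + 1)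
     + dual_form l x d (a + 1, b + 1) (a - 1, b + 1) + dual_form l x d (a - 1, b + 1) (a - 1, b - 1) = 0"
    by (simp add: dual_form_def)
qed

text \<open>Since \<open>l / (d * d')\<close> times \<open>d + \<sigma> * d'\<close> is
  \<open>\<sigma>\<close> times \<open>l / d + \<sigma> * (l / d')\<close>, duality multiplies the
  unit direction of an edge by \<open>\<sigma>\<close>: it keeps horizontal directions and reverses
  vertical ones.\<close>

lemma
  assumes x: "tangential_net Q x d" and l: "l \<noteq> 0"
    and y: "\<And>v w. g_edge Q v w \<Longrightarrow> y w - y v = dual_form l x d v w"
  shows tangential_net_dual: "tangential_net Q y (\<lambda>v. l / d v)"
    and mixed_area_dual: "g_face Q u \<Longrightarrow> mixed_area (face_quad u x) (face_quad u y) = 0"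
proof -
  have d: "d v \<noteq> 0" "d w \<noteq> 0" if "g_edge Q v w" for v w
    using x g_edge_verts[OF that] by (auto simp: tangential_net_def)
  have F: "tangential (y (a - 1, b - 1)) (y (a + 1, b - 1)) (y (a + 1, b + 1)) (y (a - 1, b + 1))
          (l / d (a - 1, b - 1)) (l / d (a + 1, b - 1)) (l / - d (a + 1, b + 1)) (l / - d (a - 1, b + 1)) \<and>
     mixed_area (x (a - 1, b - 1), x (a + 1, b - 1), x (a + 1, b + 1), x (a - 1, b + 1))
        (y (a - 1, b - 1), y (a + 1, b - 1), y (a + 1, b + 1), y (a - 1, b + 1)) = 0"
    if f: "g_face Q (a, b)" for a b
  proof (rule tangential_dual[OF _ l])
    show "tangential (x (a - 1, b - 1)) (x (a + 1, b - 1)) (x (a + 1, b + 1)) (x (a - 1, b + 1))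
          (d (a - 1, b - 1)) (d (a + 1, b - 1)) (- d (a + 1, b + 1)) (- d (a - 1, b + 1))"
      using x f by (simp add: tangential_net_def)
    note e = g_face_edges'[OF f]
    show "y (a + 1, b - 1) - y (a - 1, b - 1) = (l / (d (a - 1, b - 1) * d (a + 1, b - 1))) *\<^sub>R (x (a + 1, b - 1) - x (a - 1, b - 1))"
      using y e(1) by (simp add: g_edge_def dual_form_def)
    show "y (a + 1, b + 1) - y (a + 1, b - 1) = - (l / (d (a + 1, b - 1) * - d (a + 1, b + 1))) *\<^sub>R (x (a + 1, b + 1) - x (a + 1, b - 1))"
      using y e(2) by (simp add: g_edge_def dual_form_def)
    show "y (a - 1, b + 1) - y (a + 1, b + 1) = (l / (- d (a + 1, b + 1) * - d (a - 1, b + 1))) *\<^sub>R (x (a - 1, b + 1) - x (a + 1, b + 1))"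
      using y g_hedge_sym[OF e(3)] by (simp add: g_edge_def dual_form_def)
  qed
  show "mixed_area (face_quad u x) (face_quad u y) = 0" if "g_face Q u"
    using F that by (cases u) (auto simp: face_quad_def)
  have E: "y w - y v = (l / d v + \<sigma> * (l / d w)) *\<^sub>R (\<sigma> *\<^sub>R E)"
    if "g_edge Q v w" "x w - x v = (d v + \<sigma> * d w) *\<^sub>R E" "\<sigma> = 1 \<or> \<sigma> = -1" for v w \<sigma> E
  proof -
    have "l / (d v * d w) * (d v + \<sigma> * d w) = (l / d v + \<sigma> * (l / d w)) * \<sigma>"
      using that(3) d[OF that(1)] by (auto simp: field_simps)
    then show ?thesis unfolding y[OF that(1)] dual_form_def that(2) by simp
  qed
  show "tangential_net Q y (\<lambda>v. l / d v)"
    unfolding tangential_net_def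
  proof (intro conjI allI impI ballI)
    show "l / d v \<noteq> 0" if "v \<in> s_verts Q" for v
      using x l that by (simp add: tangential_net_def)
    show "\<exists>E. norm E = 1 \<and> y w - y v = (l / d v + l / d w) *\<^sub>R E" if e: "g_hedge Q v w" for v w
    proof -
      obtain E where "norm E = 1" "x w - x v = (d v + d w) *\<^sub>R E"
        using x e unfolding tangential_net_def by blast
      then show ?thesis using E[of v w 1 E] e by (auto simp: g_edge_def)
    qed
    show "\<exists>E. norm E = 1 \<and> y w - y v = (l / d v - l / d w) *\<^sub>R E" if e: "g_vedge Q v w" for v w
    proof -
      obtain E where "norm E = 1" "x w - x v = (d v - d w) *\<^sub>R E"
        using x e unfolding tangential_net_def by blast
      then show ?thesis using E[of v w "-1" E] e by (intro exI[of _ "- E"]) (auto simp: g_edge_def)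
    qed
  qed (use F in simp)
qed

text \<open>The sphere pairs along an edge lie in a plane: with the origin at the point of contact of \<open>s\<^sub>v\<close> and
  \<open>s\<^sub>w\<close> and \<open>E\<close> the direction of the edge, the spheres of the dual touch at \<open>- T\<close>.\<close>

lemma pair_lift:
  assumes d: "d \<noteq> 0" "d' \<noteq> 0" "l \<noteq> 0" and \<sigma>: "\<sigma> = 1 \<or> \<sigma> = -1" and E: "norm E = 1" "T \<bullet> E = 0"
    and c': "c' = c + (d + \<sigma> * d') *\<^sub>R E"
    and y: "y = c - T + (d - \<sigma> * (l / d)) *\<^sub>R E"
    and y': "y' = c' - T - (\<sigma> * d' - l / d') *\<^sub>R E"
  shows "lift (y', - (l / d')) - lift (c, d) = (d' / d) *\<^sub>R (lift (y, - (l / d)) - lift (c', d'))"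
  unfolding lift_diff_eq_iff
proof (intro conjI)
  show "1 / - (l / d') - 1 / d = d' / d * (1 / - (l / d) - 1 / d')"
    using d by (simp add: field_simps)
  have s2: "\<sigma> * \<sigma> = 1" using \<sigma> by auto
  have yy: "y' - y = (l / (d * d')) *\<^sub>R (c' - c)"
  proof -
    have "y' - y = (c' - c) - ((\<sigma> * d' - l / d') + (d - \<sigma> * (l / d))) *\<^sub>R E"
      unfolding y y' by (simp add: algebra_simps)
    also have "\<dots> = (l / d' + \<sigma> * (l / d)) *\<^sub>R E"
      unfolding c' by (simp add: algebra_simps flip: scaleR_add_left scaleR_diff_left)
    also have "l / d' + \<sigma> * (l / d) = l / (d * d') * (d + \<sigma> * d')"
      using d by (simp add: field_simps)
    finally show ?thesis unfolding c' by simp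
  qed
  have v1: "(1 / - (l / d')) *\<^sub>R y' = - (d' / l) *\<^sub>R (y + (l / (d * d')) *\<^sub>R (c' - c))"
    unfolding yy[symmetric] by simp
  have "(d' / l) * (l / (d * d')) = 1 / d" using d by simp
  then have "- (d' / l) *\<^sub>R (y + (l / (d * d')) *\<^sub>R (c' - c)) = - (d' / l) *\<^sub>R y - (1 / d) *\<^sub>R (c' - c)"
    by (simp add: scaleR_add_right)
  with v1 show "(1 / - (l / d')) *\<^sub>R y' - (1 / d) *\<^sub>R c = (d' / d) *\<^sub>R ((1 / - (l / d)) *\<^sub>R y - (1 / d') *\<^sub>R c')"
    using d by (simp add: algebra_simps)
  define b where "b = c \<bullet> E"
  define t where "t = c \<bullet> T"
  define n where "n = c \<bullet> c"
  define m where "m = T \<bullet> T"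
  have EE: "E \<bullet> E = 1" using E(1) by (simp add: norm_eq_1)
  have N: "(norm (c - r *\<^sub>R T + s *\<^sub>R E))\<^sup>2 = n + r\<^sup>2 * m + s\<^sup>2 - 2 * r * t + 2 * s * b" for r s
    unfolding power2_norm_eq_inner using EE E(2)
    by (simp add: inner_add inner_diff inner_commute n_def m_def t_def b_def power2_eq_square algebra_simps)
  have nc: "(norm c)\<^sup>2 = n" using N[of 0 0] by simp
  have nc': "(norm c')\<^sup>2 = n + (d + \<sigma> * d')\<^sup>2 + 2 * (d + \<sigma> * d') * b"
    using N[of 0 "d + \<sigma> * d'"] by (simp add: c')
  have ny: "(norm y)\<^sup>2 = n + m + (d - \<sigma> * (l / d))\<^sup>2 - 2 * t + 2 * (d - \<sigma> * (l / d)) * b"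
    using N[of 1 "d - \<sigma> * (l / d)"] by (simp add: y)
  have "y' = c - 1 *\<^sub>R T + (d + l / d') *\<^sub>R E"
    unfolding y' c' by (simp add: algebra_simps)
  then have ny': "(norm y')\<^sup>2 = n + m + (d + l / d')\<^sup>2 - 2 * t + 2 * (d + l / d') * b"
    using N[of 1 "d + l / d'"] by simp
  define p where "p = l / d"
  define p' where "p' = l / d'"
  have pd: "p * d = l" "p' * d' = l" using d by (simp_all add: p_def p'_def)
  have p0: "p \<noteq> 0" "p' \<noteq> 0" using d by (simp_all add: p_def p'_def)
  show "((norm y')\<^sup>2 - (- (l / d'))\<^sup>2) / - (l / d') - ((norm c)\<^sup>2 - d\<^sup>2) / d
      = d' / d * (((norm y)\<^sup>2 - (- (l / d))\<^sup>2) / - (l / d) - ((norm c')\<^sup>2 - d'\<^sup>2) / d')"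
  proof -
    have e1: "(norm y')\<^sup>2 - p'\<^sup>2 = n + m + d\<^sup>2 + 2 * d * p' - 2 * t + 2 * (d + p') * b"
      unfolding ny' p'_def[symmetric] by (simp add: power2_eq_square algebra_simps)
    have e2: "(norm y)\<^sup>2 - p\<^sup>2 = n + m + d\<^sup>2 - 2 * \<sigma> * l - 2 * t + 2 * (d - \<sigma> * p) * b"
      unfolding ny p_def[symmetric] unfolding pd(1)[symmetric] using \<sigma> by (auto simp: power2_eq_square algebra_simps)
    have e3: "(norm c')\<^sup>2 - d'\<^sup>2 = n + d\<^sup>2 + 2 * \<sigma> * d * d' + 2 * (d + \<sigma> * d') * b"
      unfolding nc' using \<sigma> by (auto simp: power2_eq_square algebra_simps)
    have l: "1 / p' = d' / l" "1 / p = d / l" using d by (simp_all add: p_def p'_def)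
    have L: "((norm y')\<^sup>2 - p'\<^sup>2) * (d' / l) + (n - d\<^sup>2) / d = d' / d * (((norm y)\<^sup>2 - p\<^sup>2) * (d / l) + ((norm c')\<^sup>2 - d'\<^sup>2) / d')"
    proof -
      \<comment> \<open>The change of the power of the origin along the edge is \<open>d * W\<close>
        for the first pair of spheres and \<open>(l / d') * W\<close> for the dual pair; after
        weighting, both contribute the same \<open>W\<close>.\<close>
      define W where "W = 2 * d + 2 * \<sigma> * d' + 2 * b + 2 * \<sigma> * b * d' / d"
      have 1: "(norm y')\<^sup>2 - p'\<^sup>2 = ((norm y)\<^sup>2 - p\<^sup>2) + (l / d') * W"
        unfolding e1 e2 W_def unfolding p_def p'_def using d by (simp add: field_simps)
      have 2: "(norm c')\<^sup>2 - d'\<^sup>2 = (n - d\<^sup>2) + d * W"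
        unfolding e3 W_def using d by (simp add: field_simps power2_eq_square)
      have "((norm y')\<^sup>2 - p'\<^sup>2) * (d' / l) = ((norm y)\<^sup>2 - p\<^sup>2) * (d' / l) + W"
        unfolding 1 using d by (simp add: field_simps)
      moreover have "d' / d * (((norm c')\<^sup>2 - d'\<^sup>2) / d') = (n - d\<^sup>2) / d + W"
        unfolding 2 using d by (simp add: field_simps)
      moreover have "d' / d * (((norm y)\<^sup>2 - p\<^sup>2) * (d / l)) = ((norm y)\<^sup>2 - p\<^sup>2) * (d' / l)"
        using d by simp
      ultimately show ?thesis by (simp only: distrib_left)
    qed
    have q: "X / - p' = - (X * (d' / l))" "X / - p = - (X * (d / l))" for X
      using d by (simp_all add: p_def p'_def)
    show ?thesis
      unfolding p_def[symmetric] p'_def[symmetric] q nc power2_minus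
      using L by (simp add: algebra_simps)
  qed
qed

text \<open>Scaling multiplies the three components of \<open>lift_diff_eq_iff\<close> by
  \<open>1 / \<mu>\<close>, \<open>1\<close> and \<open>\<mu>\<close>, so the factor
  \<open>r\<close> is kept.\<close>

lemma lift_scale:
  assumes "\<mu> \<noteq> 0" "lift (c1, d1) - lift (c2, d2) = r *\<^sub>R (lift (c3, d3) - lift (c4, d4))"
  shows "lift (\<mu> *\<^sub>R c1, \<mu> * d1) - lift (\<mu> *\<^sub>R c2, \<mu> * d2) = r *\<^sub>R (lift (\<mu> *\<^sub>R c3, \<mu> * d3) - lift (\<mu> *\<^sub>R c4, \<mu> * d4))"
proof -
  have 1: "1 / (\<mu> * d) = (1 / \<mu>) * (1 / d)" "(1 / (\<mu> * d)) *\<^sub>R \<mu> *\<^sub>R c = (1 / d) *\<^sub>R c" for d and c :: "real^3"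
    using assms(1) by simp_all
  have 2: "((norm (\<mu> *\<^sub>R c))\<^sup>2 - (\<mu> * d)\<^sup>2) / (\<mu> * d) = \<mu> * (((norm c)\<^sup>2 - d\<^sup>2) / d)" for d and c :: "real^3"
  proof -
    have "(norm (\<mu> *\<^sub>R c))\<^sup>2 = \<mu>\<^sup>2 * (norm c)\<^sup>2" by (simp add: power_mult_distrib)
    then show ?thesis using assms(1) by (cases "d = 0") (simp_all add: field_simps power2_eq_square)
  qed
  have 3: "\<mu> * a - \<mu> * b = r * (\<mu> * c - \<mu> * d)" if "a - b = r * (c - d)" for \<mu> a b c d :: real
    unfolding right_diff_distrib[symmetric] that by (simp only: mult.left_commute)
  from assms(2) show ?thesis
    unfolding lift_diff_eq_iff 1 2 by (intro conjI 3) simp_all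
qed

lemma s1_isothermic_scale:
  assumes "\<mu> \<noteq> 0" "s1_isothermic Q (\<lambda>v. (x v, d v))"
  shows "s1_isothermic Q (\<lambda>v. (\<mu> *\<^sub>R x v, \<mu> * d v))"
proof -
  have L: "lorentz (lift (\<mu> *\<^sub>R c, \<mu> * e)) (lift (\<mu> *\<^sub>R c', \<mu> * e')) = lorentz (lift (c, e)) (lift (c', e'))"
    if "e \<noteq> 0" "e' \<noteq> 0" for c c' e e'
  proof -
    have "(norm (\<mu> *\<^sub>R c - \<mu> *\<^sub>R c'))\<^sup>2 = \<mu>\<^sup>2 * (norm (c - c'))\<^sup>2"
      by (simp add: power_mult_distrib flip: scaleR_diff_right)
    then show ?thesis
      using assms(1) that by (simp add: lorentz_lift field_simps power2_eq_square)
  qed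
  show ?thesis
    unfolding s1_isothermic_def fst_conv snd_conv
  proof (intro conjI allI impI ballI)
    show d: "\<mu> * d v \<noteq> 0" if "v \<in> s_verts Q" for v
      using assms that by (simp add: s1_isothermic_def)
    then have d': "d v \<noteq> 0" if "v \<in> s_verts Q" for v using that by auto
    show "lorentz (lift (\<mu> *\<^sub>R x v, \<mu> * d v)) (lift (\<mu> *\<^sub>R x w, \<mu> * d w)) = - 1" if "g_hedge Q v w" for v w
    proof -
      have "lorentz (lift (x v, d v)) (lift (x w, d w)) = - 1"
        using assms(2) that unfolding s1_isothermic_def by blast
      then show ?thesis using L d' that unfolding g_hedge_def by metis
    qed
    show "lorentz (lift (\<mu> *\<^sub>R x v, \<mu> * d v)) (lift (\<mu> *\<^sub>R x w, \<mu> * d w)) = 1" if "g_vedge Q v w" for v w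
    proof -
      have "lorentz (lift (x v, d v)) (lift (x w, d w)) = 1"
        using assms(2) that unfolding s1_isothermic_def by blast
      then show ?thesis using L d' that unfolding g_vedge_def by metis
    qed
    fix a b \<sigma> \<tau> :: int
    assume f: "g_face Q (a, b)" "\<sigma> \<in> {1, -1}" "\<tau> \<in> {1, -1}"
    obtain r where "lift (x (a + \<sigma>, b + \<tau>), d (a + \<sigma>, b + \<tau>)) - lift (x (a - \<sigma>, b - \<tau>), d (a - \<sigma>, b - \<tau>))
       = r *\<^sub>R (lift (x (a - \<sigma>, b + \<tau>), d (a - \<sigma>, b + \<tau>)) - lift (x (a + \<sigma>, b - \<tau>), d (a + \<sigma>, b - \<tau>)))"
      using assms(2) f unfolding s1_isothermic_def by blast
    from lift_scale[OF assms(1) this]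
    show "\<exists>r. lift (\<mu> *\<^sub>R x (a + \<sigma>, b + \<tau>), \<mu> * d (a + \<sigma>, b + \<tau>)) - lift (\<mu> *\<^sub>R x (a - \<sigma>, b - \<tau>), \<mu> * d (a - \<sigma>, b - \<tau>))
       = r *\<^sub>R (lift (\<mu> *\<^sub>R x (a - \<sigma>, b + \<tau>), \<mu> * d (a - \<sigma>, b + \<tau>)) - lift (\<mu> *\<^sub>R x (a + \<sigma>, b - \<tau>), \<mu> * d (a + \<sigma>, b - \<tau>)))"
      by (rule exI)
  qed
qed

text \<open>The assumptions on edges say that the Gauss map \<open>x - y\<close> has, on the line of
  its edge, a foot point \<open>T\<close> orthogonal to the edge; this is the position required by
  \<open>pair_lift\<close>. The scaling is included because both \<open>\<mu> = 1\<close> and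
  \<open>\<mu> = 1 / \<epsilon>\<close> will be used.\<close>

lemma s1_cmc_pairI:
  assumes x: "tangential_net Q x d" and l: "l > 0"
    and y: "\<And>v w. g_edge Q v w \<Longrightarrow> y w - y v = dual_form l x d v w"
    and h: "\<And>v w. g_hedge Q v w \<Longrightarrow> \<exists>T E. norm E = 1 \<and> T \<bullet> E = 0 \<and> x w - x v = (d v + d w) *\<^sub>R E \<and>
      x v - y v = T - (d v - l / d v) *\<^sub>R E \<and> x w - y w = T + (d w - l / d w) *\<^sub>R E"
    and v: "\<And>v w. g_vedge Q v w \<Longrightarrow> \<exists>T E. norm E = 1 \<and> T \<bullet> E = 0 \<and> x w - x v = (d v - d w) *\<^sub>R E \<and>
      x v - y v = T - (d v + l / d v) *\<^sub>R E \<and> x w - y w = T + (- d w - l / d w) *\<^sub>R E"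
    and m: "\<mu> \<noteq> 0"
  shows "s1_cmc_pair Q (\<lambda>v. (\<mu> *\<^sub>R x v, \<mu> * d v)) (\<lambda>v. (\<mu> *\<^sub>R y v, \<mu> * (l / d v)))"
  unfolding s1_cmc_pair_def
proof (intro conjI)
  have d: "d v \<noteq> 0" if "v \<in> s_verts Q" for v
    using x that by (simp add: tangential_net_def)
  have iso: "s1_isothermic Q (\<lambda>v. (x v, d v))" "s1_isothermic Q (\<lambda>v. (y v, l / d v))"
    using tangential_net_s1_isothermic[OF x] tangential_net_s1_isothermic[OF tangential_net_dual[OF x _ y]] l by auto
  show "s1_isothermic Q (\<lambda>v. (\<mu> *\<^sub>R x v, \<mu> * d v))" "s1_isothermic Q (\<lambda>v. (\<mu> *\<^sub>R y v, \<mu> * (l / d v)))"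
    by (fact s1_isothermic_scale[OF m iso(1)], fact s1_isothermic_scale[OF m iso(2)])
  show "\<exists>l'>0. christoffel_dual Q l' (\<lambda>v. (\<mu> *\<^sub>R x v, \<mu> * d v)) (\<lambda>v. (\<mu> *\<^sub>R y v, \<mu> * (l / d v)))"
  proof -
    \<comment> \<open>Both surfaces are scaled, so the product of dual radii gains
      \<open>\<mu>\<^sup>2\<close>.\<close>
    have "christoffel_dual Q (\<mu>\<^sup>2 * l) (\<lambda>v. (\<mu> *\<^sub>R x v, \<mu> * d v)) (\<lambda>v. (\<mu> *\<^sub>R y v, \<mu> * (l / d v)))"
      unfolding christoffel_dual_def fst_conv snd_conv
    proof (intro conjI ballI allI impI)
      show "\<mu> * (l / d v) = \<mu>\<^sup>2 * l / (\<mu> * d v)" for v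
        using m by (simp add: power2_eq_square)
      fix v w assume "g_edge Q v w"
      from y[OF this] show "\<mu> *\<^sub>R y w - \<mu> *\<^sub>R y v = (\<mu>\<^sup>2 * l / (\<mu> * d v * (\<mu> * d w))) *\<^sub>R (\<mu> *\<^sub>R x w - \<mu> *\<^sub>R x v)"
        using m by (simp add: dual_form_def power2_eq_square flip: scaleR_diff_right)
    qed
    moreover have "\<mu>\<^sup>2 * l > 0" using l m by simp
    ultimately show ?thesis by blast
  qed
  have pair: "\<exists>r. lift (y w, - (l / d w)) - lift (x v, d v) = r *\<^sub>R (lift (y v, - (l / d v)) - lift (x w, d w))"
    if e: "g_edge Q v w" for v w
  proof -
    have dv: "d v \<noteq> 0" "d w \<noteq> 0" using d g_edge_verts[OF e] by auto
    obtain T E \<sigma> where "\<sigma> = 1 \<or> \<sigma> = -1" "norm E = 1" "T \<bullet> E = 0" "x w - x v = (d v + \<sigma> * d w) *\<^sub>R E"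
      "x v - y v = T - (d v - \<sigma> * (l / d v)) *\<^sub>R E" "x w - y w = T + (\<sigma> * d w - l / d w) *\<^sub>R E"
    proof (cases "g_hedge Q v w")
      case True
      then show ?thesis using h[OF True] that[of 1] by auto
    next
      case False
      then have "g_vedge Q v w" using e by (simp add: g_edge_def)
      then show ?thesis using v[of v w] that[of "-1"] by auto
    qed
    then have "lift (y w, - (l / d w)) - lift (x v, d v) = (d w / d v) *\<^sub>R (lift (y v, - (l / d v)) - lift (x w, d w))"
      using dv l by (intro pair_lift[where \<sigma> = \<sigma> and E = E and T = T]) (auto simp: algebra_simps)
    then show ?thesis ..
  qed
  show "\<exists>t\<in>{\<lambda>v. (\<mu> *\<^sub>R y v, \<mu> * (l / d v)), \<lambda>v. reverse (\<mu> *\<^sub>R y v, \<mu> * (l / d v))}. \<forall>v w. g_edge Q v w \<longrightarrow>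
     (\<exists>r. lift (t w) - lift (\<mu> *\<^sub>R x v, \<mu> * d v) = r *\<^sub>R (lift (t v) - lift (\<mu> *\<^sub>R x w, \<mu> * d w)))"
  \<comment> \<open>The orientations of the dual are reversed, since \<open>pair_lift\<close> works
    with the radii \<open>- (l / d)\<close>.\<close>
  proof (rule bexI[of _ "\<lambda>v. reverse (\<mu> *\<^sub>R y v, \<mu> * (l / d v))"], intro allI impI)
    fix v w assume "g_edge Q v w"
    from pair[OF this] obtain r where "lift (y w, - (l / d w)) - lift (x v, d v) = r *\<^sub>R (lift (y v, - (l / d v)) - lift (x w, d w))" ..
    from lift_scale[OF m this]
    show "\<exists>r. lift (reverse (\<mu> *\<^sub>R y w, \<mu> * (l / d w))) - lift (\<mu> *\<^sub>R x v, \<mu> * d v)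
       = r *\<^sub>R (lift (reverse (\<mu> *\<^sub>R y v, \<mu> * (l / d v))) - lift (\<mu> *\<^sub>R x w, \<mu> * d w))"
      by (intro exI[of _ r]) (simp add: reverse_def)
  qed simp
qed

text \<open>Duality makes the mixed area of \<open>x\<close> and \<open>y\<close> vanish, leaving
  minus the area of \<open>x\<close> for the Gauss map \<open>y - x\<close>. Only \<open>x\<close>
  is scaled, which contributes one factor \<open>\<mu>\<close> against \<open>\<mu>\<^sup>2\<close>
  in the area.\<close>

lemma has_mean_curvature_pair:
  assumes x: "tangential_net Q x d" and l: "l \<noteq> 0" and m: "\<mu> \<noteq> 0"
    and y: "\<And>v w. g_edge Q v w \<Longrightarrow> y w - y v = dual_form l x d v w"
  shows "has_mean_curvature Q (\<lambda>v. \<mu> *\<^sub>R x v) (\<lambda>v. y v - x v) (1 / \<mu>)"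
  unfolding has_mean_curvature_def
proof (intro allI impI)
  fix u assume f: "g_face Q u"
  obtain a b where u: "u = (a, b)" by (cases u)
  let ?F = "face_quad u"
  have area: "mixed_area (?F x) (?F x) \<noteq> 0"
    using x f unfolding u tangential_net_def by (auto simp: face_quad_def intro!: tangential_area)
  have zero: "mixed_area (?F x) (?F y) = 0" by (rule mixed_area_dual[OF x l y f])
  have lin: "mixed_area (?F (\<lambda>v. \<mu> *\<^sub>R x v)) (?F (\<lambda>v. \<mu> *\<^sub>R x v)) = \<mu>\<^sup>2 *\<^sub>R mixed_area (?F x) (?F x)"
    "mixed_area (?F (\<lambda>v. \<mu> *\<^sub>R x v)) (?F (\<lambda>v. y v - x v)) = \<mu> *\<^sub>R (mixed_area (?F x) (?F y) - mixed_area (?F x) (?F x))"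
    unfolding u face_quad_def mixed_area_def prod.case
    by (simp_all only: cross3_simps power2_eq_square) (simp_all add: field_simps)
  show "mixed_area (?F (\<lambda>v. \<mu> *\<^sub>R x v)) (?F (\<lambda>v. \<mu> *\<^sub>R x v)) \<noteq> 0 \<and>
    mixed_area (?F (\<lambda>v. \<mu> *\<^sub>R x v)) (?F (\<lambda>v. y v - x v)) = - (1 / \<mu>) *\<^sub>R mixed_area (?F (\<lambda>v. \<mu> *\<^sub>R x v)) (?F (\<lambda>v. \<mu> *\<^sub>R x v))"
    unfolding lin zero using area m by (simp add: power2_eq_square)
qed


section \<open>Ring configurations\<close>

text \<open>Cosine and sine of the radius of that circle of the ring at \<open>v\<close> that passes through the point at \<open>b\<close>,
  where \<open>C\<close>, \<open>S\<close>, \<open>S'\<close> are \<open>cos r\<close>, \<open>sin r\<close>, \<open>sin R\<close>.\<close>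

definition ring_cos :: "real \<Rightarrow> (vertex \<Rightarrow> real) \<Rightarrow> vertex \<Rightarrow> vertex \<Rightarrow> real" where
  "ring_cos q C v b = (if snd v = snd b then C v else q * C v)"

definition ring_sin :: "(vertex \<Rightarrow> real) \<Rightarrow> (vertex \<Rightarrow> real) \<Rightarrow> vertex \<Rightarrow> vertex \<Rightarrow> real" where
  "ring_sin S S' v b = (if snd v = snd b then S v else S' v)"

lemma ccw_quadI:
  assumes "(i, j) \<in> Q"
  shows "ccw_quad Q (i, j) (i + 1, j) (i + 1, j + 1) (i, j + 1)"
    "ccw_quad Q (i + 1, j) (i + 1, j + 1) (i, j + 1) (i, j)"
    "ccw_quad Q (i + 1, j + 1) (i, j + 1) (i, j) (i + 1, j)"
    "ccw_quad Q (i, j + 1) (i, j) (i + 1, j) (i + 1, j + 1)"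
  using assms unfolding ccw_quad_def Let_def
  by (intro bexI[of _ "(i, j)"]; simp)+

lemma c_vert_white: "(x, y) \<in> Q \<or> (x - 1, y) \<in> Q \<or> (x, y - 1) \<in> Q \<or> (x - 1, y - 1) \<in> Q \<Longrightarrow>
    odd x \<Longrightarrow> odd y \<Longrightarrow> (x, y) \<in> white Q"
  by (simp add: white_def mem_c_verts)

text \<open>The identities of \<open>quad\<close> say that the spherical triangle
  \<open>p v\<close>, \<open>t b\<close>, \<open>p v'\<close> has a right angle at
  \<open>t b\<close> and lies on a definite side. Unlike the order conditions of a ring pattern they
  are equations, which pass to the limit; so one locale serves patterns with \<open>q < 1\<close>
  and the limit with \<open>q = 1\<close>.\<close>

locale ring_config =
  fixes Q :: "(int \<times> int) set" and q :: real and p t :: "vertex \<Rightarrow> real^3" and C S S' :: "vertex \<Rightarrow> real"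
  assumes graph: "s_quad_graph Q"
    and q: "0 < q" "q \<le> 1"
    and white: "v \<in> white Q \<Longrightarrow> norm (p v) = 1 \<and> 0 < S v \<and> 0 < S' v \<and> (C v)\<^sup>2 + (S v)\<^sup>2 = 1 \<and> q\<^sup>2 * (C v)\<^sup>2 + (S' v)\<^sup>2 = 1"
    and s_vert: "v \<in> s_verts Q \<Longrightarrow> 0 < C v"
    and quad: "v \<in> white Q \<Longrightarrow> ccw_quad Q v b v' b' \<Longrightarrow>
      norm (t b) = 1 \<and> norm (t b') = 1 \<and> p v \<bullet> t b = ring_cos q C v b \<and> p v \<bullet> t b' = ring_cos q C v b' \<and>
      p v' = ring_cos q C v' b *\<^sub>R t b + (ring_sin S S' v' b / ring_sin S S' v b) *\<^sub>R cross3 (p v) (t b) \<and>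
      p v' = ring_cos q C v' b' *\<^sub>R t b' - (ring_sin S S' v' b' / ring_sin S S' v b') *\<^sub>R cross3 (p v) (t b')"
begin

text \<open>Unit tangent at \<open>t b\<close> to the circle of the ring \<open>c\<close> through
  that point; the edge of the Koebe net touching there has this direction.\<close>

definition dir :: "vertex \<Rightarrow> vertex \<Rightarrow> real^3" where
  "dir c b = (1 / ring_sin S S' c b) *\<^sub>R cross3 (p c) (t b)"

definition net :: "vertex \<Rightarrow> real^3" where
  "net v = (1 / (sqrt q * C v)) *\<^sub>R p v"

text \<open>Distance from \<open>net v\<close> to the point of contact
  \<open>tau v b *\<^sub>R t b\<close> of the edge through \<open>b\<close>.\<close>

definition len :: "vertex \<Rightarrow> vertex \<Rightarrow> real" where
  "len v b = ring_sin S S' v b / (sqrt q * C v)"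

text \<open>Absolute radius prescribed for the sphere of the first surface; \<open>lam\<close> is
  its product with that of the second.\<close>

definition dist_c :: "vertex \<Rightarrow> real" where
  "dist_c v = (S' v + S v) / (2 * sqrt q * C v)"

definition lam :: real where
  "lam = (1 - q\<^sup>2) / (4 * q)"

text \<open>Alternates between consecutive rows of s-vertices; their second coordinates are even,
  hence the division by \<open>2\<close>.\<close>

definition sgn_v :: "vertex \<Rightarrow> real" where
  "sgn_v v = (if even (snd v div 2) then 1 else -1)"

definition rad :: "vertex \<Rightarrow> real" where
  "rad v = sgn_v v * dist_c v"

text \<open>Radius of the sphere about the origin touched by the edge through \<open>b\<close>;
  horizontal and vertical edges touch two different spheres with reciprocal radii, which merge for
  \<open>q = 1\<close>.\<close>

definition tau :: "vertex \<Rightarrow> vertex \<Rightarrow> real" where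
  "tau v b = (if snd v = snd b then 1 / sqrt q else sqrt q)"

section \<open>Edges of the Koebe net as tangents of two concentric spheres\<close>

lemma ring_cos_sin: "v \<in> white Q \<Longrightarrow> (ring_cos q C v b)\<^sup>2 + (ring_sin S S' v b)\<^sup>2 = 1"
  "v \<in> white Q \<Longrightarrow> 0 < ring_sin S S' v b"
  using white[of v] by (simp_all add: ring_cos_def ring_sin_def power_mult_distrib)

lemma s_verts_white: "v \<in> s_verts Q \<Longrightarrow> v \<in> white Q"
  by (simp add: white_def)

lemma dir_props:
  assumes "c \<in> white Q" "ccw_quad Q c b v b' \<or> ccw_quad Q c b' v b"
  shows "norm (dir c b) = 1" "dir c b \<bullet> t b = 0" "dir c b \<bullet> p c = 0" "norm (t b) = 1"
proof -
  have t: "norm (t b) = 1" "p c \<bullet> t b = ring_cos q C c b" using quad assms by blast+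
  have n: "norm (p c) = 1" using white assms(1) by blast
  have s: "0 < ring_sin S S' c b" using ring_cos_sin(2) assms(1) by blast
  have "(norm (cross3 (p c) (t b)))\<^sup>2 = (ring_sin S S' c b)\<^sup>2"
    unfolding norm_cross t n using ring_cos_sin(1)[OF assms(1), of b] by simp
  then have "norm (cross3 (p c) (t b)) = ring_sin S S' c b"
    using s by (simp add: power2_eq_iff_nonneg)
  then show "norm (dir c b) = 1" using s by (simp add: dir_def)
  show "dir c b \<bullet> t b = 0" "dir c b \<bullet> p c = 0"
    by (simp_all add: dir_def dot_cross_self inner_commute)
  show "norm (t b) = 1" by (rule t)
qed

text \<open>The factorisation \<open>(S' + S) * (S' - S) = (1 - q\<^sup>2) * C\<^sup>2\<close> makes
  \<open>lam\<close> the product of the two radii. Their difference and their sum are the tangent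
  lengths \<open>S / (sqrt q * C)\<close> and \<open>S' / (sqrt q * C)\<close> on horizontal and
  vertical edges.\<close>

lemma len_dist:
  assumes "v \<in> s_verts Q"
  shows "0 < dist_c v" "0 < len v b" "snd v = snd b \<Longrightarrow> len v b = dist_c v - lam / dist_c v"
    "snd v \<noteq> snd b \<Longrightarrow> len v b = dist_c v + lam / dist_c v"
    "lam / dist_c v = (S' v - S v) / (2 * sqrt q * C v)" "0 \<le> lam" "lam < (dist_c v)\<^sup>2"
proof -
  have w: "0 < S v" "0 < S' v" "(C v)\<^sup>2 + (S v)\<^sup>2 = 1" "q\<^sup>2 * (C v)\<^sup>2 + (S' v)\<^sup>2 = 1" and C: "0 < C v"
    using white[OF s_verts_white[OF assms]] s_vert[OF assms] by auto
  have sq: "0 < sqrt q" "sqrt q * sqrt q = q" using q by auto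
  show d: "0 < dist_c v" using w C sq by (simp add: dist_c_def add_pos_pos)
  show len: "0 < len v b" using w C sq by (simp add: len_def ring_sin_def)
  have "(S' v)\<^sup>2 - (S v)\<^sup>2 = (1 - q\<^sup>2) * (C v)\<^sup>2" using w(3,4) by (simp add: algebra_simps)
  then have f: "(S' v + S v) * (S' v - S v) = (1 - q\<^sup>2) * (C v)\<^sup>2"
    by (simp add: power2_eq_square algebra_simps)
  have "dist_c v * ((S' v - S v) / (2 * sqrt q * C v)) = ((S' v + S v) * (S' v - S v)) / (4 * (sqrt q * sqrt q) * (C v * C v))"
    by (simp add: dist_c_def)
  also have "\<dots> = lam" unfolding f sq lam_def using C by (simp add: power2_eq_square)
  finally show l: "lam / dist_c v = (S' v - S v) / (2 * sqrt q * C v)" using d by (simp add: field_simps)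
  show "len v b = dist_c v - lam / dist_c v" if "snd v = snd b"
    unfolding l using that by (simp add: len_def ring_sin_def dist_c_def diff_divide_distrib add_divide_distrib)
  show "len v b = dist_c v + lam / dist_c v" if "snd v \<noteq> snd b"
    unfolding l using that by (simp add: len_def ring_sin_def dist_c_def diff_divide_distrib add_divide_distrib)
  show "0 \<le> lam" using q by (simp add: lam_def power_le_one)
  have "lam / dist_c v < dist_c v"
    unfolding l unfolding dist_c_def using w C sq by (intro divide_strict_right_mono) simp_all
  then show "lam < (dist_c v)\<^sup>2" using d by (simp add: power2_eq_square field_simps)
qed

lemma net_contact:
  assumes "c \<in> white Q" "v \<in> s_verts Q"
  shows "ccw_quad Q c b v b' \<Longrightarrow> net v = tau v b *\<^sub>R t b + len v b *\<^sub>R dir c b"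
    and "ccw_quad Q c b' v b \<Longrightarrow> net v = tau v b *\<^sub>R t b - len v b *\<^sub>R dir c b"
proof -
  have C: "0 < C v" using s_vert assms by blast
  have sq: "0 < sqrt q" "sqrt q * sqrt q = q" using q by auto
  have 1: "1 / (sqrt q * C v) * ring_cos q C v b = tau v b"
    using C sq by (simp add: ring_cos_def tau_def field_simps)
  have 2: "1 / (sqrt q * C v) * (ring_sin S S' v b / ring_sin S S' c b) = len v b * (1 / ring_sin S S' c b)"
    by (simp add: len_def)
  show "net v = tau v b *\<^sub>R t b + len v b *\<^sub>R dir c b" if "ccw_quad Q c b v b'"
  proof -
    have "p v = ring_cos q C v b *\<^sub>R t b + (ring_sin S S' v b / ring_sin S S' c b) *\<^sub>R cross3 (p c) (t b)"
      using quad[OF assms(1) that] by blast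
    then show ?thesis
      unfolding net_def dir_def by (simp only: scaleR_add_right scaleR_scaleR 1 2)
  qed
  show "net v = tau v b *\<^sub>R t b - len v b *\<^sub>R dir c b" if "ccw_quad Q c b' v b"
  proof -
    have "p v = ring_cos q C v b *\<^sub>R t b - (ring_sin S S' v b / ring_sin S S' c b) *\<^sub>R cross3 (p c) (t b)"
      using quad[OF assms(1) that] by blast
    then show ?thesis
      unfolding net_def dir_def by (simp only: scaleR_diff_right scaleR_scaleR 1 2)
  qed
qed

definition contact :: "vertex \<Rightarrow> vertex \<Rightarrow> vertex \<Rightarrow> real^3 \<Rightarrow> real^3 \<Rightarrow> bool" where
  "contact v b w T E \<longleftrightarrow> norm E = 1 \<and> T \<bullet> E = 0 \<and> norm T = tau v b \<and>
     net v = T - len v b *\<^sub>R E \<and> net w = T + len w b *\<^sub>R E"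

lemma contact_sym: "contact v b w T E \<Longrightarrow> tau w b = tau v b \<Longrightarrow> contact w b v T (- E)"
  by (simp add: contact_def)

text \<open>The two squares at the white vertex \<open>c\<close> share \<open>b\<close>, so both
  ends of the edge lie on the one tangent at \<open>b\<close> with direction
  \<open>dir c b\<close>.\<close>

lemma contactI:
  assumes c: "c \<in> white Q" and "v \<in> s_verts Q" "w \<in> s_verts Q" "tau w b = tau v b"
    and "ccw_quad Q c b' v b" "ccw_quad Q c b w b''"
  shows "contact v b w (tau v b *\<^sub>R t b) (dir c b)"
proof -
  have "0 < tau v b" using q by (simp add: tau_def)
  then show ?thesis
    using dir_props[OF c, of b v b'] net_contact(2)[OF c assms(2,5)] net_contact(1)[OF c assms(3,6)] assms(4-6)
    by (simp add: contact_def inner_commute)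
qed

lemma hedge_contact:
  assumes "g_hedge Q v w"
  obtains b T E where "snd v = snd b" "snd w = snd b" "contact v b w T E"
proof -
  have *: "\<exists>T E. contact (2 * i, 2 * j) (2 * i + 1, 2 * j) (2 * i + 2, 2 * j) T E" if e: "ge_h Q i j" for i j
  proof -
    have s: "(2 * i, 2 * j) \<in> s_verts Q" "(2 * i + 2, 2 * j) \<in> s_verts Q"
      using e by (auto simp: g_hedge_def)
    have tau: "tau (2 * i + 2, 2 * j) (2 * i + 1, 2 * j) = tau (2 * i, 2 * j) (2 * i + 1, 2 * j)"
      by (simp add: tau_def)
    \<comment> \<open>Squares on opposite sides of the two halves would give contact data from two
      different rings; by \<open>no_pinch\<close> one ring at the side of the edge serves both
      halves.\<close>
    from e have "((2 * i, 2 * j) \<in> Q \<and> (2 * i + 1, 2 * j) \<in> Q) \<or> ((2 * i, 2 * j - 1) \<in> Q \<and> (2 * i + 1, 2 * j - 1) \<in> Q)"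
      using no_pinch[OF graph, of "2 * i + 1" "2 * j"] unfolding ge_h_iff by auto
    then show ?thesis
    proof (elim disjE conjE)
      assume Q: "(2 * i, 2 * j) \<in> Q" "(2 * i + 1, 2 * j) \<in> Q"
      have "(2 * i + 1, 2 * j + 1) \<in> white Q" using Q by (intro c_vert_white) auto
      then have "contact (2 * i, 2 * j) (2 * i + 1, 2 * j) (2 * i + 2, 2 * j)
         (tau (2 * i, 2 * j) (2 * i + 1, 2 * j) *\<^sub>R t (2 * i + 1, 2 * j)) (dir (2 * i + 1, 2 * j + 1) (2 * i + 1, 2 * j))"
        using ccw_quadI(3)[OF Q(1)] ccw_quadI(4)[OF Q(2)]
        by (intro contactI[OF _ s tau, of _ "(2 * i, 2 * j + 1)" "(2 * i + 2, 2 * j + 1)"]) (simp_all add: algebra_simps)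
      then show ?thesis by blast
    next
      assume Q: "(2 * i, 2 * j - 1) \<in> Q" "(2 * i + 1, 2 * j - 1) \<in> Q"
      have c: "(2 * i + 1, 2 * j - 1) \<in> white Q" using Q by (intro c_vert_white) auto
      have "contact (2 * i + 2, 2 * j) (2 * i + 1, 2 * j) (2 * i, 2 * j)
         (tau (2 * i + 2, 2 * j) (2 * i + 1, 2 * j) *\<^sub>R t (2 * i + 1, 2 * j)) (dir (2 * i + 1, 2 * j - 1) (2 * i + 1, 2 * j))"
        using ccw_quadI(1)[OF Q(2)] ccw_quadI(2)[OF Q(1)]
        by (intro contactI[OF c s(2,1) tau[symmetric], of "(2 * i + 2, 2 * j - 1)" "(2 * i, 2 * j - 1)"]) (simp_all add: algebra_simps)
      from contact_sym[OF this tau[symmetric]] show ?thesis by blast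
    qed
  qed
  have "\<exists>b T E. snd v = snd b \<and> snd w = snd b \<and> contact v b w T E"
  proof (cases rule: g_hedge_cases[OF assms])
    case (1 i j)
    then show ?thesis using * by (metis snd_conv)
  next
    case (2 i j)
    then obtain T E where "contact w (2 * i + 1, 2 * j) v T E" using * by blast
    then have "contact v (2 * i + 1, 2 * j) w T (- E)" by (rule contact_sym) (simp add: tau_def 2)
    then show ?thesis using 2 by (metis snd_conv)
  qed
  then show thesis using that by blast
qed

lemma vedge_contact:
  assumes "g_vedge Q v w"
  obtains b T E where "snd v \<noteq> snd b" "snd w \<noteq> snd b" "contact v b w T E"
proof -
  have *: "\<exists>T E. contact (2 * i, 2 * j) (2 * i, 2 * j + 1) (2 * i, 2 * j + 2) T E" if e: "ge_v Q i j" for i j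
  proof -
    have s: "(2 * i, 2 * j) \<in> s_verts Q" "(2 * i, 2 * j + 2) \<in> s_verts Q"
      using e by (auto simp: g_vedge_def)
    have tau: "tau (2 * i, 2 * j + 2) (2 * i, 2 * j + 1) = tau (2 * i, 2 * j) (2 * i, 2 * j + 1)"
      by (simp add: tau_def)
    from e have "((2 * i, 2 * j) \<in> Q \<and> (2 * i, 2 * j + 1) \<in> Q) \<or> ((2 * i - 1, 2 * j) \<in> Q \<and> (2 * i - 1, 2 * j + 1) \<in> Q)"
      using no_pinch[OF graph, of "2 * i" "2 * j + 1"] unfolding ge_v_iff by auto
    then show ?thesis
    proof (elim disjE conjE)
      assume Q: "(2 * i - 1, 2 * j) \<in> Q" "(2 * i - 1, 2 * j + 1) \<in> Q"
      have c: "(2 * i - 1, 2 * j + 1) \<in> white Q" using Q by (intro c_vert_white) auto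
      have "contact (2 * i, 2 * j) (2 * i, 2 * j + 1) (2 * i, 2 * j + 2)
         (tau (2 * i, 2 * j) (2 * i, 2 * j + 1) *\<^sub>R t (2 * i, 2 * j + 1)) (dir (2 * i - 1, 2 * j + 1) (2 * i, 2 * j + 1))"
        using ccw_quadI(4)[OF Q(1)] ccw_quadI(1)[OF Q(2)]
        by (intro contactI[OF c s tau, of "(2 * i - 1, 2 * j)" "(2 * i - 1, 2 * j + 2)"]) (simp_all add: algebra_simps)
      then show ?thesis by blast
    next
      assume Q: "(2 * i, 2 * j) \<in> Q" "(2 * i, 2 * j + 1) \<in> Q"
      have c: "(2 * i + 1, 2 * j + 1) \<in> white Q" using Q by (intro c_vert_white) auto
      have "contact (2 * i, 2 * j + 2) (2 * i, 2 * j + 1) (2 * i, 2 * j)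
         (tau (2 * i, 2 * j + 2) (2 * i, 2 * j + 1) *\<^sub>R t (2 * i, 2 * j + 1)) (dir (2 * i + 1, 2 * j + 1) (2 * i, 2 * j + 1))"
        using ccw_quadI(2)[OF Q(2)] ccw_quadI(3)[OF Q(1)]
        by (intro contactI[OF c s(2,1) tau[symmetric], of "(2 * i + 1, 2 * j + 2)" "(2 * i + 1, 2 * j)"]) (simp_all add: algebra_simps)
      from contact_sym[OF this tau[symmetric]] show ?thesis by blast
    qed
  qed
  have "\<exists>b T E. snd v \<noteq> snd b \<and> snd w \<noteq> snd b \<and> contact v b w T E"
  proof (cases rule: g_vedge_cases[OF assms])
    case (1 i j)
    then obtain T E where "contact v (2 * i, 2 * j + 1) w T E" using * by blast
    then show ?thesis using 1 by (intro exI[of _ "(2 * i, 2 * j + 1)"]) auto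
  next
    case (2 i j)
    then obtain T E where "contact w (2 * i, 2 * j + 1) v T E" using * by blast
    then have "contact v (2 * i, 2 * j + 1) w T (- E)" by (rule contact_sym) (simp add: tau_def 2)
    then show ?thesis using 2 by (intro exI[of _ "(2 * i, 2 * j + 1)"]) auto
  qed
  then show thesis using that by blast
qed

text \<open>Together with \<open>omega\<close> the solution of
  \<open>theta - omega = net w - net v\<close> and
  \<open>omega = lam / (rad v * rad w) * theta\<close>: the edges of the two surfaces over an edge
  of the Gauss map.\<close>

definition theta :: "vertex \<Rightarrow> vertex \<Rightarrow> real^3" where
  "theta v w = (rad v * rad w / (rad v * rad w - lam)) *\<^sub>R (net w - net v)"

definition omega :: "vertex \<Rightarrow> vertex \<Rightarrow> real^3" where
  "omega v w = (lam / (rad v * rad w)) *\<^sub>R theta v w"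

definition opposite :: "vertex \<Rightarrow> vertex \<Rightarrow> vertex \<Rightarrow> bool" where
  "opposite v b w \<longleftrightarrow> v \<in> s_verts Q \<and> w \<in> s_verts Q \<and>
     (snd v = snd b \<and> snd w = snd b \<and> sgn_v w = sgn_v v \<or> snd v \<noteq> snd b \<and> snd w \<noteq> snd b \<and> sgn_v w = - sgn_v v)"

lemma sgn_sq: "sgn_v v * sgn_v v = 1"
  by (simp add: sgn_v_def)

lemma rad_nonzero: "v \<in> s_verts Q \<Longrightarrow> rad v \<noteq> 0"
  using len_dist(1)[of v] by (auto simp: rad_def sgn_v_def)

text \<open>The lengths \<open>len\<close> add up to \<open>dist_c v + dist_c w\<close> times
  \<open>1 - lam / (rad v * rad w)\<close>, and \<open>theta\<close> cancels the second factor. The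
  denominator is nonzero on horizontal edges because \<open>lam\<close> is below the square of each
  radius, and on vertical ones because there the product of radii is negative.\<close>

lemma theta_contact:
  assumes "contact v b w T E" "opposite v b w"
  shows "theta v w = (dist_c v + dist_c w) *\<^sub>R E" "rad v * rad w \<noteq> lam"
proof -
  have s: "v \<in> s_verts Q" "w \<in> s_verts Q" using assms(2) by (auto simp: opposite_def)
  define a b' where ab: "a = dist_c v" "b' = dist_c w"
  have pos: "0 < a" "0 < b'" "lam < a\<^sup>2" "lam < b'\<^sup>2" "0 \<le> lam"
    using len_dist[OF s(1)] len_dist[OF s(2)] by (auto simp: ab)
  have nn: "net w - net v = (len v b + len w b) *\<^sub>R E"
    using assms(1) by (simp add: contact_def scaleR_add_left)
  have "lam\<^sup>2 < (a * b')\<^sup>2"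
  proof (cases "lam = 0")
    case True
    then show ?thesis using pos by simp
  next
    case False
    then have "lam * lam < a\<^sup>2 * b'\<^sup>2" using pos by (intro mult_strict_mono) auto
    then show ?thesis by (simp add: power2_eq_square mult_ac)
  qed
  then have lt: "lam < a * b'" using pos by (simp add: power2_less_imp_less)
  from assms(2) consider "snd v = snd b" "snd w = snd b" "rad v * rad w = a * b'"
    | "snd v \<noteq> snd b" "snd w \<noteq> snd b" "rad v * rad w = - (a * b')"
  proof -
    have "rad v * rad w = (sgn_v v * sgn_v w) * (a * b')" by (simp add: rad_def ab)
    then show thesis using assms(2) sgn_sq[of v] that unfolding opposite_def by auto
  qed
  then have "rad v * rad w / (rad v * rad w - lam) * (len v b + len w b) = a + b' \<and> rad v * rad w \<noteq> lam"
  proof cases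
    case 1
    have "len v b + len w b = (a + b') * (a * b' - lam) / (a * b')"
    proof -
      have "len v b = a - lam / a" "len w b = b' - lam / b'"
        using 1 len_dist(3)[OF s(1), of b] len_dist(3)[OF s(2), of b] by (simp_all add: ab)
      then show ?thesis using pos(1,2) by (simp only:) (simp add: field_simps)
    qed
    then show ?thesis unfolding 1 using lt pos(1,2) by simp
  next
    case 2
    have "len v b + len w b = (a + b') * (a * b' + lam) / (a * b')"
    proof -
      have "len v b = a + lam / a" "len w b = b' + lam / b'"
        using 2 len_dist(4)[OF s(1), of b] len_dist(4)[OF s(2), of b] by (simp_all add: ab)
      then show ?thesis using pos(1,2) by (simp only:) (simp add: field_simps)
    qed
    moreover have "a * b' + lam > 0" using pos by (simp add: add_pos_nonneg)
    moreover have "- (a * b') / (- (a * b') - lam) = a * b' / (a * b' + lam)"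
      by (metis add.commute minus_add_distrib minus_divide_divide diff_conv_add_uminus minus_minus)
    ultimately show ?thesis unfolding 2 using pos(1,2) by simp
  qed
  then show "theta v w = (dist_c v + dist_c w) *\<^sub>R E" "rad v * rad w \<noteq> lam"
    unfolding theta_def nn ab by auto
qed

lemma hedge_opposite: "g_hedge Q v w \<Longrightarrow> snd v = snd b \<Longrightarrow> snd w = snd b \<Longrightarrow> opposite v b w"
  by (auto simp: opposite_def g_hedge_def sgn_v_def)

lemma vedge_opposite:
  assumes "g_vedge Q v w" "snd v \<noteq> snd b" "snd w \<noteq> snd b"
  shows "opposite v b w"
proof -
  have "sgn_v w = - sgn_v v"
    by (cases rule: g_vedge_cases[OF assms(1)]) (simp_all add: sgn_v_def)
  then show ?thesis using assms by (auto simp: opposite_def g_vedge_def)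
qed

text \<open>Conjugation and multiplication by \<open>z * z'\<close> exchange the two circles in the
  equation of the corner; the sum of both equations describes a corner at a single circle with equal
  tangent lengths \<open>a + a'\<close>.\<close>

lemma contact_swap:
  assumes "cmod z = 1" "cmod z' = 1" "z * Complex r a = z' * Complex r' (- a')"
  shows "z * Complex (r + r') (a + a') = z' * Complex (r + r') (- (a + a'))"
proof -
  have 1: "cnj z * z = 1" "cnj z' * z' = 1"
    using complex_norm_square[of z] complex_norm_square[of z'] assms(1,2) by (simp_all add: mult.commute)
  have "cnj z * Complex r (- a) = cnj z' * Complex r' a'"
    using arg_cong[OF assms(3), of cnj] by (simp add: complex_cnj)
  then have "z * z' * (cnj z * Complex r (- a)) = z * z' * (cnj z' * Complex r' a')" by simp
  then have "z' * ((cnj z * z) * Complex r (- a)) = z * ((cnj z' * z') * Complex r' a')" by (simp add: mult_ac)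
  then have "z' * Complex r (- a) = z * Complex r' a'" by (simp add: 1)
  moreover have "Complex (r + r') (a + a') = Complex r a + Complex r' a'"
    "Complex (r + r') (- (a + a')) = Complex r' (- a') + Complex r (- a)" by (simp_all add: complex_eq_iff)
  ultimately show ?thesis using assms(3) by (simp only: distrib_left)
qed

text \<open>In complex coordinates of the plane orthogonal to the centre of the face's ring, each
  net vertex has two expressions, one from each of its points of contact. Equating them allows
  \<open>contact_swap\<close> to be applied at every corner, and by \<open>theta_contact\<close> the
  resulting quadrilateral has the edges \<open>theta\<close>.\<close>

lemma tangential_face:
  assumes f: "g_face Q (a, b)"
  obtains x1 x2 x3 x4 where
    "tangential x1 x2 x3 x4 (dist_c (a - 1, b - 1)) (dist_c (a + 1, b - 1)) (dist_c (a + 1, b + 1)) (dist_c (a - 1, b + 1))"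
    "x2 - x1 = theta (a - 1, b - 1) (a + 1, b - 1)" "x3 - x2 = theta (a + 1, b - 1) (a + 1, b + 1)"
    "x4 - x3 = theta (a + 1, b + 1) (a - 1, b + 1)" "x1 - x4 = theta (a - 1, b + 1) (a - 1, b - 1)"
proof -
  let ?c = "(a, b)" and ?v1 = "(a - 1, b - 1)" and ?v2 = "(a + 1, b - 1)" and ?v3 = "(a + 1, b + 1)" and ?v4 = "(a - 1, b + 1)"
    and ?b1 = "(a, b - 1)" and ?b2 = "(a + 1, b)" and ?b3 = "(a, b + 1)" and ?b4 = "(a - 1, b)"
  have Q: "(a, b) \<in> Q" "(a - 1, b) \<in> Q" "(a, b - 1) \<in> Q" "(a - 1, b - 1) \<in> Q" "odd a" "odd b"
    using f by (auto simp: g_face_iff)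
  have c: "?c \<in> white Q" using Q by (intro c_vert_white) auto
  note e = g_face_edges'[OF f]
  have s: "?v1 \<in> s_verts Q" "?v2 \<in> s_verts Q" "?v3 \<in> s_verts Q" "?v4 \<in> s_verts Q"
    using e by (auto simp: g_hedge_def g_vedge_def)
  have quads: "ccw_quad Q ?c ?b4 ?v1 ?b1" "ccw_quad Q ?c ?b1 ?v2 ?b2" "ccw_quad Q ?c ?b2 ?v3 ?b3" "ccw_quad Q ?c ?b3 ?v4 ?b4"
    using ccw_quadI(3)[OF Q(4)] ccw_quadI(4)[OF Q(3)] ccw_quadI(1)[OF Q(1)] ccw_quadI(2)[OF Q(2)] by simp_all
  have pc: "norm (p ?c) = 1" "0 < S ?c" "0 < S' ?c" using white[OF c] by auto
  define n where "n = (\<lambda>u. (1 / ring_sin S S' ?c u) *\<^sub>R (t u - ring_cos q C ?c u *\<^sub>R p ?c))"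
  define f where "f = n ?b1"
  define g where "g = cross3 (p ?c) f"
  define z where "z = (\<lambda>u. Complex (n u \<bullet> f) (n u \<bullet> g))"
  let ?P = "plane_pt f g"
  have pp: "p ?c \<bullet> p ?c = 1" using pc by (simp add: norm_eq_1)
  have n: "n u \<bullet> p ?c = 0 \<and> norm (n u) = 1 \<and> dir ?c u = cross3 (p ?c) (n u) \<and>
     t u = ring_cos q C ?c u *\<^sub>R p ?c + ring_sin S S' ?c u *\<^sub>R n u"
    if "ccw_quad Q ?c u v u' \<or> ccw_quad Q ?c u' v u" for u v u'
  proof -
    have t: "norm (t u) = 1" "p ?c \<bullet> t u = ring_cos q C ?c u" using quad[OF c] that by blast+
    note cs = ring_cos_sin[OF c, of u]
    have 1: "(t u - ring_cos q C ?c u *\<^sub>R p ?c) \<bullet> p ?c = 0"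
      using t(2) pp by (simp add: inner_diff_left inner_commute[of "t u" "p (a, b)"])
    have "(norm (t u - ring_cos q C ?c u *\<^sub>R p ?c))\<^sup>2 = (ring_sin S S' ?c u)\<^sup>2"
    proof -
      have "t u \<bullet> t u = 1" using t by (simp add: norm_eq_1)
      then have "(norm (t u - ring_cos q C ?c u *\<^sub>R p ?c))\<^sup>2 = 1 - (ring_cos q C ?c u)\<^sup>2"
        unfolding power2_norm_eq_inner using t(2) pp
        by (simp add: inner_diff_left inner_diff_right inner_commute[of "t u" "p (a, b)"] power2_eq_square)
      then show ?thesis using cs(1) by simp
    qed
    then have "norm (t u - ring_cos q C ?c u *\<^sub>R p ?c) = ring_sin S S' ?c u"
      using cs(2) by (simp add: power2_eq_iff_nonneg)
    then have "norm (n u) = 1" using cs(2) by (simp add: n_def)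
    moreover have "n u \<bullet> p ?c = 0" using 1 by (simp add: n_def)
    moreover have "dir ?c u = cross3 (p ?c) (n u)"
      by (simp add: dir_def n_def cross_mult_right Cross3.right_diff_distrib)
    moreover have "t u = ring_cos q C ?c u *\<^sub>R p ?c + ring_sin S S' ?c u *\<^sub>R n u"
      using cs(2) by (simp add: n_def)
    ultimately show ?thesis by blast
  qed
  have f1: "f \<bullet> p ?c = 0" "norm f = 1" using n[OF disjI1, OF quads(2)] by (auto simp: f_def)
  have ff: "f \<bullet> f = 1" using f1 by (simp add: norm_eq_1)
  have "(norm g)\<^sup>2 = 1" unfolding g_def norm_cross using f1 pc by (simp add: inner_commute)
  then have "norm g = 1" using power2_eq_iff_nonneg[of "norm g" 1] by simp
  moreover have "f \<bullet> g = 0" by (simp add: g_def dot_cross_self)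
  ultimately have on: "orthonormal_pair f g" using f1 by (simp add: orthonormal_pair_def)
  have cg: "cross3 (p ?c) g = - f"
    unfolding g_def Lagrange using f1 pp by (simp add: inner_commute)
  \<comment> \<open>The vectors \<open>f\<close>, \<open>g\<close> and \<open>p (a, b)\<close> form
    an orthonormal frame, and the remainder \<open>r\<close> is orthogonal to all three.\<close>
  have nP: "u = ?P (Complex (u \<bullet> f) (u \<bullet> g))" if "u \<bullet> p ?c = 0" for u
  proof -
    define r where "r = u - ?P (Complex (u \<bullet> f) (u \<bullet> g))"
    have gg: "g \<bullet> g = 1" "f \<bullet> g = 0" "g \<bullet> p ?c = 0"
      using on by (auto simp: orthonormal_pair_def norm_eq_1 g_def dot_cross_self)
    have r: "r \<bullet> f = 0" "r \<bullet> g = 0" "r \<bullet> p ?c = 0"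
      using that ff gg f1 by (simp_all add: r_def plane_pt_def inner_diff_left inner_add_left inner_commute[of g f])
    have "cross3 r f = 0"
    proof -
      have "f = - cross3 (p ?c) g" using cg by simp
      then have "cross3 r f = - cross3 r (cross3 (p ?c) g)" by (metis cross_minus_right)
      also have "\<dots> = 0" unfolding Lagrange using r by simp
      finally show ?thesis .
    qed
    then have "r = 0" using r(1) norm_and_cross_eq_0[of r f] ff by auto
    then show ?thesis by (simp add: r_def)
  qed
  have dP: "cross3 (p ?c) (?P w) = ?P (\<i> * w)" for w
    by (simp add: plane_pt_def cross_add_right cross_mult_right cg flip: g_def)
  have zP: "n u = ?P (z u) \<and> dir ?c u = ?P (\<i> * z u) \<and> cmod (z u) = 1"
    if "ccw_quad Q ?c u v u' \<or> ccw_quad Q ?c u' v u" for u v u'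
  proof -
    note nu = n[OF that]
    have 1: "n u = ?P (z u)" unfolding z_def using nu by (intro nP) blast
    then have "dir ?c u = ?P (\<i> * z u)" using nu dP by metis
    moreover have "cmod (z u) = 1" using nu 1 norm_plane_pt[OF on] by metis
    ultimately show ?thesis using 1 by blast
  qed
  have zb: "cmod (z ?b1) = 1" "cmod (z ?b2) = 1" "cmod (z ?b3) = 1" "cmod (z ?b4) = 1"
    "dir ?c ?b1 = ?P (\<i> * z ?b1)" "dir ?c ?b2 = ?P (\<i> * z ?b2)" "dir ?c ?b3 = ?P (\<i> * z ?b3)" "dir ?c ?b4 = ?P (\<i> * z ?b4)"
    using zP[OF disjI1, OF quads(1)] zP[OF disjI1, OF quads(2)] zP[OF disjI1, OF quads(3)] zP[OF disjI1, OF quads(4)] by auto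
  define rh rv where r: "rh = 1 / sqrt q * S' ?c" "rv = sqrt q * S ?c"
  \<comment> \<open>Height of the face plane. Contact points of both kinds give the same value,
    since \<open>1 / sqrt q * (q * C) = sqrt q * C\<close>; their distances from the axis are
    \<open>rh\<close> and \<open>rv\<close>.\<close>
  define h where "h = sqrt q * C ?c"
  have sq: "0 < sqrt q" "sqrt q * sqrt q = q" using q by auto
  have net1: "net v = h *\<^sub>R p ?c + ?P (z u * Complex (if snd v = snd u then rh else rv) (len v u))"
    if quad: "ccw_quad Q ?c u v u'" and v: "v \<in> s_verts Q" "snd v = snd u \<longleftrightarrow> snd ?c \<noteq> snd u" for v u u'
  proof -
    note k = n[OF disjI1[OF quad]] zP[OF disjI1[OF quad]]
    have tt: "tau v u * ring_cos q C ?c u = h" "tau v u * ring_sin S S' ?c u = (if snd v = snd u then rh else rv)"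
      using v(2) sq by (auto simp: tau_def ring_cos_def ring_sin_def h_def r field_simps)
    have "net v = tau v u *\<^sub>R t u + len v u *\<^sub>R dir ?c u" by (rule net_contact(1)[OF c v(1) quad])
    also have "\<dots> = tau v u *\<^sub>R (ring_cos q C ?c u *\<^sub>R p ?c + ring_sin S S' ?c u *\<^sub>R ?P (z u)) + len v u *\<^sub>R ?P (\<i> * z u)"
      using k by (metis (no_types, lifting))
    also have "\<dots> = h *\<^sub>R p ?c + ?P (of_real (tau v u * ring_sin S S' ?c u) * z u + of_real (len v u) * (\<i> * z u))"
      unfolding plane_pt_linear tt(1)[symmetric] by (simp add: scaleR_add_right)
    also have "of_real (tau v u * ring_sin S S' ?c u) * z u + of_real (len v u) * (\<i> * z u)
       = z u * Complex (if snd v = snd u then rh else rv) (len v u)"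
      unfolding tt(2) by (simp add: Complex_eq algebra_simps)
    finally show ?thesis .
  qed
  have net2: "net v = h *\<^sub>R p ?c + ?P (z u * Complex (if snd v = snd u then rh else rv) (- len v u))"
    if quad: "ccw_quad Q ?c u' v u" and v: "v \<in> s_verts Q" "snd v = snd u \<longleftrightarrow> snd ?c \<noteq> snd u" for v u u'
  proof -
    note k = n[OF disjI2[OF quad]] zP[OF disjI2[OF quad]]
    have tt: "tau v u * ring_cos q C ?c u = h" "tau v u * ring_sin S S' ?c u = (if snd v = snd u then rh else rv)"
      using v(2) sq by (auto simp: tau_def ring_cos_def ring_sin_def h_def r field_simps)
    have "net v = tau v u *\<^sub>R t u - len v u *\<^sub>R dir ?c u" by (rule net_contact(2)[OF c v(1) quad])
    also have "\<dots> = tau v u *\<^sub>R (ring_cos q C ?c u *\<^sub>R p ?c + ring_sin S S' ?c u *\<^sub>R ?P (z u)) - len v u *\<^sub>R ?P (\<i> * z u)"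
      using k by (metis (no_types, lifting))
    also have "\<dots> = h *\<^sub>R p ?c + ?P (of_real (tau v u * ring_sin S S' ?c u) * z u - of_real (len v u) * (\<i> * z u))"
      unfolding plane_pt_linear tt(1)[symmetric] by (simp add: scaleR_add_right)
    also have "of_real (tau v u * ring_sin S S' ?c u) * z u - of_real (len v u) * (\<i> * z u)
       = z u * Complex (if snd v = snd u then rh else rv) (- len v u)"
      unfolding tt(2) by (simp add: Complex_eq algebra_simps)
    finally show ?thesis .
  qed
  have inj: "u = w" if "?P u = ?P w" for u w
    using norm_plane_pt[OF on, of "u - w"] that by (simp add: plane_pt_linear)
  \<comment> \<open>The mean of the two circles; correspondingly \<open>dist_c\<close> is the mean
    of the two tangent lengths at a vertex, as \<open>ld\<close> shows.\<close>
  define \<rho> where "\<rho> = (rh + rv) / 2"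
  have rpos: "0 < \<rho>" unfolding \<rho>_def r using pc sq by (simp add: add_pos_pos)
  have halve: "z * Complex \<rho> d = z' * Complex \<rho> (- d)"
    if "cmod z = 1" "cmod z' = 1" "z * Complex r a = z' * Complex r' (- a')" "r + r' = 2 * \<rho>" "a + a' = 2 * d" for z z' r a r' a' d
  proof -
    have "Complex (2 * \<rho>) (2 * d) = 2 * Complex \<rho> d" "Complex (2 * \<rho>) (- (2 * d)) = 2 * Complex \<rho> (- d)"
      by (simp_all add: complex_eq_iff)
    then show ?thesis using contact_swap[OF that(1-3)] unfolding that(4,5) by simp
  qed
  have ld: "len v u + len v u' = 2 * dist_c v" if "v \<in> s_verts Q" "snd v = snd u" "snd v \<noteq> snd u'" for v u u'
    using len_dist(3)[OF that(1,2)] len_dist(4)[OF that(1,3)] by simp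
  have rho: "rh + rv = 2 * \<rho>" "rv + rh = 2 * \<rho>" by (simp_all add: \<rho>_def)
  have corner2: "z ?b1 * Complex \<rho> (dist_c ?v2) = z ?b2 * Complex \<rho> (- dist_c ?v2)"
    using inj net1[OF quads(2) s(2)] net2[OF quads(2) s(2)] ld[OF s(2), of ?b1 ?b2]
    by (intro halve[where a = "len ?v2 ?b1" and a' = "len ?v2 ?b2", OF zb(1,2) _ rho(1)]) auto
  have corner3: "z ?b2 * Complex \<rho> (dist_c ?v3) = z ?b3 * Complex \<rho> (- dist_c ?v3)"
    using inj net1[OF quads(3) s(3)] net2[OF quads(3) s(3)] ld[OF s(3), of ?b3 ?b2]
    by (intro halve[where a = "len ?v3 ?b2" and a' = "len ?v3 ?b3", OF zb(2,3) _ rho(2)]) auto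
  have corner4: "z ?b3 * Complex \<rho> (dist_c ?v4) = z ?b4 * Complex \<rho> (- dist_c ?v4)"
    using inj net1[OF quads(4) s(4)] net2[OF quads(4) s(4)] ld[OF s(4), of ?b3 ?b4]
    by (intro halve[where a = "len ?v4 ?b3" and a' = "len ?v4 ?b4", OF zb(3,4) _ rho(1)]) auto
  have corner1: "z ?b4 * Complex \<rho> (dist_c ?v1) = z ?b1 * Complex \<rho> (- dist_c ?v1)"
    using inj net1[OF quads(1) s(1)] net2[OF quads(1) s(1)] ld[OF s(1), of ?b1 ?b4]
    by (intro halve[where a = "len ?v1 ?b4" and a' = "len ?v1 ?b1", OF zb(4,1) _ rho(2)]) auto
  have edge: "?P (z u * Complex \<rho> d') - ?P (z u * Complex \<rho> (- d)) = (d + d') *\<^sub>R ?P (\<i> * z u)" for u d d'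
  proof -
    have "z u * Complex \<rho> d' - z u * Complex \<rho> (- d) = of_real (d + d') * (\<i> * z u)"
      by (simp add: Complex_eq algebra_simps)
    then show ?thesis by (simp flip: plane_pt_linear)
  qed
  show thesis
  proof (rule that)
    show "tangential (?P (z ?b1 * Complex \<rho> (- dist_c ?v1))) (?P (z ?b2 * Complex \<rho> (- dist_c ?v2)))
       (?P (z ?b3 * Complex \<rho> (- dist_c ?v3))) (?P (z ?b4 * Complex \<rho> (- dist_c ?v4)))
       (dist_c ?v1) (dist_c ?v2) (dist_c ?v3) (dist_c ?v4)"
      unfolding tangential_def
    proof (intro exI conjI)
      show "orthonormal_pair f g" by (rule on)
      show "\<rho> \<noteq> 0" using rpos by simp
      show "0 < dist_c ?v1 \<and> 0 < dist_c ?v2 \<and> 0 < dist_c ?v3 \<and> 0 < dist_c ?v4 \<or>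
        dist_c ?v1 < 0 \<and> dist_c ?v2 < 0 \<and> dist_c ?v3 < 0 \<and> dist_c ?v4 < 0"
        using s len_dist(1) by blast
    qed (fact zb corner1 corner2 corner3 corner4 | rule add_0_left[symmetric])+
    show "?P (z ?b2 * Complex \<rho> (- dist_c ?v2)) - ?P (z ?b1 * Complex \<rho> (- dist_c ?v1)) = theta ?v1 ?v2"
      unfolding corner2[symmetric] edge zb(5)[symmetric]
      by (rule theta_contact(1)[symmetric, OF contactI[OF c s(1,2) _ quads(1,2)] hedge_opposite[OF e(1)]]) (simp_all add: tau_def)
    show "?P (z ?b3 * Complex \<rho> (- dist_c ?v3)) - ?P (z ?b2 * Complex \<rho> (- dist_c ?v2)) = theta ?v2 ?v3"
      unfolding corner3[symmetric] edge zb(6)[symmetric]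
      by (rule theta_contact(1)[symmetric, OF contactI[OF c s(2,3) _ quads(2,3)] vedge_opposite[OF e(2)]]) (simp_all add: tau_def)
    show "?P (z ?b4 * Complex \<rho> (- dist_c ?v4)) - ?P (z ?b3 * Complex \<rho> (- dist_c ?v3)) = theta ?v3 ?v4"
      unfolding corner4[symmetric] edge zb(7)[symmetric]
      by (rule theta_contact(1)[symmetric, OF contactI[OF c s(3,4) _ quads(3,4)] hedge_opposite[OF g_hedge_sym[OF e(3)]]]) (simp_all add: tau_def)
    show "?P (z ?b1 * Complex \<rho> (- dist_c ?v1)) - ?P (z ?b4 * Complex \<rho> (- dist_c ?v4)) = theta ?v4 ?v1"
      unfolding corner1[symmetric] edge zb(8)[symmetric]
      by (rule theta_contact(1)[symmetric, OF contactI[OF c s(4,1) _ quads(4,1)] vedge_opposite[OF g_vedge_sym[OF e(4)]]]) (simp_all add: tau_def)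
  qed
qed

end


section \<open>The cmc pair of a potential, and the case q = 1\<close>

context ring_config
begin

lemma rad_mult:
  assumes "g_edge Q v w"
  shows "g_hedge Q v w \<Longrightarrow> sgn_v w = sgn_v v \<and> rad v * rad w = dist_c v * dist_c w"
    "g_vedge Q v w \<Longrightarrow> sgn_v w = - sgn_v v \<and> rad v * rad w = - (dist_c v * dist_c w)"
proof -
  have r: "rad v * rad w = (sgn_v v * sgn_v w) * (dist_c v * dist_c w)" by (simp add: rad_def)
  show "sgn_v w = sgn_v v \<and> rad v * rad w = dist_c v * dist_c w" if h: "g_hedge Q v w"
  proof -
    have "sgn_v w = sgn_v v"
      by (cases rule: g_hedge_cases[OF h]) (simp_all add: sgn_v_def)
    then show ?thesis using r sgn_sq[of v] by simp
  qed
  show "sgn_v w = - sgn_v v \<and> rad v * rad w = - (dist_c v * dist_c w)" if h: "g_vedge Q v w"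
  proof -
    have "sgn_v w = - sgn_v v"
      by (cases rule: g_vedge_cases[OF h]) (simp_all add: sgn_v_def)
    then show ?thesis using r sgn_sq[of v] by simp
  qed
qed

lemma theta_antisym: "theta w v = - theta v w"
  by (simp add: theta_def mult.commute flip: scaleR_minus_right)

text \<open>Around a face, \<open>omega\<close> consists of the dual edges of the tangential
  quadrilateral with edges \<open>theta\<close>; the negative products of radii on vertical edges
  supply the alternating signs.\<close>

lemma omega_closed:
  assumes "lam \<noteq> 0"
  shows "closed_form Q omega"
  unfolding closed_form_def
proof (intro conjI allI impI)
  show "omega w v = - omega v w" for v w
    by (simp add: omega_def theta_antisym[of w v] mult.commute)
  fix a b assume f: "g_face Q (a, b)"
  obtain x1 x2 x3 x4 where x:
    "tangential x1 x2 x3 x4 (dist_c (a - 1, b - 1)) (dist_c (a + 1, b - 1)) (dist_c (a + 1, b + 1)) (dist_c (a - 1, b + 1))"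
    "x2 - x1 = theta (a - 1, b - 1) (a + 1, b - 1)" "x3 - x2 = theta (a + 1, b - 1) (a + 1, b + 1)"
    "x4 - x3 = theta (a + 1, b + 1) (a - 1, b + 1)" "x1 - x4 = theta (a - 1, b + 1) (a - 1, b - 1)"
    by (rule tangential_face[OF f])
  note e = g_face_edges'[OF f]
  have m: "rad (a - 1, b - 1) * rad (a + 1, b - 1) = dist_c (a - 1, b - 1) * dist_c (a + 1, b - 1)"
    "rad (a + 1, b - 1) * rad (a + 1, b + 1) = - (dist_c (a + 1, b - 1) * dist_c (a + 1, b + 1))"
    "rad (a + 1, b + 1) * rad (a - 1, b + 1) = dist_c (a + 1, b + 1) * dist_c (a - 1, b + 1)"
    "rad (a - 1, b + 1) * rad (a - 1, b - 1) = - (dist_c (a - 1, b + 1) * dist_c (a - 1, b - 1))"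
    using rad_mult(1)[OF _ e(1)] rad_mult(2)[OF _ e(2)] rad_mult(1)[OF _ g_hedge_sym[OF e(3)]] rad_mult(2)[OF _ g_vedge_sym[OF e(4)]]
      e g_hedge_sym[OF e(3)] g_vedge_sym[OF e(4)] by (auto simp: g_edge_def)
  from tangential_dual_closed[OF x(1) assms]
  show "omega (a - 1, b - 1) (a + 1, b - 1) + omega (a + 1, b - 1) (a + 1, b + 1)
      + omega (a + 1, b + 1) (a - 1, b + 1) + omega (a - 1, b + 1) (a - 1, b - 1) = 0"
    unfolding omega_def m x(2-5)[symmetric] by simp
qed

text \<open>Multiplying the edge direction by \<open>sgn_v v\<close> converts positive lengths into
  signed radii; for a face whose lower row is negative, its plane is turned over.\<close>

lemma theta_net:
  assumes x: "\<And>v w. g_edge Q v w \<Longrightarrow> x w - x v = theta v w"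
  shows "tangential_net Q x rad"
  unfolding tangential_net_def
proof (intro conjI ballI allI impI)
  show "rad v \<noteq> 0" if "v \<in> s_verts Q" for v using that by (rule rad_nonzero)
  have sgn1: "norm (sgn_v v *\<^sub>R E) = 1" if "norm E = 1" for v and E :: "real^3"
    using that by (simp add: sgn_v_def)
  show "\<exists>E. norm E = 1 \<and> x w - x v = (rad v + rad w) *\<^sub>R E" if h: "g_hedge Q v w" for v w
  proof -
    have e: "g_edge Q v w" using h by (simp add: g_edge_def)
    obtain b T E where c: "snd v = snd b" "snd w = snd b" "contact v b w T E" by (rule hedge_contact[OF h])
    have "x w - x v = (dist_c v + dist_c w) *\<^sub>R E"
      unfolding x[OF e] by (rule theta_contact(1)[OF c(3) hedge_opposite[OF h c(1,2)]])
    also have "\<dots> = (rad v + rad w) *\<^sub>R (sgn_v v *\<^sub>R E)"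
      using rad_mult(1)[OF e h] sgn_sq[of v] by (simp add: rad_def distrib_right flip: mult.assoc)
         (metis mult.commute mult.left_commute mult.right_neutral)
    finally show ?thesis using sgn1[of E v] c(3) unfolding contact_def by blast
  qed
  show "\<exists>E. norm E = 1 \<and> x w - x v = (rad v - rad w) *\<^sub>R E" if h: "g_vedge Q v w" for v w
  proof -
    have e: "g_edge Q v w" using h by (simp add: g_edge_def)
    obtain b T E where c: "snd v \<noteq> snd b" "snd w \<noteq> snd b" "contact v b w T E" by (rule vedge_contact[OF h])
    have "x w - x v = (dist_c v + dist_c w) *\<^sub>R E"
      unfolding x[OF e] by (rule theta_contact(1)[OF c(3) vedge_opposite[OF h c(1,2)]])
    also have "\<dots> = (rad v - rad w) *\<^sub>R (sgn_v v *\<^sub>R E)"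
      using rad_mult(2)[OF e h] sgn_sq[of v] by (simp add: rad_def left_diff_distrib distrib_right flip: mult.assoc)
         (metis mult.commute mult.left_commute mult.right_neutral)
    finally show ?thesis using sgn1[of E v] c(3) unfolding contact_def by blast
  qed
  fix a b assume f: "g_face Q (a, b)"
  obtain x1 x2 x3 x4 where X:
    "tangential x1 x2 x3 x4 (dist_c (a - 1, b - 1)) (dist_c (a + 1, b - 1)) (dist_c (a + 1, b + 1)) (dist_c (a - 1, b + 1))"
    "x2 - x1 = theta (a - 1, b - 1) (a + 1, b - 1)" "x3 - x2 = theta (a + 1, b - 1) (a + 1, b + 1)"
    "x4 - x3 = theta (a + 1, b + 1) (a - 1, b + 1)" "x1 - x4 = theta (a - 1, b + 1) (a - 1, b - 1)"
    by (rule tangential_face[OF f])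
  note e = g_face_edges'[OF f]
  have ge: "g_edge Q (a - 1, b - 1) (a + 1, b - 1)" "g_edge Q (a + 1, b - 1) (a + 1, b + 1)"
     "g_edge Q (a + 1, b + 1) (a - 1, b + 1)" "g_edge Q (a - 1, b + 1) (a - 1, b - 1)"
    using e g_hedge_sym[OF e(3)] g_vedge_sym[OF e(4)] by (simp_all add: g_edge_def)
  have T: "tangential (x (a - 1, b - 1)) (x (a + 1, b - 1)) (x (a + 1, b + 1)) (x (a - 1, b + 1))
     (dist_c (a - 1, b - 1)) (dist_c (a + 1, b - 1)) (dist_c (a + 1, b + 1)) (dist_c (a - 1, b + 1))"
    by (rule tangential_translate[OF X(1)]) (simp_all only: X(2-5) x[OF ge(1)] x[OF ge(2)] x[OF ge(3)])
  have sg: "sgn_v (a + 1, b - 1) = sgn_v (a - 1, b - 1)" "sgn_v (a + 1, b + 1) = - sgn_v (a - 1, b - 1)"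
     "sgn_v (a - 1, b + 1) = - sgn_v (a - 1, b - 1)"
    using rad_mult(1)[OF ge(1) e(1)] rad_mult(2)[OF ge(2) e(2)] rad_mult(2)[OF ge(4) g_vedge_sym[OF e(4)]] by auto
  consider "sgn_v (a - 1, b - 1) = 1" | "sgn_v (a - 1, b - 1) = -1"
    unfolding sgn_v_def by presburger
  then show "tangential (x (a - 1, b - 1)) (x (a + 1, b - 1)) (x (a + 1, b + 1)) (x (a - 1, b + 1))
     (rad (a - 1, b - 1)) (rad (a + 1, b - 1)) (- rad (a + 1, b + 1)) (- rad (a - 1, b + 1))"
  proof cases
    case 1
    then show ?thesis using T by (simp add: rad_def sg)
  next
    case 2
    then show ?thesis using tangential_uminus[OF T] by (simp add: rad_def sg)
  qed
qed

text \<open>Writing \<open>d\<close> for the signed radii, \<open>d - lam / d\<close> is up to sign the distance from a vertex of the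
  Koebe net to the points of contact of horizontal edges, and \<open>d + lam / d\<close> that for vertical edges.\<close>

lemma cmc_pair:
  assumes lam: "lam \<noteq> 0" and y: "\<And>v w. g_edge Q v w \<Longrightarrow> y w - y v = omega v w" and m: "\<mu> \<noteq> 0"
  shows "s1_cmc_pair Q (\<lambda>v. (\<mu> *\<^sub>R (net v + y v), \<mu> * rad v)) (\<lambda>v. (\<mu> *\<^sub>R y v, \<mu> * (lam / rad v)))"
    and "has_mean_curvature Q (\<lambda>v. \<mu> *\<^sub>R (net v + y v)) (\<lambda>v. y v - (net v + y v)) (1 / \<mu>)"
proof -
  let ?x = "\<lambda>v. net v + y v"
  have lam0: "0 < lam" using lam q by (auto simp: lam_def power_le_one zero_less_mult_iff less_le)
  have ne: "rad v * rad w \<noteq> lam" if "g_edge Q v w" for v w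
  proof (cases "g_hedge Q v w")
    case True
    obtain b T E where c: "snd v = snd b" "snd w = snd b" "contact v b w T E" by (rule hedge_contact[OF True])
    show ?thesis by (rule theta_contact(2)[OF c(3) hedge_opposite[OF True c(1,2)]])
  next
    case False
    then have h: "g_vedge Q v w" using that by (simp add: g_edge_def)
    obtain b T E where c: "snd v \<noteq> snd b" "snd w \<noteq> snd b" "contact v b w T E" by (rule vedge_contact[OF h])
    show ?thesis by (rule theta_contact(2)[OF c(3) vedge_opposite[OF h c(1,2)]])
  qed
  have x: "?x w - ?x v = theta v w" if e: "g_edge Q v w" for v w
  proof -
    define D where "D = rad v * rad w"
    have D: "D \<noteq> 0" "D \<noteq> lam"
      using rad_nonzero g_edge_verts[OF e] ne[OF e] by (auto simp: D_def)
    have "?x w - ?x v = (net w - net v) + omega v w" using y[OF e] by (simp add: algebra_simps)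
    also have "\<dots> = (1 + lam / D * (D / (D - lam))) *\<^sub>R (net w - net v)"
      by (simp add: omega_def theta_def D_def scaleR_add_left)
    also have "1 + lam / D * (D / (D - lam)) = D / (D - lam)"
      using D by (simp add: field_simps)
    finally show ?thesis by (simp add: theta_def D_def)
  qed
  have net: "tangential_net Q ?x rad" by (rule theta_net) (rule x)
  have dual: "y w - y v = dual_form lam ?x rad v w" if "g_edge Q v w" for v w
    unfolding dual_form_def x[OF that] y[OF that] omega_def ..
  show "has_mean_curvature Q (\<lambda>v. \<mu> *\<^sub>R ?x v) (\<lambda>v. y v - ?x v) (1 / \<mu>)"
    by (rule has_mean_curvature_pair[OF net lam m dual])
  have sgn1: "norm (sgn_v v *\<^sub>R E) = 1" if "norm E = 1" for v and E :: "real^3"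
    using that by (simp add: sgn_v_def)
  have lr: "lam / rad v = sgn_v v * (lam / dist_c v)" for v
    by (simp add: rad_def sgn_v_def)
  show "s1_cmc_pair Q (\<lambda>v. (\<mu> *\<^sub>R ?x v, \<mu> * rad v)) (\<lambda>v. (\<mu> *\<^sub>R y v, \<mu> * (lam / rad v)))"
  proof (rule s1_cmc_pairI[OF net lam0 dual _ _ m])
    show "\<exists>T E. norm E = 1 \<and> T \<bullet> E = 0 \<and> ?x w - ?x v = (rad v + rad w) *\<^sub>R E \<and>
      ?x v - y v = T - (rad v - lam / rad v) *\<^sub>R E \<and> ?x w - y w = T + (rad w - lam / rad w) *\<^sub>R E"
      if h: "g_hedge Q v w" for v w
    proof -
      have e: "g_edge Q v w" and s: "v \<in> s_verts Q" "w \<in> s_verts Q" using h by (auto simp: g_edge_def g_hedge_def)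
      obtain b T E where c: "snd v = snd b" "snd w = snd b" "contact v b w T E" by (rule hedge_contact[OF h])
      have sg: "sgn_v w = sgn_v v" using rad_mult(1)[OF e h] by blast
      have "?x w - ?x v = (dist_c v + dist_c w) *\<^sub>R E"
        unfolding x[OF e] by (rule theta_contact(1)[OF c(3) hedge_opposite[OF h c(1,2)]])
      moreover have "(rad v + rad w) * sgn_v v = dist_c v + dist_c w"
        "(rad v - lam / rad v) * sgn_v v = len v b" "(rad w - lam / rad w) * sgn_v v = len w b"
        unfolding lr len_dist(3)[OF s(1) c(1)] len_dist(3)[OF s(2) c(2)] unfolding rad_def sg
        by (auto simp: sgn_v_def)
      ultimately show ?thesis
        using c(3) sgn1[of E v] unfolding contact_def
        by (intro exI[of _ T] exI[of _ "sgn_v v *\<^sub>R E"]) simp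
    qed
    show "\<exists>T E. norm E = 1 \<and> T \<bullet> E = 0 \<and> ?x w - ?x v = (rad v - rad w) *\<^sub>R E \<and>
      ?x v - y v = T - (rad v + lam / rad v) *\<^sub>R E \<and> ?x w - y w = T + (- rad w - lam / rad w) *\<^sub>R E"
      if h: "g_vedge Q v w" for v w
    proof -
      have e: "g_edge Q v w" and s: "v \<in> s_verts Q" "w \<in> s_verts Q" using h by (auto simp: g_edge_def g_vedge_def)
      obtain b T E where c: "snd v \<noteq> snd b" "snd w \<noteq> snd b" "contact v b w T E" by (rule vedge_contact[OF h])
      have sg: "sgn_v w = - sgn_v v" using rad_mult(2)[OF e h] by blast
      have "?x w - ?x v = (dist_c v + dist_c w) *\<^sub>R E"
        unfolding x[OF e] by (rule theta_contact(1)[OF c(3) vedge_opposite[OF h c(1,2)]])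
      moreover have "(rad v - rad w) * sgn_v v = dist_c v + dist_c w"
        "(rad v + lam / rad v) * sgn_v v = len v b" "(- rad w - lam / rad w) * sgn_v v = len w b"
        unfolding lr len_dist(4)[OF s(1) c(1)] len_dist(4)[OF s(2) c(2)] unfolding rad_def sg
        by (auto simp: sgn_v_def)
      ultimately show ?thesis
        using c(3) sgn1[of E v] unfolding contact_def
        by (intro exI[of _ T] exI[of _ "sgn_v v *\<^sub>R E"]) simp
    qed
  qed
qed

lemma tangential_coplanar:
  assumes "tangential x1 x2 x3 x4 d1 d2 d3 d4"
  shows "coplanar {x1, x2, x3, x4}"
proof -
  obtain f g t \<rho> z1 z2 z3 z4 where T:
    "x1 = t + plane_pt f g (z1 * Complex \<rho> (- d1))" "x2 = t + plane_pt f g (z2 * Complex \<rho> (- d2))"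
    "x3 = t + plane_pt f g (z3 * Complex \<rho> (- d3))" "x4 = t + plane_pt f g (z4 * Complex \<rho> (- d4))"
    by (rule tangentialE[OF assms]) blast
  have "t + plane_pt f g z \<in> affine hull {t, t + f, t + g}" for z
  proof -
    have "t + plane_pt f g z = (1 - Re z - Im z) *\<^sub>R t + Re z *\<^sub>R (t + f) + Im z *\<^sub>R (t + g)"
      by (simp add: plane_pt_def algebra_simps)
    then show ?thesis unfolding affine_hull_3 by (intro CollectI exI conjI) auto
  qed
  then have "{x1, x2, x3, x4} \<subseteq> affine hull {t, t + f, t + g}" unfolding T by blast
  then show ?thesis unfolding coplanar_def by blast
qed

text \<open>For \<open>q = 1\<close> the constant \<open>lam\<close> vanishes and the two circles of
  a face coincide, so the net itself is tangential. Its radii \<open>S / C\<close> are tangents of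
  spherical radii, which makes the vertex spheres orthogonal to the unit sphere.\<close>

lemma koebe:
  assumes "q = 1"
  shows "tangential_net Q net rad" "koebe_net Q (\<lambda>v. (net v, rad v))"
    "v \<in> s_verts Q \<Longrightarrow> rad v = sgn_v v * (S v / C v)"
proof -
  have lam: "lam = 0" unfolding lam_def by (simp add: assms)
  show net: "tangential_net Q net rad"
  proof (rule theta_net)
    fix v w assume "g_edge Q v w"
    then show "net w - net v = theta v w"
      using rad_nonzero g_edge_verts[of Q v w] by (simp add: theta_def lam)
  qed
  have SC: "S' v = S v" if "v \<in> s_verts Q" for v
  proof -
    have w: "0 < S v" "0 < S' v" "(C v)\<^sup>2 + (S v)\<^sup>2 = 1" "(C v)\<^sup>2 + (S' v)\<^sup>2 = 1"
      using white[OF s_verts_white[OF that]] assms by auto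
    then have "(S' v)\<^sup>2 = (S v)\<^sup>2" by linarith
    then show ?thesis using w by (simp add: power2_eq_iff_nonneg)
  qed
  show rad: "rad v = sgn_v v * (S v / C v)" if "v \<in> s_verts Q" for v
    using SC[OF that] unfolding rad_def dist_c_def by (simp add: assms)
  show "koebe_net Q (\<lambda>v. (net v, rad v))"
    unfolding koebe_net_def fst_conv snd_conv
  proof (intro conjI allI impI ballI)
    show "s1_isothermic Q (\<lambda>v. (net v, rad v))" by (rule tangential_net_s1_isothermic[OF net])
    show "coplanar {net (a - 1, b - 1), net (a + 1, b - 1), net (a + 1, b + 1), net (a - 1, b + 1)}"
      if "g_face Q (a, b)" for a b
      using net that unfolding tangential_net_def by (blast intro: tangential_coplanar)
    show "(norm (net v))\<^sup>2 = 1 + (rad v)\<^sup>2" if "v \<in> s_verts Q" for v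
    proof -
      have "norm (p v) = 1" "(C v)\<^sup>2 + (S v)\<^sup>2 = 1" "0 < C v"
        using white[OF s_verts_white[OF that]] s_vert[OF that] by auto
      moreover have "(sgn_v v)\<^sup>2 = 1" by (simp add: sgn_v_def)
      ultimately show ?thesis
        unfolding net_def rad[OF that] by (simp add: assms power_mult_distrib power_divide field_simps)
    qed
    fix v w assume e: "g_edge Q v w"
    obtain b T E where c: "contact v b w T E"
      using e hedge_contact[of v w] vedge_contact[of v w] unfolding g_edge_def by metis
    have l: "0 < len v b" "0 < len w b" using len_dist(2) g_edge_verts[OF e] by blast+
    have "norm T = 1" using c unfolding contact_def tau_def by (simp add: assms)
    moreover have "T \<bullet> (net w - net v) = 0" using c by (simp add: contact_def inner_simps)
    moreover have "T \<in> closed_segment (net v) (net w)"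
    proof -
      \<comment> \<open>Divides the edge in the ratio of the tangent lengths, so that the dividing
        point is the point of contact.\<close>
      define u where "u = len v b / (len v b + len w b)"
      have "0 \<le> u" "u \<le> 1" using l by (auto simp: u_def)
      moreover have "(1 - u) * len v b = u * len w b"
        using l by (simp add: u_def field_simps)
      moreover have "(1 - u) *\<^sub>R net v + u *\<^sub>R net w = T + (u * len w b - (1 - u) * len v b) *\<^sub>R E"
      proof -
        have "net v = T - len v b *\<^sub>R E" "net w = T + len w b *\<^sub>R E" using c by (auto simp: contact_def)
        then show ?thesis by (simp only:) (simp add: algebra_simps)
      qed
      ultimately have "T = (1 - u) *\<^sub>R net v + u *\<^sub>R net w" "0 \<le> u" "u \<le> 1" by simp_all
      then show ?thesis unfolding closed_segment_def by blast
    qed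
    ultimately show "\<exists>x\<in>closed_segment (net v) (net w). norm x = 1 \<and> x \<bullet> (net w - net v) = 0" by blast
  qed
qed

end


section \<open>Ring patterns as ring configurations\<close>

text \<open>The spherical theorem of Pythagoras for the triangle formed by the centres and a point
  of intersection.\<close>

lemma circles_orthogonal_inner:
  assumes "circles_orthogonal p \<rho> p' \<rho>'"
  shows "p \<bullet> p' = cos \<rho> * cos \<rho>'"
proof -
  obtain x where "norm x = 1" "x \<bullet> p = cos \<rho>" "x \<bullet> p' = cos \<rho>'" "cross3 p x \<bullet> cross3 p' x = 0"
    using assms by (auto simp: circles_orthogonal_def on_circle_def)
  then show ?thesis by (simp add: dot_cross inner_commute norm_eq_1)
qed

lemma triple_antisym: "p \<bullet> cross3 p' x = - (p' \<bullet> cross3 p x)"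
  by (simp add: cross3_simps)

text \<open>Lagrange's identity for \<open>cross3 x y\<close> against \<open>cross3 w N\<close>,
  where \<open>w\<close> is the part of \<open>p'\<close> orthogonal to \<open>p\<close>. It
  expresses the order of \<open>x\<close> and \<open>y\<close> about \<open>p\<close> by the sides
  of the line of centres on which they lie.\<close>

lemma triple_gram:
  assumes "norm p = 1" "norm p' = 1"
  shows "(1 - (p \<bullet> p')\<^sup>2) * (p \<bullet> cross3 x y) =
    (p' \<bullet> cross3 p x) * (y \<bullet> p' - (p \<bullet> p') * (y \<bullet> p)) - (p' \<bullet> cross3 p y) * (x \<bullet> p' - (p \<bullet> p') * (x \<bullet> p))"
proof -
  define N where "N = cross3 p p'"
  define w where "w = cross3 N p"
  have pp: "p \<bullet> p = 1" using assms by (simp add: norm_eq_1)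
  have "w = - cross3 p N" by (simp add: w_def cross_skew[of N p])
  then have w: "w = p' - (p \<bullet> p') *\<^sub>R p" by (simp add: N_def Lagrange pp)
  have "cross3 w N = - cross3 N (cross3 N p)" by (simp add: w_def cross_skew[of "cross3 N p" N])
  also have "\<dots> = (N \<bullet> N) *\<^sub>R p" by (simp add: Lagrange N_def dot_cross_self)
  finally have wN: "cross3 w N = (N \<bullet> N) *\<^sub>R p" .
  have NN: "N \<bullet> N = 1 - (p \<bullet> p')\<^sup>2"
    using norm_cross[of p p'] assms by (simp add: N_def power2_norm_eq_inner)
  have xN: "u \<bullet> N = - (p' \<bullet> cross3 p u)" for u
    by (simp add: N_def cross3_simps)
  have "(N \<bullet> N) * (p \<bullet> cross3 x y) = cross3 x y \<bullet> cross3 w N"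
    by (simp add: wN inner_commute)
  also have "\<dots> = (x \<bullet> w) * (y \<bullet> N) - (x \<bullet> N) * (y \<bullet> w)" by (rule dot_cross)
  finally show ?thesis unfolding NN unfolding xN w by (simp add: inner_diff_right algebra_simps)
qed

text \<open>By the product formula \<open>p'\<close> is orthogonal to the part of \<open>p\<close>
  orthogonal to \<open>x\<close>, hence lies in the span of \<open>x\<close> and
  \<open>cross3 p x\<close>; its unit length fixes the second coefficient up to sign.\<close>

lemma right_triangle:
  assumes "norm p = 1" "norm p' = 1" "norm x = 1" "p \<bullet> p' = (p \<bullet> x) * (p' \<bullet> x)" "(p \<bullet> x)\<^sup>2 \<noteq> 1"
  shows "p' = (p' \<bullet> x) *\<^sub>R x + ((p' \<bullet> cross3 p x) / (1 - (p \<bullet> x)\<^sup>2)) *\<^sub>R cross3 p x"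
    "(p' \<bullet> cross3 p x)\<^sup>2 = (1 - (p \<bullet> x)\<^sup>2) * (1 - (p' \<bullet> x)\<^sup>2)"
proof -
  define n where "n = cross3 p x"
  define \<beta> where "\<beta> = (p' \<bullet> n) / (1 - (p \<bullet> x)\<^sup>2)"
  define r where "r = p' - (p' \<bullet> x) *\<^sub>R x - \<beta> *\<^sub>R n"
  have nn: "n \<bullet> n = 1 - (p \<bullet> x)\<^sup>2" using norm_cross[of p x] assms by (simp add: n_def power2_norm_eq_inner)
  have ne: "n \<bullet> n \<noteq> 0" using nn assms(5) by auto
  have xx: "x \<bullet> x = 1" using assms(3) by (simp add: norm_eq_1)
  have o: "x \<bullet> n = 0" "n \<bullet> x = 0" "p \<bullet> n = 0" "n \<bullet> p = 0" by (simp_all add: n_def dot_cross_self)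
  have "r \<bullet> n = 0" using ne by (simp add: r_def inner_diff_left o \<beta>_def nn[symmetric])
  moreover have "r \<bullet> x = 0" by (simp add: r_def inner_diff_left o xx)
  moreover have "r \<bullet> p = 0" using assms(4) by (simp add: r_def inner_diff_left o inner_commute[of p' p] inner_commute[of x p])
  ultimately have "r = 0"
    using norm_and_cross_eq_0[of r n] ne by (auto simp: n_def Lagrange)
  moreover have "p' = (p' \<bullet> x) *\<^sub>R x + \<beta> *\<^sub>R n + r" by (simp add: r_def)
  ultimately have p': "p' = (p' \<bullet> x) *\<^sub>R x + \<beta> *\<^sub>R n" by simp
  then show "p' = (p' \<bullet> x) *\<^sub>R x + ((p' \<bullet> cross3 p x) / (1 - (p \<bullet> x)\<^sup>2)) *\<^sub>R cross3 p x"
    by (simp add: \<beta>_def n_def)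
  have "p' \<bullet> p' = 1" using assms(2) by (simp add: norm_eq_1)
  moreover have "p' \<bullet> p' = (p' \<bullet> x)\<^sup>2 + \<beta>\<^sup>2 * (n \<bullet> n)"
    by (subst (1 2) p') (simp add: inner_add_left inner_add_right o xx power2_eq_square)
  ultimately have "\<beta>\<^sup>2 * (n \<bullet> n) = 1 - (p' \<bullet> x)\<^sup>2" by simp
  then have "(p' \<bullet> n)\<^sup>2 = (n \<bullet> n) * (1 - (p' \<bullet> x)\<^sup>2)"
    using ne unfolding \<beta>_def nn[symmetric] by (simp add: power_divide field_simps power2_eq_square)
  then show "(p' \<bullet> cross3 p x)\<^sup>2 = (1 - (p \<bullet> x)\<^sup>2) * (1 - (p' \<bullet> x)\<^sup>2)"
    by (simp add: nn n_def[symmetric])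
qed

text \<open>Expansion in the frame \<open>p\<close>, \<open>p'\<close>, \<open>cross3 p p'\<close>.
  Centres are orthogonal when one of the rings is a great circle, and this formula then decides the
  degenerate order.\<close>

lemma inner_orthonormal:
  assumes "norm p = 1" "norm p' = 1" "p \<bullet> p' = 0"
  shows "x \<bullet> y = (x \<bullet> p) * (y \<bullet> p) + (x \<bullet> p') * (y \<bullet> p') + (p' \<bullet> cross3 p x) * (p' \<bullet> cross3 p y)"
proof -
  define N where "N = cross3 p p'"
  have e: "p \<bullet> p = 1" "p' \<bullet> p' = 1" using assms by (simp_all add: norm_eq_1)
  have NN: "N \<bullet> N = 1" using norm_cross[of p p'] assms by (simp add: N_def power2_norm_eq_inner)
  have o: "p \<bullet> N = 0" "N \<bullet> p = 0" "p' \<bullet> N = 0" "N \<bullet> p' = 0" "p' \<bullet> p = 0"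
    using assms by (simp_all add: N_def dot_cross_self inner_commute)
  define r where "r = x - (x \<bullet> p) *\<^sub>R p - (x \<bullet> p') *\<^sub>R p' - (x \<bullet> N) *\<^sub>R N"
  have "r \<bullet> p = 0" "r \<bullet> p' = 0" "r \<bullet> N = 0"
    by (simp_all add: r_def inner_diff_left e o assms(3) NN)
  then have "r = 0" using norm_and_cross_eq_0[of r N] NN by (auto simp: N_def Lagrange)
  moreover have "x = (x \<bullet> p) *\<^sub>R p + (x \<bullet> p') *\<^sub>R p' + (x \<bullet> N) *\<^sub>R N + r" by (simp add: r_def)
  ultimately have "x = (x \<bullet> p) *\<^sub>R p + (x \<bullet> p') *\<^sub>R p' + (x \<bullet> N) *\<^sub>R N" by simp
  then have "x \<bullet> y = ((x \<bullet> p) *\<^sub>R p + (x \<bullet> p') *\<^sub>R p' + (x \<bullet> N) *\<^sub>R N) \<bullet> y" by simp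
  also have "\<dots> = (x \<bullet> p) * (y \<bullet> p) + (x \<bullet> p') * (y \<bullet> p') + (x \<bullet> N) * (y \<bullet> N)"
    by (simp add: inner_add_left inner_commute[of p y] inner_commute[of p' y] inner_commute[of N y])
  moreover have "u \<bullet> N = - (p' \<bullet> cross3 p u)" for u by (simp add: N_def cross3_simps)
  ultimately show ?thesis by simp
qed

lemma tangent_part_inner:
  assumes "norm p = 1"
  shows "tangent_part p x \<bullet> tangent_part p y = x \<bullet> y - (x \<bullet> p) * (y \<bullet> p)"
proof -
  have "p \<bullet> p = 1" using assms by (simp add: norm_eq_1)
  then show ?thesis
    by (simp add: tangent_part_def inner_diff_left inner_diff_right inner_commute[of p y])
qed

text \<open>The orders of the two points \<open>x\<close>, \<open>y\<close> shared by two rings, about the two centres, determine on which side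
  of the line of centres each point lies. Here \<open>\<sigma>\<close>, \<open>\<tau>\<close> are the sides of \<open>x\<close> and \<open>y\<close>, \<open>C\<close>, \<open>C'\<close> the cosines of the
  inner radii, \<open>K = sin R sin R'\<close> and \<open>L = q sin r sin r'\<close>. A ring that is a great circle contributes only the
  degenerate case of the order, that the two points are separated by the line of centres; two such
  rings would leave a reflection undetermined.\<close>

lemma side_signs:
  fixes \<sigma> \<tau> C C' :: real
  assumes "\<sigma> = 1 \<or> \<sigma> = -1" "\<tau> = 1 \<or> \<tau> = -1" "0 < L" "L < K"
    and "0 < C' \<Longrightarrow> \<tau> * L \<le> \<sigma> * K" "0 < C \<Longrightarrow> \<tau> * K \<le> \<sigma> * L"
    and "C = 0 \<or> C' = 0 \<Longrightarrow> \<sigma> * \<tau> < 0" "0 < C \<or> 0 < C'" "0 \<le> C" "0 \<le> C'"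
  shows "\<sigma> = 1 \<and> \<tau> = -1"
proof (cases "0 < C'")
  case True
  then have "\<sigma> = 1" using assms(1-5) by auto
  show ?thesis
  proof (cases "0 < C")
    case True
    then show ?thesis using assms(2-4,6) \<open>\<sigma> = 1\<close> by auto
  next
    case False
    then have "C = 0" using assms(9) by linarith
    then have "\<sigma> * \<tau> < 0" using assms(7) by blast
    then show ?thesis using assms(2) \<open>\<sigma> = 1\<close> by auto
  qed
next
  case False
  then have "C' = 0" "0 < C" using assms by auto
  then show ?thesis using assms(1-4,6,7) by auto
qed

text \<open>The signs \<open>\<sigma>\<close> and \<open>\<tau>\<close> record the sides of the line
  of centres on which \<open>x\<close> and \<open>y\<close> lie. By \<open>triple_gram\<close> each
  order becomes an inequality between them; if the cosines of one ring vanish, one inequality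
  becomes void and the second clause of \<open>ccw_about\<close> takes its place.\<close>

lemma ring_pair:
  fixes p p' x y :: "real^3"
  assumes u: "norm p = 1" "norm p' = 1" "norm x = 1" "norm y = 1"
    and in_p: "p \<bullet> x = a" "p \<bullet> y = b" and in_p': "p' \<bullet> x = a'" "p' \<bullet> y = b'"
    and D: "p \<bullet> p' = a * a'" "p \<bullet> p' = b * b'"
    and s: "0 < s" "0 < s'" "0 < t" "0 < t'" "a\<^sup>2 + s\<^sup>2 = 1" "a'\<^sup>2 + s'\<^sup>2 = 1" "b\<^sup>2 + t\<^sup>2 = 1" "b'\<^sup>2 + t'\<^sup>2 = 1"
    and order: "ccw_about p x y" "ccw_about p' y x"
  obtains \<sigma> \<tau> where "\<sigma> = 1 \<or> \<sigma> = -1" "\<tau> = 1 \<or> \<tau> = -1"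
    "p' = a' *\<^sub>R x + (\<sigma> * (s' / s)) *\<^sub>R cross3 p x" "p' = b' *\<^sub>R y + (\<tau> * (t' / t)) *\<^sub>R cross3 p y"
    "\<tau> * (t' * a' * s) \<le> \<sigma> * (s' * b' * t)" "\<tau> * (t * a * s') \<le> \<sigma> * (s * b * t')"
    "(a = 0 \<and> b = 0) \<or> (a' = 0 \<and> b' = 0) \<Longrightarrow> \<sigma> * \<tau> < 0"
proof -
  define n where "n = p' \<bullet> cross3 p x"
  define m where "m = p' \<bullet> cross3 p y"
  have sq: "1 - a\<^sup>2 = s\<^sup>2" "1 - a'\<^sup>2 = s'\<^sup>2" "1 - b\<^sup>2 = t\<^sup>2" "1 - b'\<^sup>2 = t'\<^sup>2" using s by auto
  have ne: "(p \<bullet> x)\<^sup>2 \<noteq> 1" "(p \<bullet> y)\<^sup>2 \<noteq> 1" using s in_p sq by auto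
  have D': "p \<bullet> p' = (p \<bullet> x) * (p' \<bullet> x)" "p \<bullet> p' = (p \<bullet> y) * (p' \<bullet> y)" using D in_p in_p' by auto
  note Rx = right_triangle[OF u(1-3) D'(1) ne(1)] and Ry = right_triangle[OF u(1,2,4) D'(2) ne(2)]
  have n2: "n\<^sup>2 = (s * s')\<^sup>2" "m\<^sup>2 = (t * t')\<^sup>2"
    using Rx(2) Ry(2) unfolding in_p in_p' sq n_def m_def by (simp_all add: power_mult_distrib)
  have "n = s * s' \<or> n = - (s * s')" "m = t * t' \<or> m = - (t * t')"
    using n2 by (simp_all add: power2_eq_iff)
  then obtain \<sigma> \<tau> where st: "\<sigma> = 1 \<or> \<sigma> = -1" "\<tau> = 1 \<or> \<tau> = -1" "n = \<sigma> * (s * s')" "m = \<tau> * (t * t')"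
    by (metis mult_1 mult_minus1)
  have D1: "1 - (p \<bullet> p')\<^sup>2 > 0"
  proof -
    have "a\<^sup>2 < 1" "a'\<^sup>2 \<le> 1" using s zero_less_power[of s 2] zero_le_power2[of s'] by linarith+
    then have "a\<^sup>2 * a'\<^sup>2 \<le> a\<^sup>2" by (simp add: mult_left_le)
    then show ?thesis using \<open>a\<^sup>2 < 1\<close> unfolding D(1) by (simp add: power_mult_distrib)
  qed
  have g1: "(1 - (p \<bullet> p')\<^sup>2) * (p \<bullet> cross3 x y) = n * (b' * t\<^sup>2) - m * (a' * s\<^sup>2)"
  proof -
    have "b' - (b * b') * b = b' * t\<^sup>2" "a' - (a * a') * a = a' * s\<^sup>2"
      unfolding sq[symmetric] by (simp_all add: algebra_simps power2_eq_square)
    then show ?thesis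
      using triple_gram[OF u(1,2), of x y] D in_p in_p'
      by (simp add: n_def m_def inner_commute)
  qed
  have g2: "(1 - (p \<bullet> p')\<^sup>2) * (p' \<bullet> cross3 y x) = n * (b * t'\<^sup>2) - m * (a * s'\<^sup>2)"
  proof -
    have "b - (b * b') * b' = b * t'\<^sup>2" "a - (a * a') * a' = a * s'\<^sup>2"
      unfolding sq[symmetric] by (simp_all add: algebra_simps power2_eq_square)
    then show ?thesis
      using triple_gram[OF u(2,1), of y x] D in_p in_p'
      by (simp add: n_def m_def inner_commute triple_antisym[of p p'])
  qed
  have o: "0 \<le> p \<bullet> cross3 x y" "0 \<le> p' \<bullet> cross3 y x" using order by (auto simp: ccw_about_def)
  have i1: "0 \<le> n * (b' * t\<^sup>2) - m * (a' * s\<^sup>2)" using g1 o(1) D1 by (metis mult_nonneg_nonneg less_imp_le)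
  have i2: "0 \<le> n * (b * t'\<^sup>2) - m * (a * s'\<^sup>2)" using g2 o(2) D1 by (metis mult_nonneg_nonneg less_imp_le)
  have pos: "0 \<le> X" if "0 \<le> c * X" "0 < c" for c X :: real
    using that by (metis mult_pos_neg not_le)
  show thesis
  proof (rule that[OF st(1,2)])
    show "p' = a' *\<^sub>R x + (\<sigma> * (s' / s)) *\<^sub>R cross3 p x"
      using Rx(1) unfolding in_p in_p' sq n_def[symmetric] st(3) using s by (simp add: power2_eq_square)
    show "p' = b' *\<^sub>R y + (\<tau> * (t' / t)) *\<^sub>R cross3 p y"
      using Ry(1) unfolding in_p in_p' sq m_def[symmetric] st(4) using s by (simp add: power2_eq_square)
    have "0 \<le> (s * t) * (\<sigma> * (s' * b' * t) - \<tau> * (t' * a' * s))"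
      using i1 unfolding st(3,4) by (simp add: algebra_simps power2_eq_square)
    from pos[OF this] show "\<tau> * (t' * a' * s) \<le> \<sigma> * (s' * b' * t)" using s by simp
    have "0 \<le> (s' * t') * (\<sigma> * (s * b * t') - \<tau> * (t * a * s'))"
      using i2 unfolding st(3,4) by (simp add: algebra_simps power2_eq_square)
    from pos[OF this] show "\<tau> * (t * a * s') \<le> \<sigma> * (s * b * t')" using s by simp
    assume z: "(a = 0 \<and> b = 0) \<or> (a' = 0 \<and> b' = 0)"
    then have D0: "p \<bullet> p' = 0" using D by auto
    have xy: "x \<bullet> y = a * b + a' * b' + n * m"
      using inner_orthonormal[OF u(1,2) D0, of x y] in_p in_p' by (simp add: inner_commute n_def m_def)
    have "n * m < 0"
      using z
    proof
      assume z: "a = 0 \<and> b = 0"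
      then have "p' \<bullet> cross3 y x = 0" using g2 D1 by simp
      then have "tangent_part p' y \<bullet> tangent_part p' x < 0" using order(2) by (auto simp: ccw_about_def)
      then show ?thesis
        using xy z in_p' unfolding tangent_part_inner[OF u(2)] by (simp add: inner_commute)
    next
      assume z: "a' = 0 \<and> b' = 0"
      then have "p \<bullet> cross3 x y = 0" using g1 D1 by simp
      then have "tangent_part p x \<bullet> tangent_part p y < 0" using order(1) by (auto simp: ccw_about_def)
      then show ?thesis
        using xy z in_p unfolding tangent_part_inner[OF u(1)] by (simp add: inner_commute)
    qed
    then have "(s * s' * (t * t')) * (\<sigma> * \<tau>) < 0" unfolding st(3,4) by (simp add: mult_ac)
    then show "\<sigma> * \<tau> < 0" using pos[of "s * s' * (t * t')" "\<sigma> * \<tau>"] s by (meson mult_pos_pos mult_nonneg_nonneg not_le less_imp_le)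
  qed
qed

lemma ccw_quad_edges:
  assumes "ccw_quad Q v b v' b'"
  shows "h_edge Q v b \<and> v_edge Q v b' \<and> v_edge Q v' b \<and> h_edge Q v' b' \<or>
    v_edge Q v b \<and> h_edge Q v b' \<and> h_edge Q v' b \<and> v_edge Q v' b'"
    and "ccw_quad Q v' b' v b"
    and "v \<in> white Q \<Longrightarrow> v' \<in> white Q \<and> b \<in> black Q \<and> b' \<in> black Q \<and> (v \<in> s_verts Q \<or> v' \<in> s_verts Q)"
proof -
  obtain i j where Q: "(i, j) \<in> Q" and c:
    "(v, b, v', b') = ((i, j), (i + 1, j), (i + 1, j + 1), (i, j + 1)) \<or>
     (v, b, v', b') = ((i + 1, j), (i + 1, j + 1), (i, j + 1), (i, j)) \<or>
     (v, b, v', b') = ((i + 1, j + 1), (i, j + 1), (i, j), (i + 1, j)) \<or>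
     (v, b, v', b') = ((i, j + 1), (i, j), (i + 1, j), (i + 1, j + 1))"
    using assms unfolding ccw_quad_def Let_def by auto
  show "h_edge Q v b \<and> v_edge Q v b' \<and> v_edge Q v' b \<and> h_edge Q v' b' \<or>
    v_edge Q v b \<and> h_edge Q v b' \<and> h_edge Q v' b \<and> v_edge Q v' b'"
    using c Q by (elim disjE) (simp_all add: h_edge_iff v_edge_iff)
  show "ccw_quad Q v' b' v b"
    using c Q unfolding ccw_quad_def Let_def by (intro bexI[of _ "(i, j)"]) auto
  have V: "(i, j) \<in> verts Q" "(i + 1, j) \<in> verts Q" "(i, j + 1) \<in> verts Q" "(i + 1, j + 1) \<in> verts Q"
    using Q by (simp_all add: mem_verts)
  show "v' \<in> white Q \<and> b \<in> black Q \<and> b' \<in> black Q \<and> (v \<in> s_verts Q \<or> v' \<in> s_verts Q)" if "v \<in> white Q"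
    using c that V unfolding white_def black_def s_verts_def c_verts_def
    by (elim disjE) auto
qed

text \<open>Positive inner radii make the points of every ring counterclockwise. The orders about
  the two centres of a square then fix the sides, because \<open>L < K\<close> strictly for
  \<open>q < 1\<close> and the ring of the s-vertex is not a great circle.\<close>

lemma ring_pattern_config:
  assumes graph: "s_quad_graph Q" and P: "ring_pattern_on Q q P" and "q < 1"
    and pos: "\<And>v. v \<in> white Q \<Longrightarrow> 0 < rad_in P v"
    and s_pos: "\<And>v. v \<in> s_verts Q \<Longrightarrow> 0 < cos (rad_in P v)"
  shows "ring_config Q q (centre P) (pt P) (\<lambda>v. cos (rad_in P v)) (\<lambda>v. sin (rad_in P v)) (\<lambda>v. sin (rad_out P v))"
proof -
  define C where "C = (\<lambda>v. cos (rad_in P v))"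
  define S where "S = (\<lambda>v. sin (rad_in P v))"
  define S' where "S' = (\<lambda>v. sin (rad_out P v))"
  have q: "0 < q" "q \<le> 1" using P by (auto simp: ring_pattern_on_def)
  have w: "norm (centre P v) = 1 \<and> 0 < S v \<and> 0 < S' v \<and> (C v)\<^sup>2 + (S v)\<^sup>2 = 1 \<and> q\<^sup>2 * (C v)\<^sup>2 + (S' v)\<^sup>2 = 1
      \<and> 0 \<le> C v \<and> S v \<le> S' v \<and> cos (rad_out P v) = q * C v" if v: "v \<in> white Q" for v
  proof -
    have r: "norm (centre P v) = 1" "0 < rad_out P v" "rad_out P v \<le> pi / 2" "\<bar>rad_in P v\<bar> \<le> rad_out P v"
      "q * cos (rad_in P v) = cos (rad_out P v)"
      using P v unfolding ring_pattern_on_def by blast+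
    have i: "0 < rad_in P v" "rad_in P v \<le> rad_out P v" using pos[OF v] r(4) by auto
    have "0 < S v" "0 < S' v" using i r pi_gt_zero unfolding S_def S'_def by (auto intro!: sin_gt_zero)
    moreover have "S v \<le> S' v" unfolding S_def S'_def using i r(3) by (intro sin_monotone_2pi_le) auto
    moreover have "0 \<le> C v" unfolding C_def using i r(3) by (intro cos_ge_zero) auto
    moreover have "q\<^sup>2 * (C v)\<^sup>2 = (cos (rad_out P v))\<^sup>2" unfolding C_def r(5)[symmetric] by (simp add: power_mult_distrib)
    ultimately show ?thesis using r unfolding C_def S_def S'_def by simp
  qed
  have t: "norm (pt P b) = 1 \<and> centre P v \<bullet> pt P b = ring_cos q C v b"
    if "v \<in> white Q" "b \<in> black Q" "h_edge Q v b \<or> v_edge Q v b" for v b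
  proof -
    have *: "h_edge Q v b \<Longrightarrow> on_circle (centre P v) (rad_in P v) (pt P b)"
      "v_edge Q v b \<Longrightarrow> on_circle (centre P v) (rad_out P v) (pt P b)"
      using P that(1,2) unfolding ring_pattern_on_def by blast+
    from that(3) show ?thesis
    proof
      assume h: "h_edge Q v b"
      then have "snd v = snd b" by (simp add: h_edge_def)
      then show ?thesis using *(1)[OF h] by (simp add: on_circle_def ring_cos_def C_def inner_commute)
    next
      assume h: "v_edge Q v b"
      then have "snd v \<noteq> snd b" by (auto simp: v_edge_def)
      then show ?thesis using *(2)[OF h] w[OF that(1)] by (simp add: on_circle_def ring_cos_def inner_commute)
    qed
  qed
  have "ring_config Q q (centre P) (pt P) C S S'"
  proof
    show "s_quad_graph Q" "0 < q" "q \<le> 1" by fact+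
    show "norm (centre P v) = 1 \<and> 0 < S v \<and> 0 < S' v \<and> (C v)\<^sup>2 + (S v)\<^sup>2 = 1 \<and> q\<^sup>2 * (C v)\<^sup>2 + (S' v)\<^sup>2 = 1"
      if "v \<in> white Q" for v using w[OF that] by blast
    show "0 < C v" if "v \<in> s_verts Q" for v using s_pos[OF that] by (simp add: C_def)
    fix v b v' b' assume v: "v \<in> white Q" and Q: "ccw_quad Q v b v' b'"
    note e = ccw_quad_edges(1)[OF Q] and Q' = ccw_quad_edges(2)[OF Q]
    have v': "v' \<in> white Q" and bb: "b \<in> black Q" "b' \<in> black Q" and sv: "v \<in> s_verts Q \<or> v' \<in> s_verts Q"
      using ccw_quad_edges(3)[OF Q v] by auto
    note wv = w[OF v] and wv' = w[OF v']
    have t1: "norm (pt P b) = 1" "centre P v \<bullet> pt P b = ring_cos q C v b" using t[OF v bb(1)] e by auto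
    have t2: "norm (pt P b') = 1" "centre P v \<bullet> pt P b' = ring_cos q C v b'" using t[OF v bb(2)] e by auto
    have t3: "centre P v' \<bullet> pt P b = ring_cos q C v' b" using t[OF v' bb(1)] e by auto
    have t4: "centre P v' \<bullet> pt P b' = ring_cos q C v' b'" using t[OF v' bb(2)] e by auto
    have ord: "ccw_about (centre P v) (pt P b) (pt P b')" "ccw_about (centre P v') (pt P b') (pt P b)"
      using P pos[OF v] pos[OF v'] v v' Q Q' unfolding ring_pattern_on_def by blast+
    have "circles_orthogonal (centre P v) (rad_out P v) (centre P v') (rad_in P v')"
      using P v Q unfolding ring_pattern_on_def by blast
    from circles_orthogonal_inner[OF this] have D: "centre P v \<bullet> centre P v' = q * C v * C v'"
      using wv by (simp add: C_def)
    define K L where "K = S' v * S' v'" and "L = q * (S v * S v')"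
    have "L < S v * S v'" using \<open>q < 1\<close> wv wv' by (simp add: L_def)
    also have "\<dots> \<le> K" unfolding K_def using wv wv' by (intro mult_mono) auto
    finally have KL: "0 < L" "L < K" using q wv wv' by (auto simp: L_def)
    have CC: "0 < C v \<or> 0 < C v'" using sv s_pos unfolding C_def by blast
    have C0: "0 \<le> C v" "0 \<le> C v'" using wv wv' by auto
    have "centre P v' = ring_cos q C v' b *\<^sub>R pt P b + (ring_sin S S' v' b / ring_sin S S' v b) *\<^sub>R cross3 (centre P v) (pt P b) \<and>
      centre P v' = ring_cos q C v' b' *\<^sub>R pt P b' - (ring_sin S S' v' b' / ring_sin S S' v b') *\<^sub>R cross3 (centre P v) (pt P b')"
    \<comment> \<open>Which of the two points lies on the inner circle of \<open>v\<close> depends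
      on the position of \<open>v\<close> in the square; the roles in \<open>side_signs\<close> are
      exchanged accordingly.\<close>
    proof (rule disjE[OF e])
      assume e: "h_edge Q v b \<and> v_edge Q v b' \<and> v_edge Q v' b \<and> h_edge Q v' b'"
      then have "snd v = snd b" "snd v \<noteq> snd b'" "snd v' \<noteq> snd b" "snd v' = snd b'"
        by (auto simp: h_edge_def v_edge_def)
      then have rc: "ring_cos q C v b = C v" "ring_cos q C v b' = q * C v" "ring_cos q C v' b = q * C v'" "ring_cos q C v' b' = C v'"
        and rs: "ring_sin S S' v b = S v" "ring_sin S S' v b' = S' v" "ring_sin S S' v' b = S' v'" "ring_sin S S' v' b' = S v'"
        by (simp_all add: ring_cos_def ring_sin_def)
      obtain \<sigma> \<tau> where st: "\<sigma> = 1 \<or> \<sigma> = -1" "\<tau> = 1 \<or> \<tau> = -1"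
        "centre P v' = (q * C v') *\<^sub>R pt P b + (\<sigma> * (S' v' / S v)) *\<^sub>R cross3 (centre P v) (pt P b)"
        "centre P v' = C v' *\<^sub>R pt P b' + (\<tau> * (S v' / S' v)) *\<^sub>R cross3 (centre P v) (pt P b')"
        "\<tau> * (S v' * (q * C v') * S v) \<le> \<sigma> * (S' v' * C v' * S' v)" "\<tau> * (S' v * C v * S' v') \<le> \<sigma> * (S v * (q * C v) * S v')"
        "(C v = 0 \<and> q * C v = 0) \<or> (q * C v' = 0 \<and> C v' = 0) \<Longrightarrow> \<sigma> * \<tau> < 0"
        by (rule ring_pair[of "centre P v" "centre P v'" "pt P b" "pt P b'" "C v" "q * C v" "q * C v'" "C v'" "S v" "S' v'" "S' v" "S v'"])
           (use wv wv' t1 t2 t3 t4 D ord in \<open>simp_all add: rc power_mult_distrib\<close>)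
      have "\<sigma> = 1 \<and> \<tau> = -1"
      proof (rule side_signs[OF st(1,2) KL _ _ _ CC C0])
        show "\<tau> * L \<le> \<sigma> * K" if "0 < C v'"
        proof -
          have "C v' * (\<tau> * L) \<le> C v' * (\<sigma> * K)" using st(5) by (simp add: K_def L_def mult_ac)
          then show ?thesis using that by simp
        qed
        show "\<tau> * K \<le> \<sigma> * L" if "0 < C v"
        proof -
          have "C v * (\<tau> * K) \<le> C v * (\<sigma> * L)" using st(6) by (simp add: K_def L_def mult_ac)
          then show ?thesis using that by simp
        qed
        show "\<sigma> * \<tau> < 0" if "C v = 0 \<or> C v' = 0" using st(7) that by auto
      qed
      then show ?thesis using st(3,4) unfolding rc rs by simp
    next
      assume e: "v_edge Q v b \<and> h_edge Q v b' \<and> h_edge Q v' b \<and> v_edge Q v' b'"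
      then have "snd v \<noteq> snd b" "snd v = snd b'" "snd v' = snd b" "snd v' \<noteq> snd b'"
        by (auto simp: h_edge_def v_edge_def)
      then have rc: "ring_cos q C v b = q * C v" "ring_cos q C v b' = C v" "ring_cos q C v' b = C v'" "ring_cos q C v' b' = q * C v'"
        and rs: "ring_sin S S' v b = S' v" "ring_sin S S' v b' = S v" "ring_sin S S' v' b = S v'" "ring_sin S S' v' b' = S' v'"
        by (simp_all add: ring_cos_def ring_sin_def)
      obtain \<sigma> \<tau> where st: "\<sigma> = 1 \<or> \<sigma> = -1" "\<tau> = 1 \<or> \<tau> = -1"
        "centre P v' = C v' *\<^sub>R pt P b + (\<sigma> * (S v' / S' v)) *\<^sub>R cross3 (centre P v) (pt P b)"
        "centre P v' = (q * C v') *\<^sub>R pt P b' + (\<tau> * (S' v' / S v)) *\<^sub>R cross3 (centre P v) (pt P b')"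
        "\<tau> * (S' v' * C v' * S' v) \<le> \<sigma> * (S v' * (q * C v') * S v)" "\<tau> * (S v * (q * C v) * S v') \<le> \<sigma> * (S' v * C v * S' v')"
        "(q * C v = 0 \<and> C v = 0) \<or> (C v' = 0 \<and> q * C v' = 0) \<Longrightarrow> \<sigma> * \<tau> < 0"
        by (rule ring_pair[of "centre P v" "centre P v'" "pt P b" "pt P b'" "q * C v" "C v" "C v'" "q * C v'" "S' v" "S v'" "S v" "S' v'"])
           (use wv wv' t1 t2 t3 t4 D ord in \<open>simp_all add: rc power_mult_distrib\<close>)
      have "\<sigma> = 1 \<and> \<tau> = -1"
      proof (rule side_signs[OF st(1,2) KL, of "C v" "C v'"])
        show "\<tau> * L \<le> \<sigma> * K" if "0 < C v"
        proof -
          have "C v * (\<tau> * L) \<le> C v * (\<sigma> * K)" using st(6) by (simp add: K_def L_def mult_ac)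
          then show ?thesis using that by simp
        qed
        show "\<tau> * K \<le> \<sigma> * L" if "0 < C v'"
        proof -
          have "C v' * (\<tau> * K) \<le> C v' * (\<sigma> * L)" using st(5) by (simp add: K_def L_def mult_ac)
          then show ?thesis using that by simp
        qed
        show "\<sigma> * \<tau> < 0" if "C v' = 0 \<or> C v = 0" using st(7) that by auto
      qed (use CC C0 in auto)
      then show ?thesis using st(3,4) unfolding rc rs by simp
    qed
    then show "norm (pt P b) = 1 \<and> norm (pt P b') = 1 \<and> centre P v \<bullet> pt P b = ring_cos q C v b \<and> centre P v \<bullet> pt P b' = ring_cos q C v b' \<and>
      centre P v' = ring_cos q C v' b *\<^sub>R pt P b + (ring_sin S S' v' b / ring_sin S S' v b) *\<^sub>R cross3 (centre P v) (pt P b) \<and>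
      centre P v' = ring_cos q C v' b' *\<^sub>R pt P b' - (ring_sin S S' v' b' / ring_sin S S' v b') *\<^sub>R cross3 (centre P v) (pt P b')"
      using t1 t2 by blast
  qed
  then show ?thesis by (simp add: C_def S_def S'_def)
qed


section \<open>The limit of the ring patterns\<close>

text \<open>Solution of the Gram system in the basis \<open>p\<close>, \<open>p'\<close>,
  \<open>cross3 p p'\<close>; the denominator is the squared length of the cross product.\<close>

lemma triangle_apex:
  assumes "norm p = 1" "norm p' = 1" "p \<bullet> p' = a * a'" "x \<bullet> p = a" "x \<bullet> p' = a'" "(a * a')\<^sup>2 \<noteq> 1"
  shows "x = (1 / (1 - (a * a')\<^sup>2)) *\<^sub>R ((a * (1 - a'\<^sup>2)) *\<^sub>R p + (a' * (1 - a\<^sup>2)) *\<^sub>R p' - (p' \<bullet> cross3 p x) *\<^sub>R cross3 p p')"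
proof -
  define N where "N = cross3 p p'"
  define k where "k = 1 - (a * a')\<^sup>2"
  have k: "k \<noteq> 0" using assms(6) by (simp add: k_def)
  have e: "p \<bullet> p = 1" "p' \<bullet> p' = 1" using assms by (simp_all add: norm_eq_1)
  have NN: "N \<bullet> N = k" using norm_cross[of p p'] assms by (simp add: N_def k_def power2_norm_eq_inner)
  have o: "p \<bullet> N = 0" "N \<bullet> p = 0" "p' \<bullet> N = 0" "N \<bullet> p' = 0" "p' \<bullet> p = a * a'"
    using assms by (simp_all add: N_def dot_cross_self inner_commute)
  have xN: "x \<bullet> N = - (p' \<bullet> cross3 p x)" by (simp add: N_def cross3_simps)
  define u where "u = (a * (1 - a'\<^sup>2)) *\<^sub>R p + (a' * (1 - a\<^sup>2)) *\<^sub>R p' - (p' \<bullet> cross3 p x) *\<^sub>R N"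
  define r where "r = k *\<^sub>R x - u"
  have "r \<bullet> p = 0" "r \<bullet> p' = 0" "r \<bullet> N = 0"
    by (simp_all add: r_def u_def inner_diff_left inner_add_left e o assms(3-5) NN xN k_def algebra_simps power2_eq_square)
  then have "r = 0" using norm_and_cross_eq_0[of r N] NN k by (auto simp: N_def Lagrange)
  then have "u = k *\<^sub>R x" by (simp add: r_def)
  then have "(1 / k) *\<^sub>R u = x" using k by simp
  then show ?thesis by (simp add: u_def k_def N_def)
qed

text \<open>Recovers the points of a square from its two centres, the sign of the last term telling
  them apart, so that convergence can be passed from centres to points.\<close>

lemma (in ring_config) apex:
  assumes v: "v \<in> white Q" and Q: "ccw_quad Q v b v' b'" and v': "v' \<in> white Q"
    and ne: "(ring_cos q C v b * ring_cos q C v' b)\<^sup>2 \<noteq> 1" "(ring_cos q C v b' * ring_cos q C v' b')\<^sup>2 \<noteq> 1"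
  shows "t b = (1 / (1 - (ring_cos q C v b * ring_cos q C v' b)\<^sup>2)) *\<^sub>R
      ((ring_cos q C v b * (1 - (ring_cos q C v' b)\<^sup>2)) *\<^sub>R p v + (ring_cos q C v' b * (1 - (ring_cos q C v b)\<^sup>2)) *\<^sub>R p v'
        - (ring_sin S S' v b * ring_sin S S' v' b) *\<^sub>R cross3 (p v) (p v'))"
    and "t b' = (1 / (1 - (ring_cos q C v b' * ring_cos q C v' b')\<^sup>2)) *\<^sub>R
      ((ring_cos q C v b' * (1 - (ring_cos q C v' b')\<^sup>2)) *\<^sub>R p v + (ring_cos q C v' b' * (1 - (ring_cos q C v b')\<^sup>2)) *\<^sub>R p v'
        + (ring_sin S S' v b' * ring_sin S S' v' b') *\<^sub>R cross3 (p v) (p v'))"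
proof -
  have n: "norm (p v) = 1" "norm (p v') = 1" using white v v' by blast+
  have Q': "ccw_quad Q v' b' v b" by (rule ccw_quad_edges(2)[OF Q])
  have gen: "t u = (1 / (1 - (ring_cos q C v u * ring_cos q C v' u)\<^sup>2)) *\<^sub>R
      ((ring_cos q C v u * (1 - (ring_cos q C v' u)\<^sup>2)) *\<^sub>R p v + (ring_cos q C v' u * (1 - (ring_cos q C v u)\<^sup>2)) *\<^sub>R p v'
        - (k * (ring_sin S S' v u * ring_sin S S' v' u)) *\<^sub>R cross3 (p v) (p v'))"
    if t: "norm (t u) = 1" "p v \<bullet> t u = ring_cos q C v u" "p v' \<bullet> t u = ring_cos q C v' u"
      "p v' = ring_cos q C v' u *\<^sub>R t u + (k * (ring_sin S S' v' u / ring_sin S S' v u)) *\<^sub>R cross3 (p v) (t u)"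
      "(ring_cos q C v u * ring_cos q C v' u)\<^sup>2 \<noteq> 1" for u k
  proof -
    note cs = ring_cos_sin[OF v, of u]
    have cc: "cross3 (p v) (t u) \<bullet> cross3 (p v) (t u) = (ring_sin S S' v u)\<^sup>2"
      using norm_cross[of "p v" "t u"] n t cs by (simp add: power2_norm_eq_inner)
    have "p v' \<bullet> cross3 (p v) (t u) = k * (ring_sin S S' v' u / ring_sin S S' v u) * (ring_sin S S' v u)\<^sup>2"
      by (subst t(4)) (simp add: inner_add_left dot_cross_self cc)
    then have 1: "p v' \<bullet> cross3 (p v) (t u) = k * (ring_sin S S' v u * ring_sin S S' v' u)"
      using cs(2) by (simp add: power2_eq_square)
    have "p v \<bullet> p v' = ring_cos q C v u * ring_cos q C v' u"
      by (subst t(4)) (simp add: inner_add_right dot_cross_self t(2))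
    from triangle_apex[OF n this _ _ t(5), of "t u"] show ?thesis
      using t(2,3) unfolding 1 by (simp add: inner_commute)
  qed
  note a = quad[OF v Q] and a' = quad[OF v' Q']
  have A: "norm (t b) = 1" "norm (t b') = 1" "p v \<bullet> t b = ring_cos q C v b" "p v \<bullet> t b' = ring_cos q C v b'"
    "p v' \<bullet> t b = ring_cos q C v' b" "p v' \<bullet> t b' = ring_cos q C v' b'"
    "p v' = ring_cos q C v' b *\<^sub>R t b + (ring_sin S S' v' b / ring_sin S S' v b) *\<^sub>R cross3 (p v) (t b)"
    using a a' by blast+
  show "t b = (1 / (1 - (ring_cos q C v b * ring_cos q C v' b)\<^sup>2)) *\<^sub>R
      ((ring_cos q C v b * (1 - (ring_cos q C v' b)\<^sup>2)) *\<^sub>R p v + (ring_cos q C v' b * (1 - (ring_cos q C v b)\<^sup>2)) *\<^sub>R p v'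
        - (ring_sin S S' v b * ring_sin S S' v' b) *\<^sub>R cross3 (p v) (p v'))"
    using gen[OF A(1,3,5) _ ne(1), of 1] A(7) by simp
  have "p v' = ring_cos q C v' b' *\<^sub>R t b' + (-1 * (ring_sin S S' v' b' / ring_sin S S' v b')) *\<^sub>R cross3 (p v) (t b')"
  proof -
    have "p v' = ring_cos q C v' b' *\<^sub>R t b' - (ring_sin S S' v' b' / ring_sin S S' v b') *\<^sub>R cross3 (p v) (t b')"
      using a by blast
    then show ?thesis by simp
  qed
  then show "t b' = (1 / (1 - (ring_cos q C v b' * ring_cos q C v' b')\<^sup>2)) *\<^sub>R
      ((ring_cos q C v b' * (1 - (ring_cos q C v' b')\<^sup>2)) *\<^sub>R p v + (ring_cos q C v' b' * (1 - (ring_cos q C v b')\<^sup>2)) *\<^sub>R p v'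
        + (ring_sin S S' v b' * ring_sin S S' v' b') *\<^sub>R cross3 (p v) (p v'))"
    using gen[OF A(2,4,6) _ ne(2), of "-1"] by simp
qed

section \<open>Convergence of the whole pattern from one edge\<close>

definition convergent_at :: "(real \<Rightarrow> 'a::topological_space) \<Rightarrow> bool" where
  "convergent_at f \<longleftrightarrow> (\<exists>l. (f \<longlongrightarrow> l) (at_right 0))"

lemma convergent_at_cong:
  assumes "\<forall>\<^sub>F x in at_right 0. f x = g x" "convergent_at g"
  shows "convergent_at f"
proof -
  obtain l where "(g \<longlongrightarrow> l) (at_right 0)" using assms(2) by (auto simp: convergent_at_def)
  then show ?thesis using tendsto_cong[OF assms(1), of l] unfolding convergent_at_def by blast
qed

lemma white_corner_quad:
  assumes "a \<in> Q" "v \<in> corners a"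
  obtains b v' b' where "ccw_quad Q v b v' b'" "corners a = {v, b, v', b'}"
proof -
  obtain i j where a: "a = (i, j)" by (cases a)
  have c: "corners a = {(i, j), (i + 1, j), (i + 1, j + 1), (i, j + 1)}"
    by (auto simp: a corners_def)
  note Q = ccw_quadI[OF assms(1)[unfolded a]]
  consider "v = (i, j)" | "v = (i + 1, j)" | "v = (i + 1, j + 1)" | "v = (i, j + 1)"
    using assms(2) unfolding c by blast
  then show thesis
  proof cases
    case 1
    show ?thesis by (rule that[OF Q(1)[folded 1]]) (unfold c 1, blast)
  next
    case 2
    show ?thesis by (rule that[OF Q(2)[folded 2]]) (unfold c 2, blast)
  next
    case 3
    show ?thesis by (rule that[OF Q(3)[folded 3]]) (unfold c 3, blast)
  next
    case 4
    show ?thesis by (rule that[OF Q(4)[folded 4]]) (unfold c 4, blast)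
  qed
qed

text \<open>Both sines have the same limit, so the rings become circles. The radii are assumed to
  converge everywhere but the positions only at one edge (\<open>flag\<close>), since the radii
  leave a rotation free.\<close>

locale ring_limit =
  fixes Q :: "(int \<times> int) set" and p t :: "real \<Rightarrow> vertex \<Rightarrow> real^3" and C S S' :: "real \<Rightarrow> vertex \<Rightarrow> real"
    and C0 S0 :: "vertex \<Rightarrow> real"
  assumes graph: "s_quad_graph Q"
    and config: "\<forall>\<^sub>F \<epsilon> in at_right 0. ring_config Q (1 - \<epsilon>) (p \<epsilon>) (t \<epsilon>) (C \<epsilon>) (S \<epsilon>) (S' \<epsilon>)"
    and C: "v \<in> white Q \<Longrightarrow> ((\<lambda>\<epsilon>. C \<epsilon> v) \<longlongrightarrow> C0 v) (at_right 0)"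
    and S: "v \<in> white Q \<Longrightarrow> ((\<lambda>\<epsilon>. S \<epsilon> v) \<longlongrightarrow> S0 v) (at_right 0)"
    and S': "v \<in> white Q \<Longrightarrow> ((\<lambda>\<epsilon>. S' \<epsilon> v) \<longlongrightarrow> S0 v) (at_right 0)"
    and S0: "v \<in> white Q \<Longrightarrow> 0 < S0 v"
    and C0: "v \<in> s_verts Q \<Longrightarrow> 0 < C0 v"
    and flag: "\<exists>v\<in>white Q. \<exists>b\<in>black Q. (h_edge Q v b \<or> v_edge Q v b) \<and>
        convergent_at (\<lambda>\<epsilon>. p \<epsilon> v) \<and> convergent_at (\<lambda>\<epsilon>. t \<epsilon> b)"
begin

lemma q_lim: "((\<lambda>\<epsilon>::real. 1 - \<epsilon>) \<longlongrightarrow> 1) (at_right 0)"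
  using tendsto_diff[OF tendsto_const tendsto_ident_at, of 1 0 "{0<..}"] by simp

lemma CS0: "v \<in> white Q \<Longrightarrow> (C0 v)\<^sup>2 + (S0 v)\<^sup>2 = 1"
proof -
  assume v: "v \<in> white Q"
  have "((\<lambda>\<epsilon>. (C \<epsilon> v)\<^sup>2 + (S \<epsilon> v)\<^sup>2) \<longlongrightarrow> (C0 v)\<^sup>2 + (S0 v)\<^sup>2) (at_right 0)"
    by (intro tendsto_intros C S v)
  moreover have "\<forall>\<^sub>F \<epsilon> in at_right 0. (C \<epsilon> v)\<^sup>2 + (S \<epsilon> v)\<^sup>2 = 1"
    using config by eventually_elim (use v ring_config.white in blast)
  then have "((\<lambda>\<epsilon>. (C \<epsilon> v)\<^sup>2 + (S \<epsilon> v)\<^sup>2) \<longlongrightarrow> 1) (at_right 0)"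
    by (rule tendsto_eventually)
  ultimately show ?thesis using tendsto_unique trivial_limit_at_right_real by blast
qed

lemma ring_cos_lim: "v \<in> white Q \<Longrightarrow> ((\<lambda>\<epsilon>. ring_cos (1 - \<epsilon>) (C \<epsilon>) v b) \<longlongrightarrow> ring_cos 1 C0 v b) (at_right 0)"
  using C[of v] tendsto_mult[OF q_lim C[of v]] by (cases "snd v = snd b") (simp_all add: ring_cos_def)

lemma ring_sin_lim: "v \<in> white Q \<Longrightarrow> ((\<lambda>\<epsilon>. ring_sin (S \<epsilon>) (S' \<epsilon>) v b) \<longlongrightarrow> ring_sin S0 S0 v b) (at_right 0)"
  using S[of v] S'[of v] by (cases "snd v = snd b") (simp_all add: ring_sin_def)

lemma ring_sin_0: "v \<in> white Q \<Longrightarrow> ring_sin S0 S0 v b \<noteq> 0"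
  using S0[of v] by (simp add: ring_sin_def)

lemma ring_cos_0:
  assumes "v \<in> white Q" "v' \<in> white Q"
  shows "(ring_cos 1 C0 v b * ring_cos 1 C0 v' b)\<^sup>2 < 1"
proof -
  have "(C0 v)\<^sup>2 < 1" "(C0 v')\<^sup>2 \<le> 1"
    using CS0[OF assms(1)] CS0[OF assms(2)] S0[OF assms(1)] zero_less_power[of "S0 v" 2] zero_le_power2[of "S0 v'"]
    by linarith+
  then have "(C0 v)\<^sup>2 * (C0 v')\<^sup>2 < 1"
    using mult_left_le[of "(C0 v')\<^sup>2" "(C0 v)\<^sup>2"] by simp
  then show ?thesis by (simp add: ring_cos_def power_mult_distrib)
qed

abbreviation cp where "cp v \<equiv> convergent_at (\<lambda>\<epsilon>. p \<epsilon> v)"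
abbreviation ct where "ct b \<equiv> convergent_at (\<lambda>\<epsilon>. t \<epsilon> b)"

lemma center_propagates:
  assumes v: "v \<in> white Q" and Q: "ccw_quad Q v b v' b'" and "cp v"
  shows "ct b \<Longrightarrow> cp v'" "ct b' \<Longrightarrow> cp v'"
proof -
  have v': "v' \<in> white Q" using ccw_quad_edges(3)[OF Q v] by blast
  obtain lp where lp: "((\<lambda>\<epsilon>. p \<epsilon> v) \<longlongrightarrow> lp) (at_right 0)" using assms by (auto simp: convergent_at_def)
  have eq: "\<forall>\<^sub>F \<epsilon> in at_right 0. p \<epsilon> v' = ring_cos (1 - \<epsilon>) (C \<epsilon>) v' b *\<^sub>R t \<epsilon> b
       + (ring_sin (S \<epsilon>) (S' \<epsilon>) v' b / ring_sin (S \<epsilon>) (S' \<epsilon>) v b) *\<^sub>R cross3 (p \<epsilon> v) (t \<epsilon> b)"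
    "\<forall>\<^sub>F \<epsilon> in at_right 0. p \<epsilon> v' = ring_cos (1 - \<epsilon>) (C \<epsilon>) v' b' *\<^sub>R t \<epsilon> b'
       - (ring_sin (S \<epsilon>) (S' \<epsilon>) v' b' / ring_sin (S \<epsilon>) (S' \<epsilon>) v b') *\<^sub>R cross3 (p \<epsilon> v) (t \<epsilon> b')"
    using config by (eventually_elim, use ring_config.quad[OF _ v Q] in blast)+
  note cr = bounded_bilinear.tendsto[OF bilinear_conv_bounded_bilinear[THEN iffD1, OF bilinear_cross]]
  show "cp v'" if ct: "ct b"
  proof -
    obtain lt where "((\<lambda>\<epsilon>. t \<epsilon> b) \<longlongrightarrow> lt) (at_right 0)" using ct by (auto simp: convergent_at_def)
    note lt = this
    have "convergent_at (\<lambda>\<epsilon>. ring_cos (1 - \<epsilon>) (C \<epsilon>) v' b *\<^sub>R t \<epsilon> b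
       + (ring_sin (S \<epsilon>) (S' \<epsilon>) v' b / ring_sin (S \<epsilon>) (S' \<epsilon>) v b) *\<^sub>R cross3 (p \<epsilon> v) (t \<epsilon> b))"
      unfolding convergent_at_def
      by (rule exI, (rule tendsto_add tendsto_scaleR tendsto_divide cr lt lp ring_cos_lim ring_sin_lim v v' ring_sin_0)+)
    then show ?thesis by (rule convergent_at_cong[OF eq(1)])
  qed
  show "cp v'" if ct: "ct b'"
  proof -
    obtain lt where "((\<lambda>\<epsilon>. t \<epsilon> b') \<longlongrightarrow> lt) (at_right 0)" using ct by (auto simp: convergent_at_def)
    note lt = this
    have "convergent_at (\<lambda>\<epsilon>. ring_cos (1 - \<epsilon>) (C \<epsilon>) v' b' *\<^sub>R t \<epsilon> b'
       - (ring_sin (S \<epsilon>) (S' \<epsilon>) v' b' / ring_sin (S \<epsilon>) (S' \<epsilon>) v b') *\<^sub>R cross3 (p \<epsilon> v) (t \<epsilon> b'))"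
      unfolding convergent_at_def
      by (rule exI, (rule tendsto_diff tendsto_scaleR tendsto_divide cr lt lp ring_cos_lim ring_sin_lim v v' ring_sin_0)+)
    then show ?thesis by (rule convergent_at_cong[OF eq(2)])
  qed
qed

lemma points_propagate:
  assumes v: "v \<in> white Q" and Q: "ccw_quad Q v b v' b'" and "cp v" "cp v'"
  shows "ct b" "ct b'"
proof -
  have v': "v' \<in> white Q" using ccw_quad_edges(3)[OF Q v] by blast
  obtain lp lp' where lp: "((\<lambda>\<epsilon>. p \<epsilon> v) \<longlongrightarrow> lp) (at_right 0)" "((\<lambda>\<epsilon>. p \<epsilon> v') \<longlongrightarrow> lp') (at_right 0)"
    using assms by (auto simp: convergent_at_def)
  note cr = bounded_bilinear.tendsto[OF bilinear_conv_bounded_bilinear[THEN iffD1, OF bilinear_cross]]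
  have ev: "\<forall>\<^sub>F \<epsilon> in at_right 0. (ring_cos (1 - \<epsilon>) (C \<epsilon>) v u * ring_cos (1 - \<epsilon>) (C \<epsilon>) v' u)\<^sup>2 < 1" for u
    by (rule order_tendstoD(2)[OF _ ring_cos_0[OF v v', of u]]) (intro tendsto_intros ring_cos_lim v v')
  have ne: "1 - (ring_cos 1 C0 v u * ring_cos 1 C0 v' u)\<^sup>2 \<noteq> 0" for u
    using ring_cos_0[OF v v', of u] by simp
  have eq: "\<forall>\<^sub>F \<epsilon> in at_right 0. t \<epsilon> b = (1 / (1 - (ring_cos (1 - \<epsilon>) (C \<epsilon>) v b * ring_cos (1 - \<epsilon>) (C \<epsilon>) v' b)\<^sup>2)) *\<^sub>R
      ((ring_cos (1 - \<epsilon>) (C \<epsilon>) v b * (1 - (ring_cos (1 - \<epsilon>) (C \<epsilon>) v' b)\<^sup>2)) *\<^sub>R p \<epsilon> v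
        + (ring_cos (1 - \<epsilon>) (C \<epsilon>) v' b * (1 - (ring_cos (1 - \<epsilon>) (C \<epsilon>) v b)\<^sup>2)) *\<^sub>R p \<epsilon> v'
        - (ring_sin (S \<epsilon>) (S' \<epsilon>) v b * ring_sin (S \<epsilon>) (S' \<epsilon>) v' b) *\<^sub>R cross3 (p \<epsilon> v) (p \<epsilon> v'))"
    using config ev[of b] ev[of b'] by eventually_elim (rule ring_config.apex(1)[OF _ v Q v'], auto)
  have eq': "\<forall>\<^sub>F \<epsilon> in at_right 0. t \<epsilon> b' = (1 / (1 - (ring_cos (1 - \<epsilon>) (C \<epsilon>) v b' * ring_cos (1 - \<epsilon>) (C \<epsilon>) v' b')\<^sup>2)) *\<^sub>R
      ((ring_cos (1 - \<epsilon>) (C \<epsilon>) v b' * (1 - (ring_cos (1 - \<epsilon>) (C \<epsilon>) v' b')\<^sup>2)) *\<^sub>R p \<epsilon> v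
        + (ring_cos (1 - \<epsilon>) (C \<epsilon>) v' b' * (1 - (ring_cos (1 - \<epsilon>) (C \<epsilon>) v b')\<^sup>2)) *\<^sub>R p \<epsilon> v'
        + (ring_sin (S \<epsilon>) (S' \<epsilon>) v b' * ring_sin (S \<epsilon>) (S' \<epsilon>) v' b') *\<^sub>R cross3 (p \<epsilon> v) (p \<epsilon> v'))"
    using config ev[of b] ev[of b'] by eventually_elim (rule ring_config.apex(2)[OF _ v Q v'], auto)
  show "ct b"
    by (rule convergent_at_cong[OF eq], unfold convergent_at_def)
       (rule exI, (rule tendsto_add tendsto_diff tendsto_scaleR tendsto_divide tendsto_mult tendsto_power tendsto_const
          cr lp ring_cos_lim ring_sin_lim v v' ne)+)
  show "ct b'"
    by (rule convergent_at_cong[OF eq'], unfold convergent_at_def)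
       (rule exI, (rule tendsto_add tendsto_diff tendsto_scaleR tendsto_divide tendsto_mult tendsto_power tendsto_const
          cr lp ring_cos_lim ring_sin_lim v v' ne)+)
qed

definition good :: "int \<times> int \<Rightarrow> bool" where
  "good a \<longleftrightarrow> (\<forall>u\<in>corners a. (u \<in> white Q \<longrightarrow> cp u) \<and> (u \<in> black Q \<longrightarrow> ct u))"

text \<open>A centre and an adjacent point first determine the opposite centre, and the two centres
  then determine both points.\<close>

lemma flag_good:
  assumes a: "a \<in> Q" and v: "v \<in> corners a" "v \<in> white Q" "cp v" and b: "b \<in> corners a" "b \<in> black Q" "ct b"
  shows "good a"
proof -
  obtain b1 v' b2 where Q: "ccw_quad Q v b1 v' b2" "corners a = {v, b1, v', b2}"
    by (rule white_corner_quad[OF a v(1)])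
  have w: "v' \<in> white Q" "b1 \<in> black Q" "b2 \<in> black Q" using ccw_quad_edges(3)[OF Q(1) v(2)] by auto
  have wb: "white Q \<inter> black Q = {}" by (auto simp: black_def)
  then have "b = b1 \<or> b = b2" using b v w unfolding Q(2) by blast
  then have "cp v'" using center_propagates[OF v(2) Q(1) v(3)] b by blast
  then have "cp v'" "ct b1" "ct b2" using points_propagate[OF v(2) Q(1) v(3)] by blast+
  then show ?thesis
    using v(2,3) w wb unfolding good_def Q(2) by auto
qed

text \<open>The ends of a common side have opposite colours, so they form a flag that can be handed
  on to the next square.\<close>

lemma shared_edge:
  assumes "cell_adj a b"
  obtains u w where "u \<in> corners a" "u \<in> corners b" "w \<in> corners a" "w \<in> corners b"
    "even (fst u + snd u)" "odd (fst w + snd w)"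
proof -
  obtain i j k l where ab: "a = (i, j)" "b = (k, l)" by (cases a, cases b)
  note goal = that
  have *: thesis if xy: "x \<in> corners a" "x \<in> corners b" "y \<in> corners a" "y \<in> corners b"
     "even (fst x + snd x) \<noteq> even (fst y + snd y)" for x y
  proof (cases "even (fst x + snd x)")
    case True
    then show ?thesis using xy(5) by (intro goal[OF xy(1-4)]) simp_all
  next
    case False
    then show ?thesis using xy(5) by (intro goal[OF xy(3,4,1,2)]) simp_all
  qed
  consider "k = i" "l = j + 1" | "k = i" "l = j - 1" | "l = j" "k = i + 1" | "l = j" "k = i - 1"
    using assms unfolding cell_adj_def ab by (auto simp: abs_if split: if_splits)
  then show thesis
  proof cases
    case 1 then show ?thesis by (intro *[of "(i, j + 1)" "(i + 1, j + 1)"]) (auto simp: ab mem_corners)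
  next
    case 2 then show ?thesis by (intro *[of "(i, j)" "(i + 1, j)"]) (auto simp: ab mem_corners)
  next
    case 3 then show ?thesis by (intro *[of "(i + 1, j)" "(i + 1, j + 1)"]) (auto simp: ab mem_corners)
  next
    case 4 then show ?thesis by (intro *[of "(i, j)" "(i, j + 1)"]) (auto simp: ab mem_corners)
  qed
qed

lemma corner_colour:
  assumes "a \<in> Q" "u \<in> corners a"
  shows "even (fst u + snd u) \<Longrightarrow> u \<in> white Q" "odd (fst u + snd u) \<Longrightarrow> u \<in> black Q"
proof -
  have "u \<in> verts Q" using assms by (auto simp: verts_def)
  then show "even (fst u + snd u) \<Longrightarrow> u \<in> white Q" "odd (fst u + snd u) \<Longrightarrow> u \<in> black Q"
    by (auto simp: white_def black_def s_verts_def c_verts_def)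
qed

lemma all_good:
  assumes "a \<in> Q"
  shows "good a"
proof -
  obtain v b where vb: "v \<in> white Q" "b \<in> black Q" "h_edge Q v b \<or> v_edge Q v b" "cp v" "ct b"
    using flag by blast
  then obtain a0 where a0: "a0 \<in> Q" "v \<in> corners a0" "b \<in> corners a0"
    by (auto simp: h_edge_def v_edge_def)
  have "linked Q a0 a" by (rule s_quad_graph_linked[OF graph a0(1) assms])
  then show ?thesis
    unfolding linked_def
  proof (induction rule: rtranclp_induct)
    case base
    show ?case by (rule flag_good[OF a0(1,2) vb(1,4) a0(3) vb(2,5)])
  next
    case (step c1 c2)
    then obtain u w where uw: "u \<in> corners c1" "u \<in> corners c2" "w \<in> corners c1" "w \<in> corners c2"
      "even (fst u + snd u)" "odd (fst w + snd w)"
      using shared_edge[of c1 c2] by blast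
    have c: "c1 \<in> Q" "c2 \<in> Q" using step.hyps by auto
    have "u \<in> white Q" "w \<in> black Q" using corner_colour c uw by blast+
    moreover have "cp u" "ct w" using step.IH uw calculation unfolding good_def by blast+
    ultimately show ?case using flag_good[OF c(2) uw(2) _ _ uw(4)] by blast
  qed
qed

lemma convergence:
  assumes "v \<in> white Q"
  shows "cp v"
proof -
  have "v \<in> verts Q" using assms by (auto simp: white_def s_verts_def c_verts_def)
  then obtain a where "a \<in> Q" "v \<in> corners a" by (auto simp: verts_def)
  then show ?thesis using all_good assms unfolding good_def by blast
qed

definition p0 :: "vertex \<Rightarrow> real^3" where "p0 v = Lim (at_right 0) (\<lambda>\<epsilon>. p \<epsilon> v)"
definition t0 :: "vertex \<Rightarrow> real^3" where "t0 b = Lim (at_right 0) (\<lambda>\<epsilon>. t \<epsilon> b)"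

lemma p_lim: "v \<in> white Q \<Longrightarrow> ((\<lambda>\<epsilon>. p \<epsilon> v) \<longlongrightarrow> p0 v) (at_right 0)"
  using convergence[of v] tendsto_Lim[OF trivial_limit_at_right_real, of "\<lambda>\<epsilon>. p \<epsilon> v"]
  by (auto simp: convergent_at_def p0_def)

lemma t_lim: "ct b \<Longrightarrow> ((\<lambda>\<epsilon>. t \<epsilon> b) \<longlongrightarrow> t0 b) (at_right 0)"
  using tendsto_Lim[OF trivial_limit_at_right_real, of "\<lambda>\<epsilon>. t \<epsilon> b"]
  by (auto simp: convergent_at_def t0_def)

lemma eq_lim:
  fixes f g :: "real \<Rightarrow> 'a::t2_space"
  assumes "(f \<longlongrightarrow> a) (at_right 0)" "(g \<longlongrightarrow> b) (at_right 0)" "\<forall>\<^sub>F \<epsilon> in at_right 0. f \<epsilon> = g \<epsilon>"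
  shows "a = b"
  using assms tendsto_cong[OF assms(3)] tendsto_unique[OF trivial_limit_at_right_real] by blast

text \<open>The conditions on the pattern are equations, which pass to the limit, apart from the
  positivity of cosines and sines, which is assumed of the limits themselves.\<close>

lemma limit_config: "ring_config Q 1 p0 t0 C0 S0 S0"
proof
  show "s_quad_graph Q" by (rule graph)
  show "(0::real) < 1" "(1::real) \<le> 1" by simp_all
  show "0 < C0 v" if "v \<in> s_verts Q" for v by (rule C0[OF that])
  have norm_lim: "norm l = 1" if "(f \<longlongrightarrow> l) (at_right 0)" "\<forall>\<^sub>F \<epsilon> in at_right 0. norm (f \<epsilon>) = 1" for f :: "real \<Rightarrow> real^3" and l
    by (rule eq_lim[OF tendsto_norm[OF that(1)] tendsto_const that(2)])
  show "norm (p0 v) = 1 \<and> 0 < S0 v \<and> 0 < S0 v \<and> (C0 v)\<^sup>2 + (S0 v)\<^sup>2 = 1 \<and> 1\<^sup>2 * (C0 v)\<^sup>2 + (S0 v)\<^sup>2 = 1"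
    if v: "v \<in> white Q" for v
  proof -
    have "\<forall>\<^sub>F \<epsilon> in at_right 0. norm (p \<epsilon> v) = 1"
      using config by eventually_elim (use v ring_config.white in blast)
    then have "norm (p0 v) = 1" by (rule norm_lim[OF p_lim[OF v]])
    then show ?thesis using S0[OF v] CS0[OF v] by simp
  qed
  fix v b v' b' assume v: "v \<in> white Q" and Q: "ccw_quad Q v b v' b'"
  have v': "v' \<in> white Q" and bb: "b \<in> black Q" "b' \<in> black Q" using ccw_quad_edges(3)[OF Q v] by blast+
  have tb: "((\<lambda>\<epsilon>. t \<epsilon> b) \<longlongrightarrow> t0 b) (at_right 0)" "((\<lambda>\<epsilon>. t \<epsilon> b') \<longlongrightarrow> t0 b') (at_right 0)"
    using points_propagate[OF v Q convergence[OF v] convergence[OF v']] t_lim by blast+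
  note cr = bounded_bilinear.tendsto[OF bilinear_conv_bounded_bilinear[THEN iffD1, OF bilinear_cross]]
  note ev = eventually_mono[OF config]
  have 1: "norm (t0 b) = 1" "norm (t0 b') = 1"
    by (rule norm_lim[OF tb(1)], rule ev, use ring_config.quad[OF _ v Q] in blast)
       (rule norm_lim[OF tb(2)], rule ev, use ring_config.quad[OF _ v Q] in blast)
  have 2: "p0 v \<bullet> t0 b = ring_cos 1 C0 v b" "p0 v \<bullet> t0 b' = ring_cos 1 C0 v b'"
    by (rule eq_lim[OF tendsto_inner[OF p_lim[OF v] tb(1)] ring_cos_lim[OF v]], rule ev, use ring_config.quad[OF _ v Q] in blast)
       (rule eq_lim[OF tendsto_inner[OF p_lim[OF v] tb(2)] ring_cos_lim[OF v]], rule ev, use ring_config.quad[OF _ v Q] in blast)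
  have 3: "p0 v' = ring_cos 1 C0 v' b *\<^sub>R t0 b + (ring_sin S0 S0 v' b / ring_sin S0 S0 v b) *\<^sub>R cross3 (p0 v) (t0 b)"
  proof (rule eq_lim[OF p_lim[OF v']])
    show "((\<lambda>\<epsilon>. ring_cos (1 - \<epsilon>) (C \<epsilon>) v' b *\<^sub>R t \<epsilon> b
       + (ring_sin (S \<epsilon>) (S' \<epsilon>) v' b / ring_sin (S \<epsilon>) (S' \<epsilon>) v b) *\<^sub>R cross3 (p \<epsilon> v) (t \<epsilon> b)) \<longlongrightarrow>
       ring_cos 1 C0 v' b *\<^sub>R t0 b + (ring_sin S0 S0 v' b / ring_sin S0 S0 v b) *\<^sub>R cross3 (p0 v) (t0 b)) (at_right 0)"
      by (intro tendsto_add tendsto_scaleR tendsto_divide cr p_lim tb ring_cos_lim ring_sin_lim v v' ring_sin_0)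
  qed (rule ev, use ring_config.quad[OF _ v Q] in blast)
  have 4: "p0 v' = ring_cos 1 C0 v' b' *\<^sub>R t0 b' - (ring_sin S0 S0 v' b' / ring_sin S0 S0 v b') *\<^sub>R cross3 (p0 v) (t0 b')"
  proof (rule eq_lim[OF p_lim[OF v']])
    show "((\<lambda>\<epsilon>. ring_cos (1 - \<epsilon>) (C \<epsilon>) v' b' *\<^sub>R t \<epsilon> b'
       - (ring_sin (S \<epsilon>) (S' \<epsilon>) v' b' / ring_sin (S \<epsilon>) (S' \<epsilon>) v b') *\<^sub>R cross3 (p \<epsilon> v) (t \<epsilon> b')) \<longlongrightarrow>
       ring_cos 1 C0 v' b' *\<^sub>R t0 b' - (ring_sin S0 S0 v' b' / ring_sin S0 S0 v b') *\<^sub>R cross3 (p0 v) (t0 b')) (at_right 0)"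
      by (intro tendsto_diff tendsto_scaleR tendsto_divide cr p_lim tb ring_cos_lim ring_sin_lim v v' ring_sin_0)
  qed (rule ev, use ring_config.quad[OF _ v Q] in blast)
  show "norm (t0 b) = 1 \<and> norm (t0 b') = 1 \<and> p0 v \<bullet> t0 b = ring_cos 1 C0 v b \<and> p0 v \<bullet> t0 b' = ring_cos 1 C0 v b' \<and>
      p0 v' = ring_cos 1 C0 v' b *\<^sub>R t0 b + (ring_sin S0 S0 v' b / ring_sin S0 S0 v b) *\<^sub>R cross3 (p0 v) (t0 b) \<and>
      p0 v' = ring_cos 1 C0 v' b' *\<^sub>R t0 b' - (ring_sin S0 S0 v' b' / ring_sin S0 S0 v b') *\<^sub>R cross3 (p0 v) (t0 b')"
    using 1 2 3 4 by blast
qed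

end


section \<open>The family of cmc pairs and its limit\<close>

context ring_limit
begin

text \<open>This and the following definitions repeat constants of \<open>ring_config\<close> as
  functions of \<open>\<epsilon>\<close>: that locale holds only for small
  \<open>\<epsilon>\<close>, while limits concern the whole family.\<close>

definition net_e :: "real \<Rightarrow> vertex \<Rightarrow> real^3" where
  "net_e \<epsilon> v = (1 / (sqrt (1 - \<epsilon>) * C \<epsilon> v)) *\<^sub>R p \<epsilon> v"

definition net_0 :: "vertex \<Rightarrow> real^3" where
  "net_0 v = (1 / (sqrt 1 * C0 v)) *\<^sub>R p0 v"

definition sg :: "vertex \<Rightarrow> real" where
  "sg v = (if even (snd v div 2) then 1 else -1)"

definition rad_e :: "real \<Rightarrow> vertex \<Rightarrow> real" where
  "rad_e \<epsilon> v = sg v * ((S' \<epsilon> v + S \<epsilon> v) / (2 * sqrt (1 - \<epsilon>) * C \<epsilon> v))"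

definition rad_0 :: "vertex \<Rightarrow> real" where
  "rad_0 v = sg v * ((S0 v + S0 v) / (2 * sqrt 1 * C0 v))"

definition lam_e :: "real \<Rightarrow> real" where
  "lam_e \<epsilon> = (1 - (1 - \<epsilon>)\<^sup>2) / (4 * (1 - \<epsilon>))"

definition omega_e :: "real \<Rightarrow> vertex \<Rightarrow> vertex \<Rightarrow> real^3" where
  "omega_e \<epsilon> v w = (lam_e \<epsilon> / (rad_e \<epsilon> v * rad_e \<epsilon> w)) *\<^sub>R
     ((rad_e \<epsilon> v * rad_e \<epsilon> w / (rad_e \<epsilon> v * rad_e \<epsilon> w - lam_e \<epsilon>)) *\<^sub>R (net_e \<epsilon> w - net_e \<epsilon> v))"

lemma net_lim: "v \<in> s_verts Q \<Longrightarrow> ((\<lambda>\<epsilon>. net_e \<epsilon> v) \<longlongrightarrow> net_0 v) (at_right 0)"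
  unfolding net_e_def net_0_def using C0[of v]
  by (intro tendsto_scaleR tendsto_divide tendsto_mult tendsto_real_sqrt tendsto_const q_lim C p_lim) (auto simp: white_def)

lemma rad_lim: "v \<in> s_verts Q \<Longrightarrow> ((\<lambda>\<epsilon>. rad_e \<epsilon> v) \<longlongrightarrow> rad_0 v) (at_right 0)"
  unfolding rad_e_def rad_0_def using C0[of v]
  by (intro tendsto_add tendsto_divide tendsto_mult tendsto_real_sqrt tendsto_const q_lim C S S') (auto simp: white_def)

lemma rad_0_nonzero: "v \<in> s_verts Q \<Longrightarrow> rad_0 v \<noteq> 0"
  using C0[of v] S0[of v] by (simp add: rad_0_def sg_def white_def)

text \<open>By \<open>1 - (1 - \<epsilon>)\<^sup>2 = \<epsilon> * (2 - \<epsilon>)\<close> the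
  constant is of first order in \<open>\<epsilon>\<close>; its coefficient \<open>1 / 2\<close>
  becomes the duality constant of the limit surfaces.\<close>

lemma lam_lim: "((\<lambda>\<epsilon>. (1 / \<epsilon>) * lam_e \<epsilon>) \<longlongrightarrow> 1 / 2) (at_right 0)" "(lam_e \<longlongrightarrow> 0) (at_right 0)"
proof -
  have id: "((\<lambda>\<epsilon>::real. \<epsilon>) \<longlongrightarrow> 0) (at_right 0)" by (rule tendsto_ident_at)
  have "((\<lambda>\<epsilon>::real. (2 - \<epsilon>) / (4 * (1 - \<epsilon>))) \<longlongrightarrow> (2 - 0) / (4 * (1 - 0))) (at_right 0)"
    by (intro tendsto_intros id) simp
  moreover have "\<forall>\<^sub>F \<epsilon> in at_right (0::real). (1 / \<epsilon>) * lam_e \<epsilon> = (2 - \<epsilon>) / (4 * (1 - \<epsilon>))"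
    using eventually_at_right_less[of 0]
  proof eventually_elim
    case (elim \<epsilon>)
    have "1 - (1 - \<epsilon>)\<^sup>2 = \<epsilon> * (2 - \<epsilon>)" by (simp add: power2_eq_square algebra_simps)
    then show ?case using elim by (simp add: lam_e_def)
  qed
  ultimately show "((\<lambda>\<epsilon>. (1 / \<epsilon>) * lam_e \<epsilon>) \<longlongrightarrow> 1 / 2) (at_right 0)"
    by (simp add: tendsto_cong)
  have "(lam_e \<longlongrightarrow> (1 - (1 - 0)\<^sup>2) / (4 * (1 - 0))) (at_right 0)"
    unfolding lam_e_def by (intro tendsto_intros id) simp
  then show "(lam_e \<longlongrightarrow> 0) (at_right 0)" by simp
qed

lemma omega_lim:
  assumes "g_edge Q v w"
  shows "((\<lambda>\<epsilon>. (1 / \<epsilon>) *\<^sub>R omega_e \<epsilon> v w) \<longlongrightarrow> dual_form (1 / 2) net_0 rad_0 v w) (at_right 0)"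
proof -
  have s: "v \<in> s_verts Q" "w \<in> s_verts Q" using g_edge_verts[OF assms] by auto
  have n: "rad_0 v * rad_0 w \<noteq> 0" using rad_0_nonzero s by simp
  then have n': "rad_0 v * rad_0 w - 0 \<noteq> 0" by simp
  have "((\<lambda>\<epsilon>. ((1 / \<epsilon>) * lam_e \<epsilon> / (rad_e \<epsilon> v * rad_e \<epsilon> w)) *\<^sub>R
     ((rad_e \<epsilon> v * rad_e \<epsilon> w / (rad_e \<epsilon> v * rad_e \<epsilon> w - lam_e \<epsilon>)) *\<^sub>R (net_e \<epsilon> w - net_e \<epsilon> v)))
     \<longlongrightarrow> (1 / 2 / (rad_0 v * rad_0 w)) *\<^sub>R ((rad_0 v * rad_0 w / (rad_0 v * rad_0 w - 0)) *\<^sub>R (net_0 w - net_0 v))) (at_right 0)"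
    by (intro tendsto_scaleR tendsto_divide[OF lam_lim(1)] tendsto_divide[OF tendsto_mult] tendsto_mult tendsto_diff lam_lim rad_lim net_lim s n n')
  moreover have "(1 / \<epsilon>) *\<^sub>R omega_e \<epsilon> v w = ((1 / \<epsilon>) * lam_e \<epsilon> / (rad_e \<epsilon> v * rad_e \<epsilon> w)) *\<^sub>R
     ((rad_e \<epsilon> v * rad_e \<epsilon> w / (rad_e \<epsilon> v * rad_e \<epsilon> w - lam_e \<epsilon>)) *\<^sub>R (net_e \<epsilon> w - net_e \<epsilon> v))" for \<epsilon>
    unfolding omega_e_def by (subst scaleR_scaleR) (simp only: times_divide_eq_right)
  moreover have "(1 / 2 / (rad_0 v * rad_0 w)) *\<^sub>R ((rad_0 v * rad_0 w / (rad_0 v * rad_0 w - 0)) *\<^sub>R (net_0 w - net_0 v))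
      = dual_form (1 / 2) net_0 rad_0 v w"
    using n by (simp add: dual_form_def)
  ultimately show ?thesis by simp
qed

text \<open>The potential is taken of \<open>omega_e\<close> divided by \<open>\<epsilon>\<close>,
  which converges to the dual form of the Koebe net; using \<open>pot\<close> for all
  \<open>\<epsilon>\<close> chooses suitable translations. Multiplied by \<open>\<epsilon>\<close>
  it gives the centres of the second surface, which shrink to the origin, so those of the first tend
  to the Gauss map.\<close>

lemma cmc_family:
  obtains y :: "real \<Rightarrow> vertex \<Rightarrow> real^3" and m :: "vertex \<Rightarrow> real^3"
  where "\<forall>\<^sub>F \<epsilon> in at_right 0.
      (\<forall>\<mu>. \<mu> \<noteq> 0 \<longrightarrow>
        s1_cmc_pair Q (\<lambda>v. (\<mu> *\<^sub>R (net_e \<epsilon> v + y \<epsilon> v), \<mu> * rad_e \<epsilon> v)) (\<lambda>v. (\<mu> *\<^sub>R y \<epsilon> v, \<mu> * (lam_e \<epsilon> / rad_e \<epsilon> v))) \<and>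
        has_mean_curvature Q (\<lambda>v. \<mu> *\<^sub>R (net_e \<epsilon> v + y \<epsilon> v)) (\<lambda>v. y \<epsilon> v - (net_e \<epsilon> v + y \<epsilon> v)) (1 / \<mu>)) \<and>
      (\<forall>v\<in>s_verts Q. \<bar>rad_e \<epsilon> v\<bar> = (S' \<epsilon> v + S \<epsilon> v) / (2 * sqrt (1 - \<epsilon>) * C \<epsilon> v) \<and>
        \<bar>lam_e \<epsilon> / rad_e \<epsilon> v\<bar> = (S' \<epsilon> v - S \<epsilon> v) / (2 * sqrt (1 - \<epsilon>) * C \<epsilon> v))"
    and "koebe_net Q (\<lambda>v. (net_0 v, rad_0 v))" "s1_isothermic Q (\<lambda>v. (m v, 1 / 2 / rad_0 v))"
    and "christoffel_dual Q (1 / 2) (\<lambda>v. (net_0 v, rad_0 v)) (\<lambda>v. (m v, 1 / 2 / rad_0 v))"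
    and "\<And>v. ((\<lambda>\<epsilon>. (1 / \<epsilon>) *\<^sub>R y \<epsilon> v) \<longlongrightarrow> m v) (at_right 0)" "\<And>v. ((\<lambda>\<epsilon>. y \<epsilon> v) \<longlongrightarrow> 0) (at_right 0)"
proof -
  obtain pot :: "(vertex \<Rightarrow> vertex \<Rightarrow> real^3) \<Rightarrow> vertex \<Rightarrow> real^3" where
    pot: "\<And>\<omega> v w. closed_form Q \<omega> \<Longrightarrow> g_edge Q v w \<Longrightarrow> pot \<omega> w - pot \<omega> v = \<omega> v w"
    and pot_lim: "\<And>\<omega> \<omega>0 (F :: real filter) v. (\<And>v w. g_edge Q v w \<Longrightarrow> ((\<lambda>x. \<omega> x v w) \<longlongrightarrow> \<omega>0 v w) F) \<Longrightarrow>
           ((\<lambda>x. pot (\<omega> x) v) \<longlongrightarrow> pot \<omega>0 v) F"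
    by (rule exists_potential[OF graph]) blast
  define w0 where "w0 = dual_form (1 / 2) net_0 rad_0"
  define z where "z = (\<lambda>\<epsilon>. pot (\<lambda>v w. (1 / \<epsilon>) *\<^sub>R omega_e \<epsilon> v w))"
  define y where "y = (\<lambda>\<epsilon> v. \<epsilon> *\<^sub>R z \<epsilon> v)"
  interpret L: ring_config Q 1 p0 t0 C0 S0 S0 by (rule limit_config)
  have net0: "net_0 = L.net" by (simp add: fun_eq_iff net_0_def L.net_def)
  have rad0: "rad_0 = L.rad" by (simp add: fun_eq_iff rad_0_def L.rad_def L.dist_c_def sg_def L.sgn_v_def)
  have zlim: "((\<lambda>\<epsilon>. z \<epsilon> v) \<longlongrightarrow> pot w0 v) (at_right 0)" for v
    unfolding z_def w0_def by (rule pot_lim) (rule omega_lim)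
  have d0: "pot w0 w - pot w0 v = dual_form (1 / 2) net_0 rad_0 v w" if "g_edge Q v w" for v w
    unfolding w0_def net0 rad0 by (rule pot[OF dual_form_closed[OF L.koebe(1)] that]) simp_all
  show thesis
  proof (rule that)
    show "koebe_net Q (\<lambda>v. (net_0 v, rad_0 v))" unfolding net0 rad0 by (rule L.koebe(2)) simp
    show "s1_isothermic Q (\<lambda>v. (pot w0 v, 1 / 2 / rad_0 v))"
      unfolding rad0
      by (rule tangential_net_s1_isothermic, rule tangential_net_dual[OF L.koebe(1)]) (use d0 in \<open>simp_all add: net0 rad0\<close>)
    show "christoffel_dual Q (1 / 2) (\<lambda>v. (net_0 v, rad_0 v)) (\<lambda>v. (pot w0 v, 1 / 2 / rad_0 v))"
      unfolding christoffel_dual_def using d0 by (simp add: dual_form_def)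
    have "((\<lambda>\<epsilon>. y \<epsilon> v) \<longlongrightarrow> 0 *\<^sub>R pot w0 v) (at_right 0)" for v
      unfolding y_def by (intro tendsto_scaleR zlim tendsto_ident_at)
    then show "((\<lambda>\<epsilon>. y \<epsilon> v) \<longlongrightarrow> 0) (at_right 0)" for v by simp
    have "\<forall>\<^sub>F \<epsilon> in at_right 0. (1 / \<epsilon>) *\<^sub>R y \<epsilon> v = z \<epsilon> v" for v
      using eventually_at_right_less[of "0::real"] by eventually_elim (simp add: y_def)
    then show "((\<lambda>\<epsilon>. (1 / \<epsilon>) *\<^sub>R y \<epsilon> v) \<longlongrightarrow> pot w0 v) (at_right 0)" for v
      using zlim[of v] tendsto_cong by fast
    show "\<forall>\<^sub>F \<epsilon> in at_right 0.
      (\<forall>\<mu>. \<mu> \<noteq> 0 \<longrightarrow>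
        s1_cmc_pair Q (\<lambda>v. (\<mu> *\<^sub>R (net_e \<epsilon> v + y \<epsilon> v), \<mu> * rad_e \<epsilon> v)) (\<lambda>v. (\<mu> *\<^sub>R y \<epsilon> v, \<mu> * (lam_e \<epsilon> / rad_e \<epsilon> v))) \<and>
        has_mean_curvature Q (\<lambda>v. \<mu> *\<^sub>R (net_e \<epsilon> v + y \<epsilon> v)) (\<lambda>v. y \<epsilon> v - (net_e \<epsilon> v + y \<epsilon> v)) (1 / \<mu>)) \<and>
      (\<forall>v\<in>s_verts Q. \<bar>rad_e \<epsilon> v\<bar> = (S' \<epsilon> v + S \<epsilon> v) / (2 * sqrt (1 - \<epsilon>) * C \<epsilon> v) \<and>
        \<bar>lam_e \<epsilon> / rad_e \<epsilon> v\<bar> = (S' \<epsilon> v - S \<epsilon> v) / (2 * sqrt (1 - \<epsilon>) * C \<epsilon> v))"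
      using config eventually_at_right_less[of "0::real"]
    proof eventually_elim
      case (elim \<epsilon>)
      interpret R: ring_config Q "1 - \<epsilon>" "p \<epsilon>" "t \<epsilon>" "C \<epsilon>" "S \<epsilon>" "S' \<epsilon>" by (rule elim(1))
      have net: "net_e \<epsilon> = R.net" by (simp add: fun_eq_iff net_e_def R.net_def)
      have rad: "rad_e \<epsilon> = R.rad" by (simp add: fun_eq_iff rad_e_def R.rad_def R.dist_c_def sg_def R.sgn_v_def)
      have lam: "lam_e \<epsilon> = R.lam" by (simp add: lam_e_def R.lam_def)
      have om: "omega_e \<epsilon> = R.omega"
        by (simp add: fun_eq_iff omega_e_def R.omega_def R.theta_def net rad lam)
      have e: "0 < \<epsilon>" "\<epsilon> < 1" using elim(2) R.q(1) by auto
      have "(1 - \<epsilon>)\<^sup>2 < 1" using e by (simp add: power_less_one_iff)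
      then have l: "R.lam \<noteq> 0" using e by (simp add: R.lam_def)
      have cl: "closed_form Q (\<lambda>v w. (1 / \<epsilon>) *\<^sub>R R.omega v w)"
        using R.omega_closed[OF l] unfolding closed_form_def by (simp flip: scaleR_add_right)
      have yw: "y \<epsilon> w - y \<epsilon> v = R.omega v w" if "g_edge Q v w" for v w
        using pot[OF cl that] e unfolding y_def z_def om scaleR_diff_right[symmetric] by simp
      have "s1_cmc_pair Q (\<lambda>v. (\<mu> *\<^sub>R (R.net v + y \<epsilon> v), \<mu> * R.rad v)) (\<lambda>v. (\<mu> *\<^sub>R y \<epsilon> v, \<mu> * (R.lam / R.rad v))) \<and>
        has_mean_curvature Q (\<lambda>v. \<mu> *\<^sub>R (R.net v + y \<epsilon> v)) (\<lambda>v. y \<epsilon> v - (R.net v + y \<epsilon> v)) (1 / \<mu>)" if "\<mu> \<noteq> 0" for \<mu>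
        using R.cmc_pair[OF l yw that] by blast
      moreover have "\<bar>R.rad v\<bar> = (S' \<epsilon> v + S \<epsilon> v) / (2 * sqrt (1 - \<epsilon>) * C \<epsilon> v) \<and>
        \<bar>R.lam / R.rad v\<bar> = (S' \<epsilon> v - S \<epsilon> v) / (2 * sqrt (1 - \<epsilon>) * C \<epsilon> v)" if "v \<in> s_verts Q" for v
      proof -
        note d = R.len_dist[OF that]
        have a: "\<bar>R.rad v\<bar> = R.dist_c v" using d(1) by (simp add: R.rad_def R.sgn_v_def abs_mult)
        have b: "\<bar>R.lam / R.rad v\<bar> = R.lam / R.dist_c v" unfolding abs_divide a using d(6) by simp
        show ?thesis unfolding b unfolding a d(5) by (simp add: R.dist_c_def)
      qed
      ultimately show ?case unfolding net rad lam by blast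
    qed
  qed
qed

end

text \<open>By the limits of the Jacobi functions, for small \<open>\<epsilon>\<close> the sines of
  all inner radii and the cosines at s-vertices are positive. Nonpositive inner radii are thereby
  excluded, and all rings are ordered counterclockwise.\<close>

lemma circle_ring_limit:
  assumes graph: "s_quad_graph Q"
    and pattern: "circle_pattern_on Q P0"
    and variables: "circle_variables Q P0 \<beta>0"
    and finite_vertices: "\<And>v. v \<in> s_verts Q \<Longrightarrow> rad_out P0 v < pi / 2"
    and deformation: "ring_deformation Q D P0 \<beta>0 P \<beta>"
  shows "ring_limit Q (\<lambda>\<epsilon>. centre (P \<epsilon>)) (\<lambda>\<epsilon>. pt (P \<epsilon>)) (\<lambda>\<epsilon> v. cos (rad_in (P \<epsilon>) v))
    (\<lambda>\<epsilon> v. sin (rad_in (P \<epsilon>) v)) (\<lambda>\<epsilon> v. sin (rad_out (P \<epsilon>) v))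
    (\<lambda>v. cos (rad_out P0 v)) (\<lambda>v. sin (rad_out P0 v))"
proof -
  have ev: "\<forall>\<^sub>F \<epsilon> in at_right 0. ring_pattern_on Q (1 - \<epsilon>) (P \<epsilon>)" "\<forall>\<^sub>F \<epsilon> in at_right 0. ring_variables Q (1 - \<epsilon>) (P \<epsilon>) (\<beta> \<epsilon>)"
    using deformation unfolding ring_deformation_def by (auto elim: eventually_mono)
  have \<beta>: "((\<lambda>\<epsilon>. \<beta> \<epsilon> v) \<longlongrightarrow> \<beta>0 v) (at_right 0)" if "v \<in> white Q" for v
    using deformation that unfolding ring_deformation_def by blast
  have q1: "((\<lambda>\<epsilon>::real. 1 - \<epsilon>) \<longlongrightarrow> 1) (at_right 0)"
    using tendsto_diff[OF tendsto_const tendsto_ident_at, of 1 0 "{0<..}"] by simp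
  have q01: "\<forall>\<^sub>F \<epsilon> in at_right (0::real). 0 < 1 - \<epsilon> \<and> 1 - \<epsilon> < 1"
    using order_tendstoD(1)[OF q1, of 0] eventually_at_right_less[of "0::real"] by (simp add: eventually_conj)
  have lim: "((\<lambda>\<epsilon>. cos (rad_in (P \<epsilon>) v)) \<longlongrightarrow> cos (rad_out P0 v)) (at_right 0)"
    "((\<lambda>\<epsilon>. sin (rad_in (P \<epsilon>) v)) \<longlongrightarrow> sin (rad_out P0 v)) (at_right 0)"
    "((\<lambda>\<epsilon>. sin (rad_out (P \<epsilon>) v)) \<longlongrightarrow> sin (rad_out P0 v)) (at_right 0)" if v: "v \<in> white Q" for v
  proof -
    have c: "tanh (\<beta>0 v) = cos (rad_out P0 v)" "1 / cosh (\<beta>0 v) = sin (rad_out P0 v)"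
      using variables v by (auto simp: circle_variables_def)
    note j = jacobi_tendsto[OF q1 q01 \<beta>[OF v]]
    have e: "\<forall>\<^sub>F \<epsilon> in at_right 0. cos (rad_in (P \<epsilon>) v) = jacobi_sn (\<beta> \<epsilon> v) (1 - \<epsilon>)"
      "\<forall>\<^sub>F \<epsilon> in at_right 0. sin (rad_in (P \<epsilon>) v) = jacobi_cn (\<beta> \<epsilon> v) (1 - \<epsilon>)"
      "\<forall>\<^sub>F \<epsilon> in at_right 0. sin (rad_out (P \<epsilon>) v) = jacobi_dn (\<beta> \<epsilon> v) (1 - \<epsilon>)"
      using ev(2) v unfolding ring_variables_def by (auto elim!: eventually_mono)
    show "((\<lambda>\<epsilon>. cos (rad_in (P \<epsilon>) v)) \<longlongrightarrow> cos (rad_out P0 v)) (at_right 0)"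
      unfolding tendsto_cong[OF e(1)] c(1)[symmetric] by (rule j(1))
    show "((\<lambda>\<epsilon>. sin (rad_in (P \<epsilon>) v)) \<longlongrightarrow> sin (rad_out P0 v)) (at_right 0)"
      unfolding tendsto_cong[OF e(2)] c(2)[symmetric] by (rule j(2))
    show "((\<lambda>\<epsilon>. sin (rad_out (P \<epsilon>) v)) \<longlongrightarrow> sin (rad_out P0 v)) (at_right 0)"
      unfolding tendsto_cong[OF e(3)] c(2)[symmetric] by (rule j(3))
  qed
  have R: "0 < rad_out P0 v" "rad_out P0 v \<le> pi / 2" if "v \<in> white Q" for v
    using pattern that unfolding circle_pattern_on_def ring_pattern_on_def by blast+
  have S0: "0 < sin (rad_out P0 v)" if "v \<in> white Q" for v
    using R[OF that] pi_gt_zero by (intro sin_gt_zero) linarith+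
  have C0: "0 < cos (rad_out P0 v)" if "v \<in> s_verts Q" for v
    using R[of v] that finite_vertices[OF that] by (intro cos_gt_zero) (auto simp: white_def)
  \<comment> \<open>Finiteness lets one bound on \<open>\<epsilon>\<close> work for all
    vertices.\<close>
  have fin: "finite (white Q)"
  proof -
    have "finite (verts Q)" using graph by (auto simp: verts_def corners_def s_quad_graph_def)
    moreover have "white Q \<subseteq> verts Q" by (auto simp: white_def s_verts_def c_verts_def)
    ultimately show ?thesis by (rule rev_finite_subset)
  qed
  have pos: "\<forall>\<^sub>F \<epsilon> in at_right 0. \<forall>v\<in>white Q. 0 < sin (rad_in (P \<epsilon>) v)"
    using fin order_tendstoD(1)[OF lim(2) S0] by (auto simp: eventually_ball_finite_distrib)
  have s_pos: "\<forall>\<^sub>F \<epsilon> in at_right 0. \<forall>v\<in>s_verts Q. 0 < cos (rad_in (P \<epsilon>) v)"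
  proof -
    have "finite (s_verts Q)" using fin by (simp add: white_def)
    then show ?thesis
      using order_tendstoD(1)[OF lim(1) C0] by (auto simp: eventually_ball_finite_distrib white_def)
  qed
  show ?thesis
  proof
    show "s_quad_graph Q" by (rule graph)
    show "\<forall>\<^sub>F \<epsilon> in at_right 0. ring_config Q (1 - \<epsilon>) (centre (P \<epsilon>)) (pt (P \<epsilon>)) (\<lambda>v. cos (rad_in (P \<epsilon>) v))
       (\<lambda>v. sin (rad_in (P \<epsilon>) v)) (\<lambda>v. sin (rad_out (P \<epsilon>) v))"
      using ev(1) q01 pos s_pos
    proof eventually_elim
      case (elim \<epsilon>)
      show ?case
      proof (rule ring_pattern_config[OF graph elim(1)])
        show "1 - \<epsilon> < 1" using elim by blast
        show "0 < cos (rad_in (P \<epsilon>) v)" if "v \<in> s_verts Q" for v using elim that by blast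
        show "0 < rad_in (P \<epsilon>) v" if v: "v \<in> white Q" for v
        proof (rule ccontr)
          assume "\<not> 0 < rad_in (P \<epsilon>) v"
          moreover have "\<bar>rad_in (P \<epsilon>) v\<bar> \<le> rad_out (P \<epsilon>) v" "rad_out (P \<epsilon>) v \<le> pi / 2"
            using elim(1) v unfolding ring_pattern_on_def by blast+
          ultimately have "0 \<le> sin (- rad_in (P \<epsilon>) v)" using pi_gt_zero by (intro sin_ge_zero) linarith+
          then show False using elim v by (auto simp: not_less)
        qed
      qed
    qed
    show "\<exists>v\<in>white Q. \<exists>b\<in>black Q. (h_edge Q v b \<or> v_edge Q v b) \<and>
        convergent_at (\<lambda>\<epsilon>. centre (P \<epsilon>) v) \<and> convergent_at (\<lambda>\<epsilon>. pt (P \<epsilon>) b)"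
      using deformation unfolding ring_deformation_def convergent_at_def by blast
  qed (use lim S0 C0 in blast)+
qed

theorem theorem7p1:
  fixes Q :: "(int \<times> int) set" and D :: "vertex set"
    and P0 :: ring_pattern and \<beta>0 :: "vertex \<Rightarrow> real"
    and P :: "real \<Rightarrow> ring_pattern" and \<beta> :: "real \<Rightarrow> vertex \<Rightarrow> real"
  assumes graph: "s_quad_graph Q"
    and boundary: "D \<subseteq> boundary_white Q"
    and pattern: "circle_pattern_on Q P0"
    and variables: "circle_variables Q P0 \<beta>0"
    and finite_vertices: "\<And>v. v \<in> s_verts Q \<Longrightarrow> rad_out P0 v < pi / 2"
    and rigidity: "rigid Q D P0 \<beta>0"
    and deformation: "ring_deformation Q D P0 \<beta>0 P \<beta>"
  shows "\<exists>(s :: real \<Rightarrow> vertex \<Rightarrow> osphere) (s' :: real \<Rightarrow> vertex \<Rightarrow> osphere)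
           (k :: vertex \<Rightarrow> osphere) (m :: vertex \<Rightarrow> osphere).
     (\<forall>\<^sub>F \<epsilon> in at_right 0.
        associated_pair Q (1 - \<epsilon>) (P \<epsilon>) (\<beta> \<epsilon>) (s \<epsilon>) (s' \<epsilon>) \<and>
        s1_cmc_pair Q (\<lambda>v. (1 / \<epsilon>) *\<^sub>R s \<epsilon> v) (\<lambda>v. (1 / \<epsilon>) *\<^sub>R s' \<epsilon> v) \<and>
        has_mean_curvature Q (\<lambda>v. fst ((1 / \<epsilon>) *\<^sub>R s \<epsilon> v)) (\<lambda>v. fst (s' \<epsilon> v) - fst (s \<epsilon> v)) \<epsilon>) \<and>
     koebe_net Q k \<and> s1_minimal Q m \<and> (\<exists>l>0. christoffel_dual Q l k m) \<and>
     (\<forall>v\<in>s_verts Q.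
        ((\<lambda>\<epsilon>. s \<epsilon> v) \<longlongrightarrow> k v) (at_right 0) \<and>
        ((\<lambda>\<epsilon>. (1 / \<epsilon>) *\<^sub>R s' \<epsilon> v) \<longlongrightarrow> m v) (at_right 0))"
proof -
  interpret ring_limit Q "\<lambda>\<epsilon>. centre (P \<epsilon>)" "\<lambda>\<epsilon>. pt (P \<epsilon>)" "\<lambda>\<epsilon> v. cos (rad_in (P \<epsilon>) v)"
    "\<lambda>\<epsilon> v. sin (rad_in (P \<epsilon>) v)" "\<lambda>\<epsilon> v. sin (rad_out (P \<epsilon>) v)"
    "\<lambda>v. cos (rad_out P0 v)" "\<lambda>v. sin (rad_out P0 v)"
    by (rule circle_ring_limit[OF graph pattern variables finite_vertices deformation])
  obtain y m where
    pairs: "\<forall>\<^sub>F \<epsilon> in at_right 0.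
      (\<forall>\<mu>. \<mu> \<noteq> 0 \<longrightarrow>
        s1_cmc_pair Q (\<lambda>v. (\<mu> *\<^sub>R (net_e \<epsilon> v + y \<epsilon> v), \<mu> * rad_e \<epsilon> v)) (\<lambda>v. (\<mu> *\<^sub>R y \<epsilon> v, \<mu> * (lam_e \<epsilon> / rad_e \<epsilon> v))) \<and>
        has_mean_curvature Q (\<lambda>v. \<mu> *\<^sub>R (net_e \<epsilon> v + y \<epsilon> v)) (\<lambda>v. y \<epsilon> v - (net_e \<epsilon> v + y \<epsilon> v)) (1 / \<mu>)) \<and>
      (\<forall>v\<in>s_verts Q. \<bar>rad_e \<epsilon> v\<bar> = (sin (rad_out (P \<epsilon>) v) + sin (rad_in (P \<epsilon>) v)) / (2 * sqrt (1 - \<epsilon>) * cos (rad_in (P \<epsilon>) v)) \<and>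
        \<bar>lam_e \<epsilon> / rad_e \<epsilon> v\<bar> = (sin (rad_out (P \<epsilon>) v) - sin (rad_in (P \<epsilon>) v)) / (2 * sqrt (1 - \<epsilon>) * cos (rad_in (P \<epsilon>) v)))"
    and k: "koebe_net Q (\<lambda>v. (net_0 v, rad_0 v))" and iso: "s1_isothermic Q (\<lambda>v. (m v, 1 / 2 / rad_0 v))"
    and dual: "christoffel_dual Q (1 / 2) (\<lambda>v. (net_0 v, rad_0 v)) (\<lambda>v. (m v, 1 / 2 / rad_0 v))"
    and y: "\<And>v. ((\<lambda>\<epsilon>. (1 / \<epsilon>) *\<^sub>R y \<epsilon> v) \<longlongrightarrow> m v) (at_right 0)" "\<And>v. ((\<lambda>\<epsilon>. y \<epsilon> v) \<longlongrightarrow> 0) (at_right 0)"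
    by (rule cmc_family) blast
  \<comment> \<open>The centres differ by the Gauss map \<open>net_e\<close>, and at s-vertices the
    radii have the product \<open>lam_e\<close> for small \<open>\<epsilon>\<close>.\<close>
  define s where "s = (\<lambda>\<epsilon> v. (net_e \<epsilon> v + y \<epsilon> v, rad_e \<epsilon> v))"
  define s' where "s' = (\<lambda>\<epsilon> v. (y \<epsilon> v, lam_e \<epsilon> / rad_e \<epsilon> v))"
  have vars: "\<forall>\<^sub>F \<epsilon> in at_right 0. ring_variables Q (1 - \<epsilon>) (P \<epsilon>) (\<beta> \<epsilon>)"
    using deformation unfolding ring_deformation_def by (auto elim: eventually_mono)
  have "\<forall>\<^sub>F \<epsilon> in at_right 0.
        associated_pair Q (1 - \<epsilon>) (P \<epsilon>) (\<beta> \<epsilon>) (s \<epsilon>) (s' \<epsilon>) \<and>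
        s1_cmc_pair Q (\<lambda>v. (1 / \<epsilon>) *\<^sub>R s \<epsilon> v) (\<lambda>v. (1 / \<epsilon>) *\<^sub>R s' \<epsilon> v) \<and>
        has_mean_curvature Q (\<lambda>v. fst ((1 / \<epsilon>) *\<^sub>R s \<epsilon> v)) (\<lambda>v. fst (s' \<epsilon> v) - fst (s \<epsilon> v)) \<epsilon>"
    using pairs vars eventually_at_right_less[of "0::real"]
  proof eventually_elim
    case (elim \<epsilon>)
    \<comment> \<open>The choice \<open>\<mu> = 1\<close> gives the associated pair with mean
      curvature \<open>1\<close>, and \<open>\<mu> = 1 / \<epsilon>\<close> the scaled pair with
      mean curvature \<open>\<epsilon>\<close>.\<close>
    have mu: "s1_cmc_pair Q (\<lambda>v. \<mu> *\<^sub>R s \<epsilon> v) (\<lambda>v. \<mu> *\<^sub>R s' \<epsilon> v)"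
      "has_mean_curvature Q (\<lambda>v. fst (\<mu> *\<^sub>R s \<epsilon> v)) (\<lambda>v. fst (s' \<epsilon> v) - fst (s \<epsilon> v)) (1 / \<mu>)" if "\<mu> \<noteq> 0" for \<mu>
      using elim(1) that by (simp_all add: s_def s'_def)
    have "associated_pair Q (1 - \<epsilon>) (P \<epsilon>) (\<beta> \<epsilon>) (s \<epsilon>) (s' \<epsilon>)"
      unfolding associated_pair_def
    proof (intro conjI ballI)
      show "s1_cmc_pair Q (s \<epsilon>) (s' \<epsilon>)" using mu(1)[of 1] by simp
      show "has_mean_curvature Q (\<lambda>v. fst (s \<epsilon> v)) (\<lambda>v. fst (s' \<epsilon> v) - fst (s \<epsilon> v)) 1" using mu(2)[of 1] by simp
      fix v assume v: "v \<in> s_verts Q"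
      have vr: "cos (rad_in (P \<epsilon>) v) = jacobi_sn (\<beta> \<epsilon> v) (1 - \<epsilon>)" "sin (rad_in (P \<epsilon>) v) = jacobi_cn (\<beta> \<epsilon> v) (1 - \<epsilon>)"
        "sin (rad_out (P \<epsilon>) v) = jacobi_dn (\<beta> \<epsilon> v) (1 - \<epsilon>)"
        using elim(2) v unfolding ring_variables_def white_def by blast+
      show "fst (s \<epsilon> v) - fst (s' \<epsilon> v) = koebe_vertex (1 - \<epsilon>) (P \<epsilon>) v"
        by (simp add: s_def s'_def net_e_def koebe_vertex_def)
      show "\<bar>snd (s \<epsilon> v)\<bar> = 1 / (2 * sqrt (1 - \<epsilon>)) * ((jacobi_dn (\<beta> \<epsilon> v) (1 - \<epsilon>) + jacobi_cn (\<beta> \<epsilon> v) (1 - \<epsilon>)) / jacobi_sn (\<beta> \<epsilon> v) (1 - \<epsilon>))"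
        "\<bar>snd (s' \<epsilon> v)\<bar> = 1 / (2 * sqrt (1 - \<epsilon>)) * ((jacobi_dn (\<beta> \<epsilon> v) (1 - \<epsilon>) - jacobi_cn (\<beta> \<epsilon> v) (1 - \<epsilon>)) / jacobi_sn (\<beta> \<epsilon> v) (1 - \<epsilon>))"
      proof -
        have "\<bar>rad_e \<epsilon> v\<bar> = (sin (rad_out (P \<epsilon>) v) + sin (rad_in (P \<epsilon>) v)) / (2 * sqrt (1 - \<epsilon>) * cos (rad_in (P \<epsilon>) v))"
          "\<bar>lam_e \<epsilon> / rad_e \<epsilon> v\<bar> = (sin (rad_out (P \<epsilon>) v) - sin (rad_in (P \<epsilon>) v)) / (2 * sqrt (1 - \<epsilon>) * cos (rad_in (P \<epsilon>) v))"
          using elim(1) v by blast+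
        then show "\<bar>snd (s \<epsilon> v)\<bar> = 1 / (2 * sqrt (1 - \<epsilon>)) * ((jacobi_dn (\<beta> \<epsilon> v) (1 - \<epsilon>) + jacobi_cn (\<beta> \<epsilon> v) (1 - \<epsilon>)) / jacobi_sn (\<beta> \<epsilon> v) (1 - \<epsilon>))"
          "\<bar>snd (s' \<epsilon> v)\<bar> = 1 / (2 * sqrt (1 - \<epsilon>)) * ((jacobi_dn (\<beta> \<epsilon> v) (1 - \<epsilon>) - jacobi_cn (\<beta> \<epsilon> v) (1 - \<epsilon>)) / jacobi_sn (\<beta> \<epsilon> v) (1 - \<epsilon>))"
          unfolding s_def s'_def snd_conv vr by (simp_all only: times_divide_times_eq mult_1)
      qed
    qed
    then show ?case using mu[of "1 / \<epsilon>"] elim(3) by simp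
  qed
  moreover have "s1_minimal Q (\<lambda>v. (m v, 1 / 2 / rad_0 v))"
    unfolding s1_minimal_def using iso k dual by (meson half_gt_zero zero_less_one)
  moreover have "((\<lambda>\<epsilon>. s \<epsilon> v) \<longlongrightarrow> (net_0 v, rad_0 v)) (at_right 0)"
    "((\<lambda>\<epsilon>. (1 / \<epsilon>) *\<^sub>R s' \<epsilon> v) \<longlongrightarrow> (m v, 1 / 2 / rad_0 v)) (at_right 0)" if v: "v \<in> s_verts Q" for v
  proof -
    show "((\<lambda>\<epsilon>. s \<epsilon> v) \<longlongrightarrow> (net_0 v, rad_0 v)) (at_right 0)"
      unfolding s_def using tendsto_add[OF net_lim[OF v] y(2)[of v]] by (intro tendsto_Pair rad_lim[OF v]) simp
    show "((\<lambda>\<epsilon>. (1 / \<epsilon>) *\<^sub>R s' \<epsilon> v) \<longlongrightarrow> (m v, 1 / 2 / rad_0 v)) (at_right 0)"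
      unfolding s'_def scaleR_Pair real_scaleR_def
      using tendsto_divide[OF lam_lim(1) rad_lim[OF v] rad_0_nonzero[OF v]]
      by (intro tendsto_Pair y(1)) simp
  qed
  ultimately show ?thesis
    using k dual by (intro exI[of _ s] exI[of _ s'] exI[of _ "\<lambda>v. (net_0 v, rad_0 v)"] exI[of _ "\<lambda>v. (m v, 1 / 2 / rad_0 v)"] conjI
        exI[of _ "1 / 2 :: real"] ballI) simp_all
qed

end
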